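(* Let $H$ be a real separable Hilbert space and let $\lambda$ be a (countably additive, finite) signed Borel measure on $(\mathcal{P}_2(H),W_2)$ with $$\lambda(\mathcal{P}_2(H))=1\qquad\text{and}\qquad \int_{\mathcal{P}_2(H)} m_2^2(\nu)\,\mathrm{d}|\lambda|(\nu)<\infty .$$ Define $\mathscr{E}:\mathcal{P}_2(H)\to\mathbb{R}$ by $$\mathscr{E}(\mu)=\int_{\mathcal{P}_2(H)} W_2^2(\mu,\nu)\,\mathrm{d}\lambda(\nu).$$ Then: (i) There exists a solution $\bar\mu\in\mathcal{P}_2(H)$ of the problem $\min_{\mu\in\mathcal{P}_2(H)}\mathscr{E}(\mu)$. (ii) If, in particular, $\operatorname{supp}(\lambda^+)$ is an atom, i.e. $\lambda^+$ is concentrated on a single measure $\nu_0\in\mathcal{P}_2(H)$, then there exists a unique minimizer $\bar\mu\in\mathcal{P}_2(H)$ of $\mathscr{E}$.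
   Context: $\mathcal{P}_2(H)$ is the set of Borel probability measures $\mu$ on $H$ with finite second moment $m_2^2(\mu):=\int_H|x|^2\,\mathrm{d}\mu(x)<\infty$, endowed with the 2-Wasserstein distance $W_2(\mu,\nu)=\min\{(\int_{H\times H}|x-y|^2\,\mathrm{d}\gamma(x,y))^{1/2}:\gamma\in\Gamma(\mu,\nu)\}$, where $\Gamma(\mu,\nu)$ is the set of Borel probability measures on $H\times H$ with first marginal $\mu$ and second marginal $\nu$. For a signed measure $\lambda$ on the Borel $\sigma$-algebra of $(\mathcal{P}_2(H),W_2)$, $\lambda=\lambda^+-\lambda^-$ is its Hahn-Jordan decomposition, $|\lambda|=\lambda^++\lambda^-$, and $\int f\,\mathrm{d}\lambda:=\int f\,\mathrm{d}\lambda^+-\int f\,\mathrm{d}\lambda^-$ for $f\in L^1(|\lambda|)$. *)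

theory Defs
  imports "HOL-Probability.Probability"
begin

section \<open>Signed measures on a measurable space\<close>

definition signed_measure :: "'b measure \<Rightarrow> ('b set \<Rightarrow> real) \<Rightarrow> bool" where
  "signed_measure M \<sigma> \<longleftrightarrow>
     \<sigma> {} = 0 \<and>
     (\<forall>A::nat \<Rightarrow> 'b set. range A \<subseteq> sets M \<longrightarrow> disjoint_family A \<longrightarrow>
        (\<lambda>i. \<sigma> (A i)) sums \<sigma> (\<Union>i. A i))"

definition is_hahn_set :: "'b measure \<Rightarrow> ('b set \<Rightarrow> real) \<Rightarrow> 'b set \<Rightarrow> bool" where
  "is_hahn_set M \<sigma> P \<longleftrightarrow>
     P \<in> sets M \<and>
     (\<forall>B\<in>sets M. B \<subseteq> P \<longrightarrow> 0 \<le> \<sigma> B) \<and>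
     (\<forall>B\<in>sets M. B \<subseteq> space M - P \<longrightarrow> \<sigma> B \<le> 0)"

text \<open>By the Hahn decomposition theorem such a set exists for every signed measure; it is
  unique only up to null sets, but the measures below do not depend on the choice.\<close>

definition hahn_set :: "'b measure \<Rightarrow> ('b set \<Rightarrow> real) \<Rightarrow> 'b set" where
  "hahn_set M \<sigma> = (SOME P. is_hahn_set M \<sigma> P)"

definition pos_part :: "'b measure \<Rightarrow> ('b set \<Rightarrow> real) \<Rightarrow> 'b measure" where
  "pos_part M \<sigma> =
     measure_of (space M) (sets M) (\<lambda>A. ennreal (\<sigma> (A \<inter> hahn_set M \<sigma>)))"

definition neg_part :: "'b measure \<Rightarrow> ('b set \<Rightarrow> real) \<Rightarrow> 'b measure" where
  "neg_part M \<sigma> =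
     measure_of (space M) (sets M) (\<lambda>A. ennreal (- \<sigma> (A - hahn_set M \<sigma>)))"

definition total_variation :: "'b measure \<Rightarrow> ('b set \<Rightarrow> real) \<Rightarrow> 'b measure" where
  "total_variation M \<sigma> =
     measure_of (space M) (sets M)
       (\<lambda>A. emeasure (pos_part M \<sigma>) A + emeasure (neg_part M \<sigma>) A)"

definition signed_integral :: "'b measure \<Rightarrow> ('b set \<Rightarrow> real) \<Rightarrow> ('b \<Rightarrow> real) \<Rightarrow> real" where
  "signed_integral M \<sigma> f =
     (\<integral>x. f x \<partial>pos_part M \<sigma>) - (\<integral>x. f x \<partial>neg_part M \<sigma>)"


section \<open>The 2-Wasserstein space over a separable Hilbert space\<close>

text \<open>A real separable Hilbert space is a type of sort \<open>{real_inner, polish_space}\<close>: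
  \<open>polish_space\<close> is \<open>complete_space\<close> together with \<open>second_countable_topology\<close>, and the
  latter is separability, because the topology is that of the norm.\<close>

definition m2sq :: "'a::{real_inner, polish_space} measure \<Rightarrow> ennreal" where
  "m2sq \<mu> = (\<integral>\<^sup>+x. ennreal ((norm x)\<^sup>2) \<partial>\<mu>)"

definition P2 :: "'a::{real_inner, polish_space} measure set" where
  "P2 = {\<mu>. prob_space \<mu> \<and> sets \<mu> = sets borel \<and> m2sq \<mu> < \<infinity>}"

definition couplings ::
  "'a::{real_inner, polish_space} measure \<Rightarrow> 'a measure \<Rightarrow> ('a \<times> 'a) measure set" where
  "couplings \<mu> \<nu> =
     {\<gamma>. prob_space \<gamma> \<and> sets \<gamma> = sets borel \<and>
          distr \<gamma> borel fst = \<mu> \<and> distr \<gamma> borel snd = \<nu>}"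

text \<open>For \<open>\<mu>\<close> and \<open>\<nu>\<close> in \<open>P2\<close> the set of couplings is nonempty (product measure), every
  coupling has finite cost, and the infimum is a minimum; so \<open>enn2real\<close> loses nothing there.\<close>

definition W2 :: "'a::{real_inner, polish_space} measure \<Rightarrow> 'a measure \<Rightarrow> real" where
  "W2 \<mu> \<nu> =
     sqrt (enn2real (INF \<gamma>\<in>couplings \<mu> \<nu>. \<integral>\<^sup>+z. ennreal ((norm (fst z - snd z))\<^sup>2) \<partial>\<gamma>))"

definition borel_P2 :: "'a::{real_inner, polish_space} measure measure" where
  "borel_P2 = sigma P2 {U. openin (Metric_space.mtopology P2 W2) U}"

definition wass_energy ::
  "('a::{real_inner, polish_space} measure set \<Rightarrow> real) \<Rightarrow> 'a measure \<Rightarrow> real" where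
  "wass_energy \<sigma> \<mu> = signed_integral borel_P2 \<sigma> (\<lambda>\<nu>. (W2 \<mu> \<nu>)\<^sup>2)"

end

theory Submission imports Defs begin

text \<open>Expanding the square, \<open>W2(\<mu>,\<nu>)\<^sup>2 = m(\<mu>) + m(\<nu>) + corr \<mu> \<nu>\<close> with \<open>m\<close> the second moment, and since the
  total mass is one the energy is \<open>m(\<mu>)\<close> plus a constant plus \<open>\<integral> corr \<mu> \<nu> d\<sigma>(\<nu>)\<close>. As
  \<open>\<bar>corr \<mu> \<nu>\<bar> \<le> t m(\<mu>) + m(\<nu>)/t\<close>, the energy is coercive. A minimizing sequence therefore has a
  subsequence represented by random variables \<open>Z n\<close> converging weakly in \<open>H\<close> almost surely; along it
  \<open>corr\<close> converges for every \<open>\<nu>\<close>, whatever the sign of \<open>\<sigma>\<close>, while \<open>m\<close> is lower semicontinuous.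

  When the positive part is an atom at \<open>\<nu>\<^sub>0\<close>, glue near-optimal couplings of two minimizers along
  \<open>\<nu>\<^sub>0\<close> and take the law of the midpoint. The parallelogram identity with respect to \<open>\<nu>\<^sub>0\<close> gains
  \<open>\<sigma>\<^sup>+(P2)\<close> times a quarter of the squared distance and the negative part loses at most
  \<open>\<sigma>\<^sup>-(P2)\<close> times it, so the mass difference one gives strict convexity.

  Optimal couplings and disintegration are avoided: couplings are only near-optimal and are glued
  along a countable partition into small cells.\<close>

section \<open>The Hahn decomposition of a signed measure\<close>

text \<open>The obstacle is the negative part: along weakly convergent sequences \<open>W2\<close>
  squared is in general only lower semicontinuous, so subtracting it could destroy the
  semicontinuity of the energy. The defect sits in the moment of the moving measure alone, whose
  coefficient is exactly the total mass one. What remains, \<open>corr\<close>, pairs the moving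
  variable with a partner of fixed law. As the near-optimal partner changes along the sequence, its
  convergence needs an estimate uniform over all couplings.

  Bounded moments give no compactness for the norm topology when H is infinite dimensional. Points
  are therefore coded by reals from which membership in half-spaces with rational thresholds can be
  read; convergence of the codes then settles all inner products with a dense sequence. Balls enter
  the code only to make it decodable.

  Uniqueness is asymmetric: the lower bound for the distance from the midpoint holds for every
  coupling of the endpoints and all \<nu> at once, whereas the matching upper bound needs the
  endpoints coupled through the one \<nu> in question. Hence the positive part has to be a single
  atom.\<close>

lemma signed_measureD:
  assumes "signed_measure M \<sigma>"
  shows "\<sigma> {} = 0"
    and "\<And>A::nat \<Rightarrow> 'b set. range A \<subseteq> sets M \<Longrightarrow> disjoint_family A \<Longrightarrow> (\<lambda>i. \<sigma> (A i)) sums \<sigma> (\<Union>i. A i)"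
  using assms unfolding signed_measure_def by auto

lemma signed_measure_Un:
  assumes "signed_measure M \<sigma>" "A \<in> sets M" "B \<in> sets M" "A \<inter> B = {}"
  shows "\<sigma> (A \<union> B) = \<sigma> A + \<sigma> B"
proof -
  let ?C = "binaryset A B"
  have "(\<lambda>i. \<sigma> (?C i)) sums \<sigma> (\<Union>i. ?C i)"
    by (rule signed_measureD(2)[OF assms(1)])
       (use assms in \<open>auto simp: binaryset_def disjoint_family_on_def\<close>)
  moreover have "(\<lambda>i. \<sigma> (?C i)) sums (\<sigma> A + \<sigma> B)"
    by (rule binaryset_sums) (simp add: signed_measureD(1)[OF assms(1)])
  ultimately show ?thesis
    by (simp add: UN_binaryset_eq sums_iff)
qed

lemma signed_measure_Diff:
  assumes "signed_measure M \<sigma>" "A \<in> sets M" "B \<in> sets M" "B \<subseteq> A"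
  shows "\<sigma> (A - B) = \<sigma> A - \<sigma> B"
proof -
  have "\<sigma> ((A - B) \<union> B) = \<sigma> (A - B) + \<sigma> B"
    using assms by (intro signed_measure_Un) auto
  moreover have "(A - B) \<union> B = A" using assms(4) by auto
  ultimately show ?thesis by simp
qed

text \<open>The differences \<open>A n - A (Suc n)\<close> partition \<open>A 0\<close> minus the
  intersection, so countable additivity becomes a telescoping series.\<close>

lemma signed_measure_decseq:
  assumes \<sigma>: "signed_measure M \<sigma>" and A: "\<And>n. A n \<in> sets M" "\<And>n. A (Suc n) \<subseteq> A n"
  shows "(\<lambda>n. \<sigma> (A n)) \<longlonglongrightarrow> \<sigma> (\<Inter>n. A n)"
proof -
  define C where "C n = A n - A (Suc n)" for n
  have dec: "m \<le> n \<Longrightarrow> A n \<subseteq> A m" for m n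
    using A(2) by (rule lift_Suc_antimono_le)
  have C: "range C \<subseteq> sets M" "disjoint_family C"
  proof -
    show "range C \<subseteq> sets M" using A by (auto simp: C_def)
    have "C m \<inter> C n = {}" if "m < n" for m n
      using dec[of "Suc m" n] that by (auto simp: C_def)
    then show "disjoint_family C"
      unfolding disjoint_family_on_def by (metis Int_commute nat_neq_iff)
  qed
  have un: "(\<Union>n. C n) = A 0 - (\<Inter>n. A n)"
  proof -
    have "x \<in> (\<Union>n. C n)" if "x \<in> A 0" "x \<notin> A k" for x k
      using that
    proof (induction k)
      case (Suc k) then show ?case by (cases "x \<in> A k") (auto simp: C_def)
    qed auto
    moreover have "C n \<subseteq> A 0 - (\<Inter>n. A n)" for n using dec[of 0 n] by (auto simp: C_def)
    ultimately show ?thesis by blast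
  qed
  have part: "(\<Sum>i<n. \<sigma> (C i)) = \<sigma> (A 0) - \<sigma> (A n)" for n
    using sum_lessThan_telescope'[of "\<lambda>i. \<sigma> (A i)" n]
    by (simp add: C_def signed_measure_Diff[OF \<sigma> A(1) A(1) A(2)])
  have "(\<Inter>n. A n) \<in> sets M" using A by auto
  then have "\<sigma> (\<Union>n. C n) = \<sigma> (A 0) - \<sigma> (\<Inter>n. A n)"
    unfolding un using A by (intro signed_measure_Diff[OF \<sigma>]) auto
  with signed_measureD(2)[OF \<sigma> C]
  have "(\<lambda>n. \<sigma> (A 0) - \<sigma> (A n)) \<longlonglongrightarrow> \<sigma> (A 0) - \<sigma> (\<Inter>n. A n)"
    by (simp add: sums_def part)
  from tendsto_diff[OF tendsto_const[of "\<sigma> (A 0)"] this] show ?thesis by simp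
qed

definition positive_set :: "'b measure \<Rightarrow> ('b set \<Rightarrow> real) \<Rightarrow> 'b set \<Rightarrow> bool" where
  "positive_set M \<sigma> P \<longleftrightarrow> P \<in> sets M \<and> (\<forall>B\<in>sets M. B \<subseteq> P \<longrightarrow> 0 \<le> \<sigma> B)"

text \<open>Disjointing the \<open>P n\<close> splits any measurable part of the union into
  countably many pieces, each inside one \<open>P n\<close>.\<close>

lemma positive_set_UN:
  assumes \<sigma>: "signed_measure M \<sigma>" and P: "\<And>n::nat. positive_set M \<sigma> (P n)"
  shows "positive_set M \<sigma> (\<Union>n. P n)"
  unfolding positive_set_def
proof safe
  show "(\<Union>n. P n) \<in> sets M" using P by (auto simp: positive_set_def)
  fix B assume B: "B \<in> sets M" "B \<subseteq> (\<Union>n. P n)"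
  let ?C = "\<lambda>n. B \<inter> disjointed P n"
  have dP: "range (disjointed P) \<subseteq> sets M"
    by (rule sets.range_disjointed_sets) (use P in \<open>auto simp: positive_set_def\<close>)
  have "(\<lambda>i. \<sigma> (?C i)) sums \<sigma> (\<Union>i. ?C i)"
    using dP B disjoint_family_disjointed[of P]
    by (intro signed_measureD(2)[OF \<sigma>]) (auto intro: disjoint_family_on_bisimulation)
  moreover have "(\<Union>i. ?C i) = B"
    using B(2) UN_disjointed_eq[of P] by auto
  moreover have "0 \<le> \<sigma> (?C i)" for i
  proof -
    have "?C i \<in> sets M" using B dP by (intro sets.Int) auto
    moreover have "?C i \<subseteq> P i" using disjointed_subset[of P i] by blast
    ultimately show ?thesis using P[of i] unfolding positive_set_def by blast
  qed
  ultimately show "0 \<le> \<sigma> B"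
    using sums_le[of "\<lambda>_. 0" "\<lambda>i. \<sigma> (?C i)" 0 "\<sigma> B"] sums_zero by simp
qed

lemma positive_set_mono:
  assumes \<sigma>: "signed_measure M \<sigma>" and "positive_set M \<sigma> P" "B \<in> sets M" "B \<subseteq> P"
  shows "\<sigma> B \<le> \<sigma> P"
proof -
  have "\<sigma> (P - B) = \<sigma> P - \<sigma> B" "0 \<le> \<sigma> (P - B)"
    using assms by (auto intro!: signed_measure_Diff simp: positive_set_def)
  then show ?thesis by simp
qed

text \<open>Otherwise infinitely many disjoint sets of measure below \<open>- e\<close> could be split off.\<close>
lemma almost_positive_subset:
  assumes \<sigma>: "signed_measure M \<sigma>" and A: "A \<in> sets M" and e: "0 < e"
  shows "\<exists>B\<in>sets M. B \<subseteq> A \<and> \<sigma> A \<le> \<sigma> B \<and> (\<forall>C\<in>sets M. C \<subseteq> B \<longrightarrow> - e \<le> \<sigma> C)"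
proof (rule ccontr)
  assume neg: "\<not> ?thesis"
  define good where "good B \<longleftrightarrow> B \<in> sets M \<and> B \<subseteq> A \<and> \<sigma> A \<le> \<sigma> B" for B
  have "\<exists>C. C \<in> sets M \<and> C \<subseteq> B \<and> \<sigma> C < - e" if "good B" for B
    using neg that unfolding good_def by (meson not_le)
  then obtain c where c: "\<And>B. good B \<Longrightarrow> c B \<in> sets M \<and> c B \<subseteq> B \<and> \<sigma> (c B) < - e" by metis
  \<comment> \<open>Removing a set of negative measure only increases \<sigma>, so the removal can
    be repeated forever.\<close>
  have step: "good (B - c B)" if "good B" for B
    using that c[OF that] signed_measure_Diff[OF \<sigma>, of B "c B"] e unfolding good_def by auto
  define D where "D n = ((\<lambda>B. B - c B) ^^ n) A" for n
  have D: "good (D n)" for n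
    by (induction n) (use A step in \<open>auto simp: D_def good_def\<close>)
  have DS: "D (Suc n) = D n - c (D n)" for n by (simp add: D_def)
  have dec: "m \<le> n \<Longrightarrow> D n \<subseteq> D m" for m n
    by (rule lift_Suc_antimono_le) (auto simp: DS)
  have "c (D m) \<inter> c (D n) = {}" if "m < n" for m n
    using dec[of "Suc m" n] that c[OF D[of n]] by (auto simp: DS)
  then have "disjoint_family (\<lambda>n. c (D n))"
    unfolding disjoint_family_on_def by (metis Int_commute nat_neq_iff)
  then have "(\<lambda>n. \<sigma> (c (D n))) sums \<sigma> (\<Union>n. c (D n))"
    using c D by (intro signed_measureD(2)[OF \<sigma>]) auto
  \<comment> \<open>The sum over the disjoint removed sets is a real number, so its terms tend to 0,
    although each is below \<open>- e\<close>.\<close>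
  then have "(\<lambda>n. \<sigma> (c (D n))) \<longlonglongrightarrow> 0"
    by (intro summable_LIMSEQ_zero) (auto simp: sums_iff)
  then have "0 \<le> - e"
    by (rule LIMSEQ_le_const2) (use c D in \<open>auto intro!: exI[of _ 0] less_imp_le\<close>)
  then show False using e by simp
qed

text \<open>Shrinking repeatedly with tolerance 1/(n+1) makes the intersection satisfy every
  tolerance at once, hence positive; continuity along decreasing sequences preserves the lower bound
  \<open>\<sigma> A\<close>.\<close>

lemma positive_subset:
  assumes \<sigma>: "signed_measure M \<sigma>" and A: "A \<in> sets M"
  shows "\<exists>P. positive_set M \<sigma> P \<and> P \<subseteq> A \<and> \<sigma> A \<le> \<sigma> P"
proof -
  define good where "good n E B \<longleftrightarrow> B \<in> sets M \<and> B \<subseteq> E \<and> \<sigma> E \<le> \<sigma> B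
      \<and> (\<forall>C\<in>sets M. C \<subseteq> B \<longrightarrow> - (1 / real (Suc n)) \<le> \<sigma> C)" for n E B
  define b where "b n E = (SOME B. good n E B)" for n E
  have "good n E (b n E)" if "E \<in> sets M" for n E
  proof -
    have "\<exists>B. good n E B"
      using almost_positive_subset[OF \<sigma> that, of "1 / real (Suc n)"]
      unfolding good_def Bex_def by simp
    then show ?thesis unfolding b_def by (rule someI_ex)
  qed
  then have b: "b n E \<in> sets M" "b n E \<subseteq> E" "\<sigma> E \<le> \<sigma> (b n E)"
    "\<And>C. C \<in> sets M \<Longrightarrow> C \<subseteq> b n E \<Longrightarrow> - (1 / real (Suc n)) \<le> \<sigma> C" if "E \<in> sets M" for E n
    using that unfolding good_def by blast+
  define D where "D = rec_nat A b"
  have DS: "D 0 = A" "D (Suc n) = b n (D n)" for n by (simp_all add: D_def)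
  have Dm: "D n \<in> sets M" for n by (induction n) (use A b in \<open>auto simp: DS\<close>)
  have Dd: "D (Suc n) \<subseteq> D n" for n using b(2)[OF Dm] by (simp add: DS)
  have Ds: "\<sigma> A \<le> \<sigma> (D n)" for n
  proof (induction n)
    case (Suc n)
    then show ?case using b(3)[OF Dm, of n n] by (simp add: DS)
  qed (simp add: DS)
  have lim: "(\<lambda>n. \<sigma> (D n)) \<longlonglongrightarrow> \<sigma> (\<Inter>n. D n)"
    by (rule signed_measure_decseq[of M \<sigma> D, OF \<sigma> Dm Dd])
  have "0 \<le> \<sigma> C" if C: "C \<in> sets M" "C \<subseteq> (\<Inter>n. D n)" for C
  proof -
    have "- (1 / real (Suc n)) \<le> \<sigma> C" for n
    proof -
      have "C \<subseteq> b n (D n)" using C(2) DS(2)[of n] by blast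
      then show ?thesis by (rule b(4)[OF Dm C(1)])
    qed
    moreover have "(\<lambda>n. - (1 / real (Suc n))) \<longlonglongrightarrow> - 0"
      by (intro tendsto_minus LIMSEQ_Suc[OF lim_1_over_n])
    ultimately show ?thesis using LIMSEQ_le_const2[of "\<lambda>n. - (1 / real (Suc n))" "- 0" "\<sigma> C"] by simp
  qed
  then have "positive_set M \<sigma> (\<Inter>n. D n)"
    using Dm by (auto simp: positive_set_def)
  moreover have "\<sigma> A \<le> \<sigma> (\<Inter>n. D n)"
    by (rule LIMSEQ_le_const[OF lim]) (use Ds in auto)
  moreover have "(\<Inter>n. D n) \<subseteq> A" using DS(1) by blast
  ultimately show ?thesis by blast
qed

text \<open>The supremum of \<sigma> over positive sets is attained by a countable union of
  near-maximal ones. Outside such a maximal set nothing of positive measure can survive, since its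
  positive part could be adjoined.\<close>

lemma ex_hahn_set:
  assumes \<sigma>: "signed_measure M \<sigma>"
  shows "\<exists>P. is_hahn_set M \<sigma> P"
proof -
  let ?S = "\<sigma> ` {P. positive_set M \<sigma> P}"
  have e: "positive_set M \<sigma> {}" using signed_measureD(1)[OF \<sigma>] by (auto simp: positive_set_def)
  \<comment> \<open>Otherwise a union of positive sets of measure above every n would be a positive
    set whose real measure exceeds all n.\<close>
  have bdd: "bdd_above ?S"
  proof (rule ccontr)
    assume "\<not> bdd_above ?S"
    then have "\<exists>P. positive_set M \<sigma> P \<and> real n < \<sigma> P" for n
      unfolding bdd_above_def by (auto simp: not_le)
    then obtain P where P: "\<And>n. positive_set M \<sigma> (P n)" "\<And>n. real n < \<sigma> (P n)" by metis
    have "real n < \<sigma> (\<Union>n. P n)" for n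
      using P(2)[of n] positive_set_mono[OF \<sigma> positive_set_UN[of M \<sigma> P, OF \<sigma> P(1)], of "P n"] P(1)[of n]
        UN_upper[of n UNIV P]
      by (simp add: positive_set_def)
    then show False by (meson less_asym reals_Archimedean2)
  qed
  have "\<exists>P. positive_set M \<sigma> P \<and> Sup ?S - 1 / real (Suc n) < \<sigma> P" for n
    using less_cSup_iff[OF _ bdd, of "Sup ?S - 1 / real (Suc n)"] e by auto
  then obtain P where P: "\<And>n. positive_set M \<sigma> (P n)" "\<And>n. Sup ?S - 1 / real (Suc n) < \<sigma> (P n)"
    by metis
  define Q where "Q = (\<Union>n. P n)"
  have Q: "positive_set M \<sigma> Q" unfolding Q_def by (rule positive_set_UN[OF \<sigma> P(1)])
  have "Sup ?S - 1 / real (Suc n) \<le> \<sigma> Q" for n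
    using P(2)[of n] positive_set_mono[OF \<sigma> Q, of "P n"] P(1)[of n] UN_upper[of n UNIV P, folded Q_def]
    by (simp add: positive_set_def)
  moreover have "(\<lambda>n. Sup ?S - 1 / real (Suc n)) \<longlonglongrightarrow> Sup ?S - 0"
    by (intro tendsto_diff tendsto_const LIMSEQ_Suc[OF lim_1_over_n])
  ultimately have Qmax: "Sup ?S \<le> \<sigma> Q"
    using LIMSEQ_le_const2[of "\<lambda>n. Sup ?S - 1 / real (Suc n)" "Sup ?S - 0" "\<sigma> Q"] by simp
  have "\<sigma> B \<le> 0" if B: "B \<in> sets M" "B \<subseteq> space M - Q" for B
  proof -
    obtain R where R: "positive_set M \<sigma> R" "R \<subseteq> B" "\<sigma> B \<le> \<sigma> R"
      using positive_subset[OF \<sigma> B(1)] by blast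
    have "positive_set M \<sigma> (Q \<union> R)"
      using positive_set_UN[OF \<sigma>, of "binaryset Q R"] Q R(1) e
      by (simp add: UN_binaryset_eq) (simp add: binaryset_def)
    then have "\<sigma> (Q \<union> R) \<le> Sup ?S" by (intro cSup_upper[OF _ bdd]) auto
    moreover have "\<sigma> (Q \<union> R) = \<sigma> Q + \<sigma> R"
      using Q R B by (intro signed_measure_Un[OF \<sigma>]) (auto simp: positive_set_def)
    ultimately show ?thesis using Qmax R(3) by simp
  qed
  then have "is_hahn_set M \<sigma> Q" using Q by (auto simp: is_hahn_set_def positive_set_def)
  then show ?thesis ..
qed

lemma is_hahn_set_hahn_set: "signed_measure M \<sigma> \<Longrightarrow> is_hahn_set M \<sigma> (hahn_set M \<sigma>)"
  unfolding hahn_set_def by (rule someI_ex) (rule ex_hahn_set)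

section \<open>The positive and negative parts and the total variation as measures\<close>

lemma sets_pos_part [simp, measurable_cong]: "sets (pos_part M \<sigma>) = sets M"
  and space_pos_part [simp]: "space (pos_part M \<sigma>) = space M"
  and sets_neg_part [simp, measurable_cong]: "sets (neg_part M \<sigma>) = sets M"
  and space_neg_part [simp]: "space (neg_part M \<sigma>) = space M"
  and sets_total_variation [simp]: "sets (total_variation M \<sigma>) = sets M"
  by (simp_all add: pos_part_def neg_part_def total_variation_def)

text \<open>The factor \<open>s\<close> is 1 for the positive and -1 for the negative part, so that
  one additivity proof serves both.\<close>

lemma emeasure_of_signed_restriction:
  assumes \<sigma>: "signed_measure M \<sigma>"
    and H: "H \<in> sets M" and nonneg: "\<And>B. B \<in> sets M \<Longrightarrow> B \<subseteq> H \<Longrightarrow> 0 \<le> s * \<sigma> B"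
    and A: "A \<in> sets M"
  shows "emeasure (measure_of (space M) (sets M) (\<lambda>A. ennreal (s * \<sigma> (A \<inter> H)))) A
    = ennreal (s * \<sigma> (A \<inter> H))"
proof (rule emeasure_measure_of_sigma[where \<mu> = "\<lambda>A. ennreal (s * \<sigma> (A \<inter> H))"])
  show "sigma_algebra (space M) (sets M)" by (rule sets.sigma_algebra_axioms)
  show "positive (sets M) (\<lambda>A. ennreal (s * \<sigma> (A \<inter> H)))"
    using signed_measureD(1)[OF \<sigma>] by (auto simp: positive_def)
  show "countably_additive (sets M) (\<lambda>A. ennreal (s * \<sigma> (A \<inter> H)))"
  proof (rule countably_additiveI)
    fix C :: "nat \<Rightarrow> 'a set"
    assume C: "range C \<subseteq> sets M" "disjoint_family C"
    have "(\<lambda>i. \<sigma> (C i \<inter> H)) sums \<sigma> (\<Union>i. C i \<inter> H)"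
      using C H by (intro signed_measureD(2)[OF \<sigma>]) (auto simp: disjoint_family_on_def)
    then have "(\<lambda>i. s * \<sigma> (C i \<inter> H)) sums (s * \<sigma> (\<Union>i. C i \<inter> H))" by (rule sums_mult)
    moreover have "0 \<le> s * \<sigma> (C i \<inter> H)" for i using C H by (intro nonneg) auto
    moreover have "(\<Union>i. C i \<inter> H) = (\<Union>i. C i) \<inter> H" by blast
    ultimately show "(\<Sum>i. ennreal (s * \<sigma> (C i \<inter> H))) = ennreal (s * \<sigma> ((\<Union>i. C i) \<inter> H))"
      by (intro suminf_ennreal_eq) auto
  qed
  show "A \<in> sets M" by fact
qed

lemma
  assumes \<sigma>: "signed_measure M \<sigma>" and A: "A \<in> sets M"
  shows emeasure_pos_part: "emeasure (pos_part M \<sigma>) A = ennreal (\<sigma> (A \<inter> hahn_set M \<sigma>))"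
    and emeasure_neg_part: "emeasure (neg_part M \<sigma>) A = ennreal (- \<sigma> (A - hahn_set M \<sigma>))"
proof -
  let ?P = "hahn_set M \<sigma>"
  have P: "?P \<in> sets M" "\<And>B. B \<in> sets M \<Longrightarrow> B \<subseteq> ?P \<Longrightarrow> 0 \<le> \<sigma> B"
    "\<And>B. B \<in> sets M \<Longrightarrow> B \<subseteq> space M - ?P \<Longrightarrow> \<sigma> B \<le> 0"
    using is_hahn_set_hahn_set[OF \<sigma>] unfolding is_hahn_set_def by auto
  show "emeasure (pos_part M \<sigma>) A = ennreal (\<sigma> (A \<inter> ?P))"
    using emeasure_of_signed_restriction[OF \<sigma> P(1) _ A, of 1] P(2) by (simp add: pos_part_def)
  have eq: "B \<inter> (space M - ?P) = B - ?P" if "B \<in> sets M" for B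
    using sets.sets_into_space[OF that] by auto
  \<comment> \<open>The set functions \<open>A - ?P\<close> and \<open>A\<close> intersected with
    the complement give the same value on measurable sets only, which is all that
    \<open>measure_of\<close> looks at.\<close>
  have "measure_of (space M) (sets M) (\<lambda>A. ennreal (- 1 * \<sigma> (A \<inter> (space M - ?P)))) = neg_part M \<sigma>"
    unfolding neg_part_def
    by (rule measure_of_eq) (auto simp: sets.space_closed sets.sigma_sets_eq eq)
  then show "emeasure (neg_part M \<sigma>) A = ennreal (- \<sigma> (A - ?P))"
    using emeasure_of_signed_restriction[OF \<sigma> _ _ A, of "space M - ?P" "-1"] P eq[OF A]
    by simp
qed

lemma finite_measure_pos_part: "signed_measure M \<sigma> \<Longrightarrow> finite_measure (pos_part M \<sigma>)"
  and finite_measure_neg_part: "signed_measure M \<sigma> \<Longrightarrow> finite_measure (neg_part M \<sigma>)"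
  by (auto intro!: finite_measureI simp: emeasure_pos_part emeasure_neg_part)

text \<open>Carries the normalisation of \<sigma> over to its two parts, through which alone the
  energy depends on \<sigma>.\<close>

lemma measure_pos_part_minus_neg_part:
  assumes \<sigma>: "signed_measure M \<sigma>"
  shows "measure (pos_part M \<sigma>) (space M) - measure (neg_part M \<sigma>) (space M) = \<sigma> (space M)"
proof -
  let ?P = "hahn_set M \<sigma>"
  have P: "is_hahn_set M \<sigma> ?P" by (rule is_hahn_set_hahn_set[OF \<sigma>])
  then have PM: "?P \<in> sets M" "?P \<subseteq> space M" by (auto simp: is_hahn_set_def dest: sets.sets_into_space)
  have "0 \<le> \<sigma> ?P" "\<sigma> (space M - ?P) \<le> 0"
    using P PM unfolding is_hahn_set_def by blast+
  moreover have "\<sigma> (space M - ?P) = \<sigma> (space M) - \<sigma> ?P"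
    using PM by (intro signed_measure_Diff[OF \<sigma>]) auto
  moreover have "space M \<inter> ?P = ?P" using PM by auto
  ultimately show ?thesis
    by (simp add: measure_def emeasure_pos_part[OF \<sigma>] emeasure_neg_part[OF \<sigma>])
qed

lemma emeasure_total_variation:
  assumes "A \<in> sets M"
  shows "emeasure (total_variation M \<sigma>) A = emeasure (pos_part M \<sigma>) A + emeasure (neg_part M \<sigma>) A"
  unfolding total_variation_def
proof (rule emeasure_measure_of_sigma
    [where \<mu> = "\<lambda>A. emeasure (pos_part M \<sigma>) A + emeasure (neg_part M \<sigma>) A"])
  show "countably_additive (sets M) (\<lambda>A. emeasure (pos_part M \<sigma>) A + emeasure (neg_part M \<sigma>) A)"
  proof (rule countably_additiveI)
    fix C :: "nat \<Rightarrow> 'a set"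
    assume C: "range C \<subseteq> sets M" "disjoint_family C"
    then show "(\<Sum>i. emeasure (pos_part M \<sigma>) (C i) + emeasure (neg_part M \<sigma>) (C i)) =
        emeasure (pos_part M \<sigma>) (\<Union> (range C)) + emeasure (neg_part M \<sigma>) (\<Union> (range C))"
      by (subst suminf_add[symmetric]) (auto simp: suminf_emeasure)
  qed
qed (use assms in \<open>auto simp: positive_def sets.sigma_algebra_axioms\<close>)

text \<open>Lets the moment hypothesis on the total variation be used for each part
  separately.\<close>

lemma nn_integral_pos_part_le: "nn_integral (pos_part M \<sigma>) f \<le> nn_integral (total_variation M \<sigma>) f"
  and nn_integral_neg_part_le: "nn_integral (neg_part M \<sigma>) f \<le> nn_integral (total_variation M \<sigma>) f"
  by (auto intro!: nn_integral_mono_measure simp: le_measure emeasure_total_variation)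

section \<open>Square-integrable random variables, couplings and gluing\<close>

text \<open>Expand the squared norms of \<open>t *\<^sub>R u - v\<close> and
  \<open>t *\<^sub>R u + v\<close> and divide by \<open>t\<close>. The free weight decides which of
  the two vectors pays; coercivity and the uniform weak estimate both depend on it.\<close>

lemma inner_Young:
  fixes u v :: "'a::real_inner"
  assumes "0 < t"
  shows "2 * \<bar>u \<bullet> v\<bar> \<le> t * (norm u)\<^sup>2 + (norm v)\<^sup>2 / t"
proof -
  have "0 \<le> (norm (t *\<^sub>R u - v))\<^sup>2 / t" "0 \<le> (norm (t *\<^sub>R u + v))\<^sup>2 / t" using assms by simp_all
  moreover have "(norm (t *\<^sub>R u - v))\<^sup>2 / t = t * (norm u)\<^sup>2 - 2 * (u \<bullet> v) + (norm v)\<^sup>2 / t"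
    "(norm (t *\<^sub>R u + v))\<^sup>2 / t = t * (norm u)\<^sup>2 + 2 * (u \<bullet> v) + (norm v)\<^sup>2 / t"
    using assms by (simp_all add: power2_norm_eq_inner inner_diff inner_add inner_commute field_simps)
  ultimately show ?thesis by linarith
qed

text \<open>A triangle inequality for squares: a small \<open>t\<close> leaves the first term almost
  intact, and \<open>t = norm v / norm u\<close> recovers the square of the sum of the
  norms.\<close>

lemma norm_add_sq_le:
  fixes u v :: "'a::real_inner"
  assumes "0 < t"
  shows "(norm (u + v))\<^sup>2 \<le> (1 + t) * (norm u)\<^sup>2 + (1 + 1 / t) * (norm v)\<^sup>2"
proof -
  have "(norm (u + v))\<^sup>2 = (norm u)\<^sup>2 + 2 * (u \<bullet> v) + (norm v)\<^sup>2"
    by (simp add: power2_norm_eq_inner inner_add inner_commute)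
  then show ?thesis using inner_Young[OF assms, of u v] by (simp add: algebra_simps)
qed

definition sq_integrable ::
  "'b measure \<Rightarrow> ('b \<Rightarrow> 'a::{real_inner, second_countable_topology}) \<Rightarrow> bool" where
  "sq_integrable M X \<longleftrightarrow> X \<in> borel_measurable M \<and> integrable M (\<lambda>w. (norm (X w))\<^sup>2)"

lemma sq_integrable_measurable: "sq_integrable M X \<Longrightarrow> X \<in> borel_measurable M"
  and sq_integrable_integrable: "sq_integrable M X \<Longrightarrow> integrable M (\<lambda>w. (norm (X w))\<^sup>2)"
  by (auto simp: sq_integrable_def)

lemma sq_integrable_scaleR: "sq_integrable M X \<Longrightarrow> sq_integrable M (\<lambda>w. c *\<^sub>R X w)"
  by (auto simp: sq_integrable_def power_mult_distrib)

lemma sq_integrable_add: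
  assumes "sq_integrable M X" "sq_integrable M Y"
  shows "sq_integrable M (\<lambda>w. X w + Y w)"
  unfolding sq_integrable_def
proof
  note [measurable] = assms[THEN sq_integrable_measurable]
  show "(\<lambda>w. X w + Y w) \<in> borel_measurable M" by simp
  show "integrable M (\<lambda>w. (norm (X w + Y w))\<^sup>2)"
  proof (rule Bochner_Integration.integrable_bound)
    show "integrable M (\<lambda>w. 2 * (norm (X w))\<^sup>2 + 2 * (norm (Y w))\<^sup>2)"
      using assms by (auto simp: sq_integrable_def)
    show "AE w in M. norm ((norm (X w + Y w))\<^sup>2) \<le> norm (2 * (norm (X w))\<^sup>2 + 2 * (norm (Y w))\<^sup>2)"
      using norm_add_sq_le[of 1 "X w" "Y w" for w] by (auto simp: abs_of_nonneg)
  qed measurable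
qed

lemma sq_integrable_diff:
  assumes "sq_integrable M X" "sq_integrable M Y"
  shows "sq_integrable M (\<lambda>w. X w - Y w)"
  using sq_integrable_add[OF assms(1) sq_integrable_scaleR[OF assms(2), of "-1"]] by simp

lemma sq_integrable_inner:
  assumes "sq_integrable M X" "sq_integrable M Y"
  shows "integrable M (\<lambda>w. X w \<bullet> Y w)"
proof (rule Bochner_Integration.integrable_bound)
  note [measurable] = assms[THEN sq_integrable_measurable]
  show "integrable M (\<lambda>w. (norm (X w))\<^sup>2 + (norm (Y w))\<^sup>2)"
    using assms by (auto simp: sq_integrable_def)
  have "\<bar>X w \<bullet> Y w\<bar> \<le> (norm (X w))\<^sup>2 + (norm (Y w))\<^sup>2" for w
    using inner_Young[of 1 "X w" "Y w"] by simp
  then show "AE w in M. norm (X w \<bullet> Y w) \<le> norm ((norm (X w))\<^sup>2 + (norm (Y w))\<^sup>2)"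
    by (auto simp: abs_of_nonneg)
qed (use assms in \<open>auto simp: sq_integrable_def\<close>)

lemma integral_norm_diff_sq:
  assumes "sq_integrable M X" "sq_integrable M Y"
  shows "(\<integral>w. (norm (X w - Y w))\<^sup>2 \<partial>M)
    = (\<integral>w. (norm (X w))\<^sup>2 \<partial>M) + (\<integral>w. (norm (Y w))\<^sup>2 \<partial>M) - 2 * (\<integral>w. X w \<bullet> Y w \<partial>M)"
proof -
  have "(norm (X w - Y w))\<^sup>2 = (norm (X w))\<^sup>2 + (norm (Y w))\<^sup>2 - 2 * (X w \<bullet> Y w)" for w
    by (simp add: power2_norm_eq_inner inner_diff inner_commute)
  then show ?thesis
    using assms[THEN sq_integrable_integrable] sq_integrable_inner[OF assms] by simp
qed

lemma sq_integrable_marginal: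
  assumes "p \<in> measurable G M" "distr G M p = N" "sets M = sets N" "sq_integrable N X"
  shows "sq_integrable G (\<lambda>w. X (p w))"
proof -
  have X: "X \<in> borel_measurable M" "integrable (distr G M p) (\<lambda>x. (norm (X x))\<^sup>2)"
    using assms measurable_cong_sets[OF assms(3) refl] by (auto simp: sq_integrable_def)
  then show ?thesis
    using assms(1) integrable_distr_eq[OF assms(1), of "\<lambda>x. (norm (X x))\<^sup>2"]
    by (auto simp: sq_integrable_def)
qed

section \<open>Measures with finite second moment and their couplings\<close>

lemma P2_D:
  assumes "\<mu> \<in> P2"
  shows "prob_space \<mu>" "sets \<mu> = sets borel" "space \<mu> = UNIV" "sq_integrable \<mu> (\<lambda>x. x)"
proof -
  show 1: "prob_space \<mu>" "sets \<mu> = sets borel" using assms by (auto simp: P2_def)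
  then show "space \<mu> = UNIV" using sets_eq_imp_space_eq[of \<mu> borel] by simp
  have [measurable]: "(\<lambda>x. x) \<in> borel_measurable \<mu>" using 1(2) by (simp cong: measurable_cong_sets)
  show "sq_integrable \<mu> (\<lambda>x. x)"
    using assms by (auto simp: sq_integrable_def P2_def m2sq_def integrable_iff_bounded)
qed

lemma P2_I:
  assumes "prob_space \<mu>" "sets \<mu> = sets borel" "sq_integrable \<mu> (\<lambda>x. x)"
  shows "\<mu> \<in> P2"
  using assms by (auto simp: sq_integrable_def P2_def m2sq_def integrable_iff_bounded)

lemma distr_in_P2:
  assumes "prob_space M" "sq_integrable M X"
  shows "distr M borel X \<in> P2"
proof (rule P2_I)
  note [measurable] = assms(2)[THEN sq_integrable_measurable]
  show "prob_space (distr M borel X)" using assms(1) by (rule prob_space.prob_space_distr) simp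
  show "sq_integrable (distr M borel X) (\<lambda>x. x)"
    using assms(2) by (auto simp: sq_integrable_def integrable_distr_eq)
qed simp

definition msq :: "'a::{real_inner, polish_space} measure \<Rightarrow> real" where
  "msq \<mu> = (\<integral>x. (norm x)\<^sup>2 \<partial>\<mu>)"

lemma msq_nonneg [simp]: "0 \<le> msq \<mu>"
  by (simp add: msq_def)

lemma m2sq_eq_msq: "\<mu> \<in> P2 \<Longrightarrow> m2sq \<mu> = ennreal (msq \<mu>)"
  unfolding m2sq_def msq_def
  by (rule nn_integral_eq_integral[OF sq_integrable_integrable[OF P2_D(4)]]) auto

lemma integral_norm_sq_distr:
  "sq_integrable M X \<Longrightarrow> (\<integral>w. (norm (X w))\<^sup>2 \<partial>M) = msq (distr M borel X)"
  using sq_integrable_measurable by (subst msq_def, subst integral_distr) auto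

lemma sq_integrable_of_law:
  assumes "X \<in> borel_measurable M" "distr M borel X \<in> P2"
  shows "sq_integrable M X"
  using assms P2_D(4)[OF assms(2)] by (auto simp: sq_integrable_def integrable_distr_eq)

lemma nn_integral_norm_diff_sq:
  assumes "sq_integrable M X" "sq_integrable M Y"
  shows "(\<integral>\<^sup>+w. ennreal ((norm (X w - Y w))\<^sup>2) \<partial>M) = ennreal (\<integral>w. (norm (X w - Y w))\<^sup>2 \<partial>M)"
  using sq_integrable_integrable[OF sq_integrable_diff[OF assms]]
  by (intro nn_integral_eq_integral) auto

lemma borel_measurable_fst_snd:
  "(fst :: 'a::second_countable_topology \<times> 'b::second_countable_topology \<Rightarrow> 'a) \<in> borel_measurable borel"
  "(snd :: 'a \<times> 'b \<Rightarrow> 'b) \<in> borel_measurable borel"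
  by (simp_all add: borel_prod[symmetric])

lemma couplingsD:
  fixes \<gamma> :: "('a::{real_inner, polish_space} \<times> 'a) measure"
  assumes "\<gamma> \<in> couplings \<mu> \<nu>" "\<mu> \<in> P2" "\<nu> \<in> P2"
  shows "prob_space \<gamma>" "sets \<gamma> = sets borel" "distr \<gamma> borel fst = \<mu>" "distr \<gamma> borel snd = \<nu>"
    "sq_integrable \<gamma> fst" "sq_integrable \<gamma> snd"
proof -
  show 1: "prob_space \<gamma>" "sets \<gamma> = sets borel" "distr \<gamma> borel fst = \<mu>" "distr \<gamma> borel snd = \<nu>"
    using assms(1) by (auto simp: couplings_def)
  have "fst \<in> borel_measurable \<gamma>" "snd \<in> borel_measurable \<gamma>"
    using borel_measurable_fst_snd 1(2) by (auto cong: measurable_cong_sets)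
  then show "sq_integrable \<gamma> fst" "sq_integrable \<gamma> snd"
    using 1 assms by (auto intro: sq_integrable_of_law)
qed

lemma distr_in_couplings:
  fixes X Y :: "'b \<Rightarrow> 'a::{real_inner, polish_space}"
  assumes "prob_space M" "X \<in> borel_measurable M" "Y \<in> borel_measurable M"
  shows "distr M borel (\<lambda>w. (X w, Y w)) \<in> couplings (distr M borel X) (distr M borel Y)"
proof -
  note [measurable] = assms(2,3)
  have XY [measurable]: "(\<lambda>w. (X w, Y w)) \<in> borel_measurable M"
    unfolding borel_prod[symmetric] by measurable
  show ?thesis
    using assms(1) borel_measurable_fst_snd[where 'a='a and 'b='a]
    by (auto simp: couplings_def distr_distr comp_def intro!: prob_space.prob_space_distr)
qed

lemma W2_sq:
  "(W2 \<mu> \<nu>)\<^sup>2 = enn2real (INF \<gamma>\<in>couplings \<mu> \<nu>. \<integral>\<^sup>+z. ennreal ((norm (fst z - snd z))\<^sup>2) \<partial>\<gamma>)"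
  by (simp add: W2_def)

lemma W2_nonneg [simp]: "0 \<le> W2 \<mu> \<nu>"
  by (simp add: W2_def)

text \<open>The joint law of \<open>X\<close> and \<open>Y\<close> is an admissible coupling. Upper
  bounds on \<open>W2\<close> are obtained this way from random variables on an arbitrary
  probability space.\<close>

lemma W2_sq_le:
  assumes M: "prob_space M" and X: "sq_integrable M X" and Y: "sq_integrable M Y"
  shows "(W2 (distr M borel X) (distr M borel Y))\<^sup>2 \<le> (\<integral>w. (norm (X w - Y w))\<^sup>2 \<partial>M)"
proof -
  note [measurable] = X[THEN sq_integrable_measurable] Y[THEN sq_integrable_measurable]
  let ?\<gamma> = "distr M borel (\<lambda>w. (X w, Y w))"
  have XY [measurable]: "(\<lambda>w. (X w, Y w)) \<in> borel_measurable M"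
    unfolding borel_prod[symmetric] by measurable
  have f [measurable]: "(\<lambda>z::'b \<times> 'b. ennreal ((norm (fst z - snd z))\<^sup>2)) \<in> borel_measurable borel"
    unfolding borel_prod[symmetric] by measurable
  have "(\<integral>\<^sup>+z. ennreal ((norm (fst z - snd z))\<^sup>2) \<partial>?\<gamma>)
      = (\<integral>\<^sup>+w. ennreal ((norm (X w - Y w))\<^sup>2) \<partial>M)"
    using f by (subst nn_integral_distr[OF XY]) simp_all
  also have "\<dots> = ennreal (\<integral>w. (norm (X w - Y w))\<^sup>2 \<partial>M)"
    by (rule nn_integral_norm_diff_sq[OF X Y])
  finally have "(INF \<gamma>\<in>couplings (distr M borel X) (distr M borel Y).
      \<integral>\<^sup>+z. ennreal ((norm (fst z - snd z))\<^sup>2) \<partial>\<gamma>) \<le> ennreal (\<integral>w. (norm (X w - Y w))\<^sup>2 \<partial>M)"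
    using distr_in_couplings[OF M, of X Y] by (intro INF_lower2[of ?\<gamma>]) auto
  then show ?thesis
    unfolding W2_sq by (intro enn2real_leI) auto
qed

text \<open>The product measure has finite cost, so the infimum is finite and
  \<open>enn2real\<close> preserves it; anything strictly above an infimum is beaten by some
  coupling.\<close>

lemma near_optimal_coupling:
  assumes P2: "\<mu> \<in> P2" "\<nu> \<in> P2" and e: "0 < e"
  obtains \<gamma> where "\<gamma> \<in> couplings \<mu> \<nu>" "(\<integral>z. (norm (fst z - snd z))\<^sup>2 \<partial>\<gamma>) < (W2 \<mu> \<nu>)\<^sup>2 + e"
proof -
  let ?c = "\<lambda>\<gamma>. \<integral>\<^sup>+z. ennreal ((norm (fst z - snd z))\<^sup>2) \<partial>\<gamma>"
  interpret \<mu>: prob_space \<mu> using P2_D[OF P2(1)] by simp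
  interpret \<nu>: prob_space \<nu> using P2_D[OF P2(2)] by simp
  interpret pair_prob_space \<mu> \<nu> ..
  have c: "?c \<gamma> = ennreal (\<integral>z. (norm (fst z - snd z))\<^sup>2 \<partial>\<gamma>)" if "\<gamma> \<in> couplings \<mu> \<nu>" for \<gamma>
    using couplingsD[OF that P2] by (intro nn_integral_norm_diff_sq)
  have "distr (\<mu> \<Otimes>\<^sub>M \<nu>) \<nu> snd = \<nu>"
  proof (rule measure_eqI)
    fix A assume "A \<in> sets (distr (\<mu> \<Otimes>\<^sub>M \<nu>) \<nu> snd)"
    then have A: "A \<in> sets \<nu>" by simp
    then have "snd -` A \<inter> space (\<mu> \<Otimes>\<^sub>M \<nu>) = space \<mu> \<times> A"
      using sets.sets_into_space by (auto simp: space_pair_measure)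
    then show "emeasure (distr (\<mu> \<Otimes>\<^sub>M \<nu>) \<nu> snd) A = emeasure \<nu> A"
      using A by (simp add: emeasure_distr \<nu>.emeasure_pair_measure_Times \<mu>.emeasure_space_1)
  qed simp
  moreover have "distr (\<mu> \<Otimes>\<^sub>M \<nu>) borel fst = distr (\<mu> \<Otimes>\<^sub>M \<nu>) \<mu> fst"
    "distr (\<mu> \<Otimes>\<^sub>M \<nu>) borel snd = distr (\<mu> \<Otimes>\<^sub>M \<nu>) \<nu> snd"
    using P2_D(2)[OF P2(1)] P2_D(2)[OF P2(2)] by (auto intro!: distr_cong)
  ultimately have "distr (\<mu> \<Otimes>\<^sub>M \<nu>) borel fst = \<mu>" "distr (\<mu> \<Otimes>\<^sub>M \<nu>) borel snd = \<nu>"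
    using \<nu>.distr_pair_fst[of \<mu>] by auto
  then have "\<mu> \<Otimes>\<^sub>M \<nu> \<in> couplings \<mu> \<nu>"
    using prob_space_axioms sets_pair_measure_cong[OF P2_D(2)[OF P2(1)] P2_D(2)[OF P2(2)]]
    unfolding borel_prod by (simp add: couplings_def)
  then have "(INF \<gamma>\<in>couplings \<mu> \<nu>. ?c \<gamma>) \<le> ?c (\<mu> \<Otimes>\<^sub>M \<nu>)" "?c (\<mu> \<Otimes>\<^sub>M \<nu>) < \<infinity>"
    using c by (auto intro: INF_lower)
  then have "(INF \<gamma>\<in>couplings \<mu> \<nu>. ?c \<gamma>) < \<infinity>" by (rule le_less_trans)
  then have "ennreal ((W2 \<mu> \<nu>)\<^sup>2) = (INF \<gamma>\<in>couplings \<mu> \<nu>. ?c \<gamma>)"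
    unfolding W2_sq by (intro ennreal_enn2real) simp
  moreover have "ennreal ((W2 \<mu> \<nu>)\<^sup>2) < ennreal ((W2 \<mu> \<nu>)\<^sup>2 + e)"
    using e by (intro ennreal_lessI add_nonneg_pos) auto
  ultimately obtain \<gamma> where "\<gamma> \<in> couplings \<mu> \<nu>" "?c \<gamma> < ennreal ((W2 \<mu> \<nu>)\<^sup>2 + e)"
    by (auto simp: INF_less_iff)
  then show thesis using c by (intro that[of \<gamma>]) (auto simp: ennreal_less_iff)
qed

section \<open>Approximate gluing along a countable partition\<close>

lemma AE_atom_nonzero:
  fixes K :: "'b \<Rightarrow> nat"
  assumes "prob_space M" and [measurable]: "K \<in> measurable M (count_space UNIV)"
  shows "AE x in M. measure M {y \<in> space M. K y = K x} \<noteq> 0"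
proof -
  interpret prob_space M by fact
  have "AE x in M. K x = n \<longrightarrow> measure M {y \<in> space M. K y = n} \<noteq> 0" for n
  proof (cases "measure M {y \<in> space M. K y = n} = 0")
    case True
    then have "{y \<in> space M. K y = n} \<in> null_sets M"
      by (auto simp: null_sets_def emeasure_eq_measure)
    then have "AE y in M. y \<notin> {y \<in> space M. K y = n}" by (rule AE_not_in)
    then have "AE y in M. K y \<noteq> n" by auto
    then show ?thesis by (rule eventually_mono) simp
  qed simp
  \<comment> \<open>There are only countably many labels, so those of probability zero carry no mass
    even together.\<close>
  then have "AE x in M. \<forall>n. K x = n \<longrightarrow> measure M {y \<in> space M. K y = n} \<noteq> 0"
    by (subst AE_all_countable) auto
  then show ?thesis by eventually_elim simp
qed

text \<open>Gluing along a discrete variable needs no disintegration: condition the product measure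
  on the event that the two labels agree.\<close>
lemma glue_discrete:
  fixes K :: "'b \<Rightarrow> nat" and L :: "'c \<Rightarrow> nat"
  assumes M: "prob_space M" and N: "prob_space N"
    and K [measurable]: "K \<in> measurable M (count_space UNIV)"
    and L [measurable]: "L \<in> measurable N (count_space UNIV)"
    and eq: "distr M (count_space UNIV) K = distr N (count_space UNIV) L"
  obtains G where "prob_space G" "sets G = sets (M \<Otimes>\<^sub>M N)" "distr G M fst = M" "distr G N snd = N"
    "AE w in G. K (fst w) = L (snd w)"
proof -
  interpret M: prob_space M by fact
  interpret N: prob_space N by fact
  interpret pair_sigma_finite M N ..
  define p where "p n = measure M {y \<in> space M. K y = n}" for n
  have pL: "p n = measure N {y \<in> space N. L y = n}" for n
  proof -
    have "measure (distr M (count_space UNIV) K) {n} = measure (distr N (count_space UNIV) L) {n}"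
      using eq by simp
    then show ?thesis
      by (simp add: measure_distr p_def vimage_def Int_def conj_commute)
  qed
  \<comment> \<open>Under the product measure both labels equal n with probability
    \<open>p n\<close> squared; dividing by \<open>p n\<close> restores the common law
    \<open>p\<close> of the labels.\<close>
  define f where "f w = (if K (fst w) = L (snd w) then ennreal (1 / p (K (fst w))) else 0)" for w
  have KL [measurable]: "(\<lambda>w. K (fst w)) \<in> measurable (M \<Otimes>\<^sub>M N) (count_space UNIV)"
    "(\<lambda>w. L (snd w)) \<in> measurable (M \<Otimes>\<^sub>M N) (count_space UNIV)" by measurable
  have [measurable]: "(\<lambda>w. p (K (fst w))) \<in> borel_measurable (M \<Otimes>\<^sub>M N)"
    "(\<lambda>w. real (K (fst w))) \<in> borel_measurable (M \<Otimes>\<^sub>M N)"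
    "(\<lambda>w. real (L (snd w))) \<in> borel_measurable (M \<Otimes>\<^sub>M N)"
    by (auto intro: measurable_compose[OF KL(1)] measurable_compose[OF KL(2)])
  \<comment> \<open>Equality of the two labels is tested after casting them to reals, where
    measurability of an equation is immediate.\<close>
  have "Measurable.pred (M \<Otimes>\<^sub>M N) (\<lambda>w. real (K (fst w)) = real (L (snd w)))" by measurable
  then have [measurable]: "Measurable.pred (M \<Otimes>\<^sub>M N) (\<lambda>w. K (fst w) = L (snd w))" by simp
  have [measurable]: "f \<in> borel_measurable (M \<Otimes>\<^sub>M N)" unfolding f_def by measurable
  define G where "G = density (M \<Otimes>\<^sub>M N) f"
  have sets_G [measurable_cong]: "sets G = sets (M \<Otimes>\<^sub>M N)" by (simp add: G_def)
  \<comment> \<open>Each fibre has total density 1, which is exactly what preserves the marginal.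
    Labels with \<open>p = 0\<close>, where the quotient \<open>1 / 0\<close> is 0 and the claim
    fails, form a null set.\<close>
  have inner1: "(\<integral>\<^sup>+y. f (x, y) * indicator A x \<partial>N) = indicator A x"
    if "p (K x) \<noteq> 0" for x A
  proof -
    have "(\<integral>\<^sup>+y. f (x, y) * indicator A x \<partial>N)
        = (\<integral>\<^sup>+y. (ennreal (1 / p (K x)) * indicator A x) * indicator {y \<in> space N. L y = K x} y \<partial>N)"
      by (intro nn_integral_cong) (auto simp: f_def split: split_indicator)
    also have "\<dots> = ennreal (1 / p (K x)) * indicator A x * ennreal (p (K x))"
      by (subst nn_integral_cmult_indicator) (auto simp: pL N.emeasure_eq_measure)
    also have "\<dots> = ennreal (1 / p (K x) * p (K x)) * indicator A x"
      by (subst ennreal_mult) (auto simp: p_def ac_simps)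
    finally show ?thesis using that by simp
  qed
  have inner2: "(\<integral>\<^sup>+x. f (x, y) * indicator A y \<partial>M) = indicator A y"
    if "p (L y) \<noteq> 0" for y A
  proof -
    have "(\<integral>\<^sup>+x. f (x, y) * indicator A y \<partial>M)
        = (\<integral>\<^sup>+x. (ennreal (1 / p (L y)) * indicator A y) * indicator {x \<in> space M. K x = L y} x \<partial>M)"
      by (intro nn_integral_cong) (auto simp: f_def split: split_indicator)
    also have "\<dots> = ennreal (1 / p (L y)) * indicator A y * ennreal (p (L y))"
      by (subst nn_integral_cmult_indicator) (auto simp: p_def M.emeasure_eq_measure)
    also have "\<dots> = ennreal (1 / p (L y) * p (L y)) * indicator A y"
      by (subst ennreal_mult) (auto simp: p_def ac_simps)
    finally show ?thesis using that by simp
  qed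
  have d1: "distr G M fst = M"
  proof (rule measure_eqI)
    fix A assume "A \<in> sets (distr G M fst)"
    then have A [measurable]: "A \<in> sets M" by simp
    have "emeasure (distr G M fst) A = (\<integral>\<^sup>+w. f w * indicator A (fst w) \<partial>(M \<Otimes>\<^sub>M N))"
      using A by (subst emeasure_distr) (auto simp: G_def emeasure_density space_pair_measure
          intro!: nn_integral_cong split: split_indicator)
    also have "\<dots> = (\<integral>\<^sup>+x. \<integral>\<^sup>+y. f (x, y) * indicator A x \<partial>N \<partial>M)"
      by (subst N.nn_integral_fst[symmetric]) auto
    also have "\<dots> = (\<integral>\<^sup>+x. indicator A x \<partial>M)"
      by (intro nn_integral_cong_AE eventually_mono[OF AE_atom_nonzero[OF M K, folded p_def]])
        (rule inner1)
    finally show "emeasure (distr G M fst) A = emeasure M A" by simp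
  qed simp
  have d2: "distr G N snd = N"
  proof (rule measure_eqI)
    fix A assume "A \<in> sets (distr G N snd)"
    then have A [measurable]: "A \<in> sets N" by simp
    have "emeasure (distr G N snd) A = (\<integral>\<^sup>+w. f w * indicator A (snd w) \<partial>(M \<Otimes>\<^sub>M N))"
      using A by (subst emeasure_distr) (auto simp: G_def emeasure_density space_pair_measure
          intro!: nn_integral_cong split: split_indicator)
    also have "\<dots> = (\<integral>\<^sup>+y. \<integral>\<^sup>+x. f (x, y) * indicator A y \<partial>M \<partial>N)"
      by (subst nn_integral_snd[symmetric]) auto
    also have "\<dots> = (\<integral>\<^sup>+y. indicator A y \<partial>N)"
      by (intro nn_integral_cong_AE eventually_mono[OF AE_atom_nonzero[OF N L, folded pL]])
        (rule inner2)
    finally show "emeasure (distr G N snd) A = emeasure N A" by simp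
  qed simp
  have "prob_space G"
  proof (rule prob_spaceI)
    have "fst \<in> measurable G M" by measurable
    then have "emeasure (distr G M fst) (space M) = emeasure G (space G)"
      by (subst emeasure_distr) (auto intro!: arg_cong[where f="emeasure G"]
          simp: sets_eq_imp_space_eq[OF sets_G] space_pair_measure)
    then show "emeasure G (space G) = 1" by (simp add: d1 M.emeasure_space_1)
  qed
  moreover have "AE w in G. K (fst w) = L (snd w)"
    unfolding G_def by (subst AE_density) (auto simp: f_def)
  ultimately show thesis using that[of G] sets_G d1 d2 by blast
qed

text \<open>For a dense sequence \<open>d\<close> the fibres of \<open>cell d e\<close> are a
  countable measurable partition of the space into sets of radius at most \<open>e\<close>.\<close>

definition cell :: "(nat \<Rightarrow> 'a::metric_space) \<Rightarrow> real \<Rightarrow> 'a \<Rightarrow> nat" where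
  "cell d e x = (LEAST i. dist (d i) x < e)"

definition dense_seq :: "(nat \<Rightarrow> 'a::metric_space) \<Rightarrow> bool" where
  "dense_seq d \<longleftrightarrow> (\<forall>x e. 0 < e \<longrightarrow> (\<exists>i. dist (d i) x < e))"

lemma ex_dense_seq: "\<exists>d :: nat \<Rightarrow> 'a::{metric_space, second_countable_topology}. dense_seq d"
proof -
  obtain D :: "'a set" where D: "countable D" "\<And>X. open X \<Longrightarrow> X \<noteq> {} \<Longrightarrow> \<exists>d\<in>D. d \<in> X"
    using countable_dense_exists by metis
  have "D \<noteq> {}" using D(2)[of UNIV] by auto
  have "\<exists>i. dist (from_nat_into D i) x < e" if e: "0 < e" for x e
  proof -
    obtain y where "y \<in> D" "y \<in> ball x e"
      using D(2)[OF open_ball, of x e] e by (auto simp del: mem_ball)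
    then show ?thesis using from_nat_into_surj[OF D(1), of y] by (auto simp: dist_commute)
  qed
  then show ?thesis unfolding dense_seq_def by blast
qed

lemma dist_cell: "dense_seq d \<Longrightarrow> 0 < e \<Longrightarrow> dist (d (cell d e x)) x < e"
  unfolding dense_seq_def cell_def by (metis (mono_tags, lifting) LeastI_ex)

lemma measurable_cell [measurable]:
  "cell d e \<in> measurable (borel :: 'a::{metric_space, second_countable_topology} measure) (count_space UNIV)"
  unfolding cell_def by measurable

text \<open>Equal cell indices put both points within \<open>e / 2\<close> of the same
  \<open>d i\<close>. Gluing along the indices therefore identifies \<open>X\<close> and
  \<open>Y\<close> up to \<open>e\<close>, while both marginals stay exact.\<close>

lemma glue:
  fixes X :: "'b \<Rightarrow> 't::{metric_space, second_countable_topology}" and Y :: "'c \<Rightarrow> 't"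
  assumes M: "prob_space M" and N: "prob_space N"
    and X [measurable]: "X \<in> borel_measurable M" and Y [measurable]: "Y \<in> borel_measurable N"
    and eq: "distr M borel X = distr N borel Y" and e: "0 < e"
  obtains G where "prob_space G" "sets G = sets (M \<Otimes>\<^sub>M N)" "distr G M fst = M" "distr G N snd = N"
    "AE w in G. dist (X (fst w)) (Y (snd w)) < e"
proof -
  obtain d :: "nat \<Rightarrow> 't" where d: "dense_seq d" using ex_dense_seq by blast
  let ?k = "cell d (e / 2)"
  have k: "(\<lambda>w. ?k (X w)) \<in> measurable M (count_space UNIV)"
    "(\<lambda>w. ?k (Y w)) \<in> measurable N (count_space UNIV)" by measurable
  have "distr (distr M borel X) (count_space UNIV) ?k = distr (distr N borel Y) (count_space UNIV) ?k"
    by (simp add: eq)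
  then have "distr M (count_space UNIV) (\<lambda>w. ?k (X w)) = distr N (count_space UNIV) (\<lambda>w. ?k (Y w))"
    by (simp add: distr_distr comp_def)
  from glue_discrete[OF M N k this] obtain G where G: "prob_space G" "sets G = sets (M \<Otimes>\<^sub>M N)"
    "distr G M fst = M" "distr G N snd = N" and
    ae: "AE w in G. ?k (X (fst w)) = ?k (Y (snd w))" by blast
  have *: "dist x y < e" if "?k x = ?k y" for x y
    using dist_cell[OF d, of "e / 2" x] dist_cell[OF d, of "e / 2" y] that e
    by (metis dist_triangle_half_r half_gt_zero)
  have "AE w in G. dist (X (fst w)) (Y (snd w)) < e"
    using ae by eventually_elim (rule *)
  with G show thesis by (rule that)
qed

text \<open>A given probability space is kept and enlarged by a near-optimal partner of
  \<open>X\<close>: a near-optimal coupling of the two laws is glued to it along its first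
  coordinate, and the gluing error is absorbed into \<open>e\<close>.\<close>

lemma extend_near_optimal:
  fixes X :: "'b \<Rightarrow> 'a::{real_inner, polish_space}"
  assumes M: "prob_space M" and X: "sq_integrable M X" and \<nu>: "\<nu> \<in> P2" and e: "0 < e"
  obtains G :: "('b \<times> 'a \<times> 'a) measure" where "prob_space G" "fst \<in> measurable G M"
    "distr G M fst = M" "sq_integrable G (\<lambda>w. snd (snd w))" "distr G borel (\<lambda>w. snd (snd w)) = \<nu>"
    "(\<integral>w. (norm (X (fst w) - snd (snd w)))\<^sup>2 \<partial>G) \<le> (W2 (distr M borel X) \<nu>)\<^sup>2 + e"
proof -
  let ?\<mu> = "distr M borel X"
  have \<mu>: "?\<mu> \<in> P2" by (rule distr_in_P2[OF M X])
  \<comment> \<open>The error \<open>e\<close> is spent in thirds: on the coupling not being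
    optimal, on the factor \<open>1 + t\<close> through \<open>t * a = e / 3\<close>, and on the
    gluing distance through \<open>(1 + 1 / t) * \<delta>\<^sup>2 = e / 3\<close>.\<close>
  define a where "a = (W2 ?\<mu> \<nu>)\<^sup>2 + e / 3"
  have a: "0 < a" using e by (simp add: a_def add_nonneg_pos)
  define t where "t = e / (3 * a)"
  have t: "0 < t" using a e by (simp add: t_def)
  define \<delta> where "\<delta> = sqrt (e / 3 / (1 + 1 / t))"
  have \<delta>: "0 < \<delta>" "(1 + 1 / t) * \<delta>\<^sup>2 = e / 3"
  proof -
    have "0 < 1 + 1 / t" using t by (intro add_pos_pos) auto
    then show "0 < \<delta>" "(1 + 1 / t) * \<delta>\<^sup>2 = e / 3"
      using e by (simp_all add: \<delta>_def del: divide_divide_eq_left divide_divide_eq_left')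
  qed
  obtain \<gamma> where "\<gamma> \<in> couplings ?\<mu> \<nu>" and \<gamma>le: "(\<integral>z. (norm (fst z - snd z))\<^sup>2 \<partial>\<gamma>) < a"
    using near_optimal_coupling[OF \<mu> \<nu>, of "e / 3"] e by (auto simp: a_def)
  note \<gamma> = couplingsD[OF this(1) \<mu> \<nu>]
  obtain G where G: "prob_space G" "sets G = sets (M \<Otimes>\<^sub>M \<gamma>)"
    "distr G M fst = M" "distr G \<gamma> snd = \<gamma>" "AE w in G. dist (X (fst w)) (fst (snd w)) < \<delta>"
    by (rule glue[OF M \<gamma>(1) sq_integrable_measurable[OF X] sq_integrable_measurable[OF \<gamma>(5)] \<gamma>(3)[symmetric] \<delta>(1)])
  interpret G: prob_space G by fact
  have m [measurable]: "fst \<in> measurable G M" "snd \<in> measurable G \<gamma>"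
    using G(2) by (auto cong: measurable_cong_sets)
  have L2: "sq_integrable G (\<lambda>w. X (fst w))" "sq_integrable G (\<lambda>w. fst (snd w))"
    "sq_integrable G (\<lambda>w. snd (snd w))"
    using sq_integrable_marginal[OF m(1) G(3) refl X] sq_integrable_marginal[OF m(2) G(4) refl \<gamma>(5)]
      sq_integrable_marginal[OF m(2) G(4) refl \<gamma>(6)] by auto
  have "distr G borel (\<lambda>w. snd (snd w)) = distr (distr G \<gamma> snd) borel snd"
    using sq_integrable_measurable[OF \<gamma>(6)] m by (subst distr_distr) (auto simp: comp_def)
  then have law: "distr G borel (\<lambda>w. snd (snd w)) = \<nu>" using G(4) \<gamma>(4) by simp
  have I: "integrable G (\<lambda>w. (norm (fst (snd w) - snd (snd w)))\<^sup>2)"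
    using sq_integrable_integrable[OF sq_integrable_diff[OF L2(2,3)]] .
  have "(\<integral>w. (norm (X (fst w) - snd (snd w)))\<^sup>2 \<partial>G)
      \<le> (\<integral>w. (1 + t) * (norm (fst (snd w) - snd (snd w)))\<^sup>2 + e / 3 \<partial>G)"
  proof (rule integral_mono_AE)
    show "integrable G (\<lambda>w. (norm (X (fst w) - snd (snd w)))\<^sup>2)"
      using sq_integrable_integrable[OF sq_integrable_diff[OF L2(1,3)]] .
    show "integrable G (\<lambda>w. (1 + t) * (norm (fst (snd w) - snd (snd w)))\<^sup>2 + e / 3)"
      using I by simp
    show "AE w in G. (norm (X (fst w) - snd (snd w)))\<^sup>2
        \<le> (1 + t) * (norm (fst (snd w) - snd (snd w)))\<^sup>2 + e / 3"
      using G(5)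
    proof eventually_elim
      case (elim w)
      have "(norm (X (fst w) - fst (snd w)))\<^sup>2 \<le> \<delta>\<^sup>2"
        using elim by (intro power_mono) (auto simp: dist_norm)
      then have "(1 + 1 / t) * (norm (X (fst w) - fst (snd w)))\<^sup>2 \<le> e / 3"
        using t by (subst \<delta>(2)[symmetric], intro mult_left_mono) auto
      moreover have eq: "X (fst w) - snd (snd w)
          = (fst (snd w) - snd (snd w)) + (X (fst w) - fst (snd w))" by simp
      have "(norm (X (fst w) - snd (snd w)))\<^sup>2 \<le> (1 + t) * (norm (fst (snd w) - snd (snd w)))\<^sup>2
          + (1 + 1 / t) * (norm (X (fst w) - fst (snd w)))\<^sup>2"
        by (subst eq) (rule norm_add_sq_le[OF t])
      ultimately show ?case by linarith
    qed
  qed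
  also have "\<dots> = (1 + t) * (\<integral>w. (norm (fst (snd w) - snd (snd w)))\<^sup>2 \<partial>G) + e / 3"
    using I by (simp add: G.prob_space)
  also have "(\<integral>w. (norm (fst (snd w) - snd (snd w)))\<^sup>2 \<partial>G)
      = (\<integral>z. (norm (fst z - snd z))\<^sup>2 \<partial>distr G \<gamma> snd)"
    using sq_integrable_measurable[OF sq_integrable_diff[OF \<gamma>(5,6)]]
    by (subst integral_distr) auto
  also have "\<dots> \<le> a" using \<gamma>le G(4) by simp
  finally have "(\<integral>w. (norm (X (fst w) - snd (snd w)))\<^sup>2 \<partial>G) \<le> (1 + t) * a + e / 3"
    using t by simp
  also have "\<dots> = a + t * a + e / 3" by (simp add: algebra_simps)
  also have "t * a = e / 3" using a by (simp add: t_def)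
  also have "a + e / 3 + e / 3 = (W2 ?\<mu> \<nu>)\<^sup>2 + e" by (simp add: a_def)
  finally show thesis using that[OF G(1) m(1) G(3) L2(3) law] by blast
qed

section \<open>The Wasserstein metric\<close>

text \<open>Swapping the coordinates turns couplings one way into couplings the other way at equal
  cost. The statement covers all measures because \<open>Metric_space\<close> asks for symmetry off
  the carrier too.\<close>

lemma W2_commute: "W2 \<mu> \<nu> = W2 \<nu> \<mu>"
proof -
  let ?c = "\<lambda>\<gamma>. \<integral>\<^sup>+z. ennreal ((norm (fst z - snd z))\<^sup>2) \<partial>(\<gamma> :: ('a \<times> 'a) measure)"
  have "(INF \<gamma>\<in>couplings \<mu> \<nu>. ?c \<gamma>) \<le> (INF \<gamma>\<in>couplings \<nu> \<mu>. ?c \<gamma>)" for \<mu> \<nu> :: "'a measure"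
  proof (rule INF_mono)
    fix \<gamma> assume \<gamma>: "\<gamma> \<in> couplings \<nu> \<mu>"
    then have *: "prob_space \<gamma>" "sets \<gamma> = sets borel" "distr \<gamma> borel fst = \<nu>" "distr \<gamma> borel snd = \<mu>"
      by (auto simp: couplings_def)
    have m: "fst \<in> borel_measurable \<gamma>" "snd \<in> borel_measurable \<gamma>"
      using borel_measurable_fst_snd *(2) by (auto cong: measurable_cong_sets)
    note [measurable] = m
    have sw [measurable]: "(\<lambda>z. (snd z, fst z)) \<in> borel_measurable \<gamma>"
      unfolding borel_prod[symmetric] by measurable
    have f: "(\<lambda>z::'a \<times> 'a. ennreal ((norm (fst z - snd z))\<^sup>2)) \<in> borel_measurable borel"
      unfolding borel_prod[symmetric] by measurable
    have "distr \<gamma> borel (\<lambda>z. (snd z, fst z)) \<in> couplings \<mu> \<nu>"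
      using distr_in_couplings[OF *(1) m(2,1)] *(3,4) by simp
    moreover have "?c (distr \<gamma> borel (\<lambda>z. (snd z, fst z))) = ?c \<gamma>"
      using nn_integral_distr[OF sw, of "\<lambda>z. ennreal ((norm (fst z - snd z))\<^sup>2)"] f
      by (simp add: norm_minus_commute[of "snd _"])
    then have "?c (distr \<gamma> borel (\<lambda>z. (snd z, fst z))) \<le> ?c \<gamma>" by (rule eq_refl)
    ultimately show "\<exists>\<gamma>'\<in>couplings \<mu> \<nu>. ?c \<gamma>' \<le> ?c \<gamma>" by (rule rev_bexI)
  qed
  then show ?thesis unfolding W2_def by (intro arg_cong[where f = "\<lambda>x. sqrt (enn2real x)"] antisym)
qed

text \<open>A chain of two near-optimal couplings gives the weighted inequality for squares for
  every \<open>t\<close>; optimising \<open>t\<close> turns it into the triangle inequality.\<close>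

lemma W2_triangle:
  assumes P2: "\<mu> \<in> P2" "\<nu> \<in> P2" "\<rho> \<in> P2"
  shows "W2 \<mu> \<rho> \<le> W2 \<mu> \<nu> + W2 \<nu> \<rho>"
proof -
  have *: "(W2 \<mu> \<rho>)\<^sup>2 \<le> (1 + t) * (W2 \<mu> \<nu>)\<^sup>2 + (1 + 1 / t) * (W2 \<nu> \<rho>)\<^sup>2" if t: "0 < t" for t
  proof (rule field_le_epsilon)
    fix e :: real assume e: "0 < e"
    \<comment> \<open>Chosen so that the two coupling errors, with their weights
      \<open>1 + t\<close> and \<open>1 + 1 / t\<close>, add up to \<open>e\<close>.\<close>
    define e' where "e' = e / ((1 + t) + (1 + 1 / t))"
    have den: "0 < (1 + t) + (1 + 1 / t)" using t by (intro add_pos_pos) auto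
    have e': "0 < e'" "(1 + t) * e' + (1 + 1 / t) * e' = e"
    proof -
      show "0 < e'" using e den by (simp add: e'_def)
      have "(1 + t) * e' + (1 + 1 / t) * e' = ((1 + t) + (1 + 1 / t)) * e'"
        by (simp only: distrib_right)
      then show "(1 + t) * e' + (1 + 1 / t) * e' = e"
        unfolding e'_def using den by simp
    qed
    obtain \<gamma> where g: "\<gamma> \<in> couplings \<mu> \<nu>" "(\<integral>z. (norm (fst z - snd z))\<^sup>2 \<partial>\<gamma>) < (W2 \<mu> \<nu>)\<^sup>2 + e'"
      using near_optimal_coupling[OF P2(1,2) e'(1)] by blast
    note \<gamma> = couplingsD[OF g(1) P2(1,2)]
    obtain G :: "(('a \<times> 'a) \<times> 'a \<times> 'a) measure" where G: "prob_space G" "fst \<in> measurable G \<gamma>"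
      "distr G \<gamma> fst = \<gamma>" "sq_integrable G (\<lambda>w. snd (snd w))" "distr G borel (\<lambda>w. snd (snd w)) = \<rho>"
      "(\<integral>w. (norm (snd (fst w) - snd (snd w)))\<^sup>2 \<partial>G) \<le> (W2 \<nu> \<rho>)\<^sup>2 + e'"
      by (rule extend_near_optimal[OF \<gamma>(1,6) P2(3) e'(1), unfolded \<gamma>(4)])
    have L: "sq_integrable G (\<lambda>w. fst (fst w))" "sq_integrable G (\<lambda>w. snd (fst w))"
      using sq_integrable_marginal[OF G(2,3) refl \<gamma>(5)] sq_integrable_marginal[OF G(2,3) refl \<gamma>(6)] by auto
    have law: "distr G borel (\<lambda>w. fst (fst w)) = \<mu>"
      using distr_distr[OF sq_integrable_measurable[OF \<gamma>(5)] G(2)] G(3) \<gamma>(3) by (simp add: comp_def)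
    have "(W2 \<mu> \<rho>)\<^sup>2 \<le> (\<integral>w. (norm (fst (fst w) - snd (snd w)))\<^sup>2 \<partial>G)"
      using W2_sq_le[OF G(1) L(1) G(4)] law G(5) by simp
    also have "\<dots> \<le> (\<integral>w. (1 + t) * (norm (fst (fst w) - snd (fst w)))\<^sup>2
        + (1 + 1 / t) * (norm (snd (fst w) - snd (snd w)))\<^sup>2 \<partial>G)"
    proof (rule integral_mono)
      show "integrable G (\<lambda>w. (norm (fst (fst w) - snd (snd w)))\<^sup>2)"
        by (rule sq_integrable_integrable[OF sq_integrable_diff[OF L(1) G(4)]])
      show "integrable G (\<lambda>w. (1 + t) * (norm (fst (fst w) - snd (fst w)))\<^sup>2
        + (1 + 1 / t) * (norm (snd (fst w) - snd (snd w)))\<^sup>2)"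
        by (intro Bochner_Integration.integrable_add integrable_mult_right
            sq_integrable_integrable[OF sq_integrable_diff] L G)
      show "(norm (fst (fst w) - snd (snd w)))\<^sup>2 \<le> (1 + t) * (norm (fst (fst w) - snd (fst w)))\<^sup>2
        + (1 + 1 / t) * (norm (snd (fst w) - snd (snd w)))\<^sup>2" for w :: "('a \<times> 'a) \<times> 'a \<times> 'a"
        using norm_add_sq_le[OF t, of "fst (fst w) - snd (fst w)" "snd (fst w) - snd (snd w)"] by simp
    qed
    also have "\<dots> = (1 + t) * (\<integral>w. (norm (fst (fst w) - snd (fst w)))\<^sup>2 \<partial>G)
        + (1 + 1 / t) * (\<integral>w. (norm (snd (fst w) - snd (snd w)))\<^sup>2 \<partial>G)"
      using sq_integrable_integrable[OF sq_integrable_diff[OF L]]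
        sq_integrable_integrable[OF sq_integrable_diff[OF L(2) G(4)]] by simp
    also have "(\<integral>w. (norm (fst (fst w) - snd (fst w)))\<^sup>2 \<partial>G) = (\<integral>z. (norm (fst z - snd z))\<^sup>2 \<partial>distr G \<gamma> fst)"
      using sq_integrable_measurable[OF sq_integrable_diff[OF \<gamma>(5,6)]] G(2)
      by (subst integral_distr) auto
    also have "\<dots> = (\<integral>z. (norm (fst z - snd z))\<^sup>2 \<partial>\<gamma>)" using G(3) by simp
    also have "(1 + t) * \<dots> + (1 + 1 / t) * (\<integral>w. (norm (snd (fst w) - snd (snd w)))\<^sup>2 \<partial>G)
        \<le> (1 + t) * ((W2 \<mu> \<nu>)\<^sup>2 + e') + (1 + 1 / t) * ((W2 \<nu> \<rho>)\<^sup>2 + e')"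
      using t g(2) G(6) by (intro add_mono mult_left_mono) auto
    also have "\<dots> = (1 + t) * (W2 \<mu> \<nu>)\<^sup>2 + (1 + 1 / t) * (W2 \<nu> \<rho>)\<^sup>2 + ((1 + t) * e' + (1 + 1 / t) * e')"
      by (simp only: distrib_left)
    finally show "(W2 \<mu> \<rho>)\<^sup>2 \<le> (1 + t) * (W2 \<mu> \<nu>)\<^sup>2 + (1 + 1 / t) * (W2 \<nu> \<rho>)\<^sup>2 + e"
      using e'(2) by simp
  qed
  define a where "a = W2 \<mu> \<nu>"
  define b where "b = W2 \<nu> \<rho>"
  have ab: "0 \<le> a" "0 \<le> b" by (auto simp: a_def b_def)
  \<comment> \<open>The optimal weight is \<open>b / a\<close>; the shift by \<open>s\<close> keeps
    it well defined and positive when a distance vanishes.\<close>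
  have *: "W2 \<mu> \<rho> \<le> (a + s) + (b + s)" if s: "0 < s" for s
  proof -
    let ?a = "a + s" and ?b = "b + s"
    have pos: "0 < ?a" "0 < ?b" using ab s by auto
    have "(W2 \<mu> \<rho>)\<^sup>2 \<le> (1 + ?b / ?a) * a\<^sup>2 + (1 + 1 / (?b / ?a)) * b\<^sup>2"
      using *[of "?b / ?a"] pos by (simp add: a_def b_def)
    also have "\<dots> \<le> (1 + ?b / ?a) * ?a\<^sup>2 + (1 + 1 / (?b / ?a)) * ?b\<^sup>2"
      using ab s pos by (intro add_mono mult_left_mono power_mono) auto
    also have "\<dots> = (?a + ?b)\<^sup>2"
    proof -
      have "(1 + v / u) * u\<^sup>2 + (1 + 1 / (v / u)) * v\<^sup>2 = (u + v)\<^sup>2" if "0 < u" "0 < v" for u v :: real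
      proof -
        have "v / u * u\<^sup>2 = u * v" "1 / (v / u) * v\<^sup>2 = u * v"
          using that by (auto simp: power2_eq_square)
        then show ?thesis by (simp add: distrib_right power2_sum)
      qed
      then show ?thesis using pos by blast
    qed
    finally show ?thesis by (rule power2_le_imp_le) (use pos in simp)
  qed
  have "W2 \<mu> \<rho> \<le> a + b + s" if "0 < s" for s
    using *[OF half_gt_zero[OF that]] by simp
  then show ?thesis unfolding a_def b_def by (rule field_le_epsilon)
qed

lemma W2_self:
  assumes "\<mu> \<in> P2"
  shows "W2 \<mu> \<mu> = 0"
proof -
  have "distr \<mu> borel (\<lambda>x. x) = \<mu>" using P2_D[OF assms] by (intro distr_id2) simp
  then have "(W2 \<mu> \<mu>)\<^sup>2 \<le> 0"
    using W2_sq_le[OF P2_D(1)[OF assms] P2_D(4)[OF assms] P2_D(4)[OF assms]] by simp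
  then show ?thesis by simp
qed

text \<open>Distance zero allows couplings of arbitrarily small cost, under which, by Markov's
  inequality, a point of \<open>F\<close> rarely moves further than 1/(n+1). The closed
  neighbourhoods \<open>A n\<close> then shrink to \<open>F\<close>.\<close>

lemma measure_closed_le_of_W2_zero:
  assumes P2: "\<mu> \<in> P2" "\<nu> \<in> P2" and W: "W2 \<mu> \<nu> = 0" and F: "closed F" "F \<noteq> {}"
  shows "measure \<mu> F \<le> measure \<nu> F"
proof -
  interpret \<mu>: prob_space \<mu> using P2_D[OF P2(1)] by simp
  interpret \<nu>: prob_space \<nu> using P2_D[OF P2(2)] by simp
  have sets: "sets \<mu> = sets borel" "sets \<nu> = sets borel" using P2 P2_D by auto
  define A where "A n = {x. infdist x F \<le> 1 / real (Suc n)}" for n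
  have A: "closed (A n)" for n
    unfolding A_def by (intro closed_Collect_le continuous_intros)
  have le: "measure \<mu> F \<le> measure \<nu> (A n)" for n
  proof (rule field_le_epsilon)
    fix e :: real assume e: "0 < e"
    let ?\<delta> = "1 / real (Suc n)"
    \<comment> \<open>The cost bound contains the squared threshold by which Markov's inequality
      divides, so exactly \<open>e\<close> is left.\<close>
    obtain \<gamma> where g: "\<gamma> \<in> couplings \<mu> \<nu>" "(\<integral>z. (norm (fst z - snd z))\<^sup>2 \<partial>\<gamma>) < (W2 \<mu> \<nu>)\<^sup>2 + e * ?\<delta>\<^sup>2"
      using near_optimal_coupling[OF P2, of "e * ?\<delta>\<^sup>2"] e by auto
    note \<gamma> = couplingsD[OF g(1) P2]
    interpret \<gamma>: prob_space \<gamma> by fact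
    note [measurable] = \<gamma>(5,6)[THEN sq_integrable_measurable]
    have [measurable]: "F \<in> sets borel" "A n \<in> sets borel" using F A by auto
    have I: "integrable \<gamma> (\<lambda>z. (norm (fst z - snd z))\<^sup>2)"
      by (rule sq_integrable_integrable[OF sq_integrable_diff[OF \<gamma>(5,6)]])
    have m1: "measure \<mu> F = measure \<gamma> (fst -` F \<inter> space \<gamma>)" by (subst \<gamma>(3)[symmetric], subst measure_distr) auto
    have m2: "measure \<nu> (A n) = measure \<gamma> (snd -` A n \<inter> space \<gamma>)" by (subst \<gamma>(4)[symmetric], subst measure_distr) auto
    have "fst -` F \<inter> space \<gamma> \<subseteq> (snd -` A n \<inter> space \<gamma>) \<union> {z \<in> space \<gamma>. ?\<delta>\<^sup>2 \<le> (norm (fst z - snd z))\<^sup>2}"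
    proof
      fix z assume z: "z \<in> fst -` F \<inter> space \<gamma>"
      show "z \<in> (snd -` A n \<inter> space \<gamma>) \<union> {z \<in> space \<gamma>. ?\<delta>\<^sup>2 \<le> (norm (fst z - snd z))\<^sup>2}"
      proof (cases "?\<delta> \<le> norm (fst z - snd z)")
        case True
        then have "?\<delta>\<^sup>2 \<le> (norm (fst z - snd z))\<^sup>2" by (intro power_mono) auto
        then show ?thesis using z by simp
      next
        case False
        have "infdist (snd z) F \<le> dist (snd z) (fst z)" using z by (intro infdist_le) auto
        then show ?thesis using False z by (auto simp: A_def dist_norm norm_minus_commute)
      qed
    qed
    then have "measure \<mu> F \<le> measure \<gamma> ((snd -` A n \<inter> space \<gamma>) \<union> {z \<in> space \<gamma>. ?\<delta>\<^sup>2 \<le> (norm (fst z - snd z))\<^sup>2})"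
      unfolding m1 by (intro \<gamma>.finite_measure_mono) measurable
    also have "\<dots> \<le> measure \<nu> (A n) + measure \<gamma> {z \<in> space \<gamma>. ?\<delta>\<^sup>2 \<le> (norm (fst z - snd z))\<^sup>2}"
      unfolding m2 by (intro measure_Un_le) measurable
    also have "measure \<gamma> {z \<in> space \<gamma>. ?\<delta>\<^sup>2 \<le> (norm (fst z - snd z))\<^sup>2}
        \<le> (\<integral>z. (norm (fst z - snd z))\<^sup>2 \<partial>\<gamma>) / ?\<delta>\<^sup>2"
      using integral_Markov_inequality_measure[OF I, of "space \<gamma>" "?\<delta>\<^sup>2"] by simp
    also have "\<dots> \<le> e"
      using g(2) W by (subst pos_divide_le_eq) auto
    finally show "measure \<mu> F \<le> measure \<nu> (A n) + e" by simp
  qed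
  have "(\<Inter>n. A n) = F"
  proof
    show "F \<subseteq> (\<Inter>n. A n)" by (auto simp: A_def infdist_zero)
    show "(\<Inter>n. A n) \<subseteq> F"
    proof
      fix x assume "x \<in> (\<Inter>n. A n)"
      then have "infdist x F \<le> 1 / real (Suc n)" for n by (auto simp: A_def)
      moreover have "(\<lambda>n. 1 / real (Suc n)) \<longlonglongrightarrow> 0" by (rule LIMSEQ_Suc[OF lim_1_over_n])
      ultimately have "infdist x F \<le> 0" by (intro LIMSEQ_le_const) auto
      then show "x \<in> F" using in_closed_iff_infdist_zero[OF F] infdist_nonneg[of x F] by auto
    qed
  qed
  moreover have "(\<lambda>n. measure \<nu> (A n)) \<longlonglongrightarrow> measure \<nu> (\<Inter>n. A n)"
  proof (rule \<nu>.finite_Lim_measure_decseq)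
    show "range A \<subseteq> sets \<nu>" using A sets by auto
    have "1 / real (Suc n) \<le> 1 / real (Suc m)" if "m \<le> n" for m n
      using that by (intro divide_left_mono) auto
    then show "decseq A" by (force simp: A_def decseq_def)
  qed
  ultimately have "(\<lambda>n. measure \<nu> (A n)) \<longlonglongrightarrow> measure \<nu> F" by simp
  then show ?thesis using le by (intro LIMSEQ_le_const) auto
qed

text \<open>Closed sets are an intersection-stable generator of the Borel sets, so comparing the
  measures on them in both directions suffices.\<close>

lemma W2_eq_0_iff:
  assumes P2: "\<mu> \<in> P2" "\<nu> \<in> P2"
  shows "W2 \<mu> \<nu> = 0 \<longleftrightarrow> \<mu> = \<nu>"
proof
  assume W: "W2 \<mu> \<nu> = 0"
  interpret \<mu>: prob_space \<mu> using P2_D[OF P2(1)] by simp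
  interpret \<nu>: prob_space \<nu> using P2_D[OF P2(2)] by simp
  have "W2 \<nu> \<mu> = 0" using W W2_commute[of \<mu> \<nu>] by simp
  then have eq: "measure \<mu> F = measure \<nu> F" if "closed F" for F
    using measure_closed_le_of_W2_zero[OF P2 W that] measure_closed_le_of_W2_zero[OF P2(2,1) _ that]
    by (cases "F = {}") (auto intro: antisym)
  have sets: "sets \<mu> = sets borel" "sets \<nu> = sets borel" using P2 P2_D by auto
  have b: "sets (borel :: 'a measure) = sigma_sets UNIV {S. closed S}"
    by (simp add: borel_eq_closed)
  show "\<mu> = \<nu>"
  proof (rule measure_eqI_generator_eq[where E = "{S. closed S}" and \<Omega> = UNIV and A = "\<lambda>_. UNIV"])
    show "Int_stable {S :: 'a set. closed S}" by (auto simp: Int_stable_def)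
    show "emeasure \<mu> X = emeasure \<nu> X" if "X \<in> {S. closed S}" for X
      using eq[of X] that by (simp add: \<mu>.emeasure_eq_measure \<nu>.emeasure_eq_measure)
  qed (auto simp: sets b)
qed (use W2_self[OF P2(1)] in auto)

lemma Metric_space_P2: "Metric_space P2 W2"
  by (rule Metric_space.intro) (simp, rule W2_commute, simp add: W2_eq_0_iff, simp add: W2_triangle)

section \<open>The Borel structure of the Wasserstein space and second moments\<close>

lemma space_borel_P2 [simp]: "space borel_P2 = P2"
  and sets_borel_P2: "sets borel_P2 = sigma_sets P2 {U. openin (Metric_space.mtopology P2 W2) U}"
proof -
  interpret Metric_space P2 W2 by (rule Metric_space_P2)
  have "{U. openin (Metric_space.mtopology P2 W2) U} \<subseteq> Pow P2"
    using openin_subset[of mtopology] by auto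
  then show "space borel_P2 = P2"
    "sets borel_P2 = sigma_sets P2 {U. openin (Metric_space.mtopology P2 W2) U}"
    unfolding borel_P2_def by (rule space_measure_of, rule sets_measure_of)
qed

lemma openin_mtopology_in_sets_borel_P2:
  "openin (Metric_space.mtopology P2 W2) U \<Longrightarrow> U \<in> sets borel_P2"
  by (auto simp: sets_borel_P2)

lemma measurable_W2:
  assumes \<mu>: "\<mu> \<in> P2"
  shows "W2 \<mu> \<in> borel_measurable borel_P2"
proof (rule borel_measurableI_less)
  interpret Metric_space P2 W2 by (rule Metric_space_P2)
  fix y
  have "{\<nu> \<in> space borel_P2. W2 \<mu> \<nu> < y} = mball \<mu> y"
    using \<mu> by auto
  then show "{\<nu> \<in> space borel_P2. W2 \<mu> \<nu> < y} \<in> sets borel_P2"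
    by (simp add: openin_mtopology_in_sets_borel_P2)
qed

text \<open>Points are closed in a metric space. This makes the atom condition speak of a measurable
  set, so that it can be read as an almost-everywhere statement.\<close>

lemma Diff_singleton_in_sets_borel_P2: "P2 - {\<nu>} \<in> sets borel_P2"
proof -
  interpret Metric_space P2 W2 by (rule Metric_space_P2)
  have "\<exists>r>0. mball x r \<subseteq> P2 - {\<nu>}" if "x \<in> P2" "x \<noteq> \<nu>" for x
  proof (cases "\<nu> \<in> P2")
    case True
    with that have "0 < W2 x \<nu>" by (metis mdist_pos_eq)
    then show ?thesis by (intro exI[of _ "W2 x \<nu>"]) auto
  next
    case False
    then show ?thesis by (intro exI[of _ 1]) auto
  qed
  then show ?thesis
    by (intro openin_mtopology_in_sets_borel_P2) (auto simp: openin_mtopology)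
qed

lemma dirac_in_P2: "return borel (x :: 'a::{real_inner, polish_space}) \<in> P2"
proof (rule P2_I)
  show "prob_space (return borel x)" by (rule prob_space_return) simp
  show "sq_integrable (return borel x) (\<lambda>x. x)"
    by (auto simp: sq_integrable_def integrable_iff_bounded nn_integral_return)
qed simp

text \<open>The second moment is the squared distance to the Dirac mass at 0, because every coupling
  with that mass has first coordinate almost surely 0. Measurability of \<open>msq\<close> follows
  from that of \<open>W2\<close>.\<close>

lemma W2_dirac_0:
  fixes \<nu> :: "'a::{real_inner, polish_space} measure"
  assumes \<nu>: "\<nu> \<in> P2"
  shows "(W2 (return borel 0) \<nu>)\<^sup>2 = msq \<nu>"
proof (rule antisym)
  interpret \<nu>: prob_space \<nu> using P2_D[OF \<nu>] by simp
  have "sq_integrable \<nu> (\<lambda>_. 0::'a)" by (simp add: sq_integrable_def)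
  moreover have "distr \<nu> borel (\<lambda>_. 0::'a) = return borel 0" by (rule \<nu>.distr_const) simp
  moreover have "distr \<nu> borel (\<lambda>x. x) = \<nu>" using P2_D[OF \<nu>] by (intro distr_id2) simp
  ultimately show "(W2 (return borel 0) \<nu>)\<^sup>2 \<le> msq \<nu>"
    using W2_sq_le[OF P2_D(1)[OF \<nu>] _ P2_D(4)[OF \<nu>], of "\<lambda>_. 0"] by (simp add: msq_def)
  show "msq \<nu> \<le> (W2 (return borel 0) \<nu>)\<^sup>2"
  proof (rule field_le_epsilon)
    fix e :: real assume "0 < e"
    then obtain \<gamma> where g: "\<gamma> \<in> couplings (return borel 0) \<nu>"
      "(\<integral>z. (norm (fst z - snd z))\<^sup>2 \<partial>\<gamma>) < (W2 (return borel 0) \<nu>)\<^sup>2 + e"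
      using near_optimal_coupling[OF dirac_in_P2 \<nu>] by blast
    note \<gamma> = couplingsD[OF g(1) dirac_in_P2 \<nu>]
    note [measurable] = \<gamma>(5,6)[THEN sq_integrable_measurable]
    have "AE x in distr \<gamma> borel fst. x = 0" unfolding \<gamma>(3) by (subst AE_return) auto
    then have "AE z in \<gamma>. fst z = 0" by (subst (asm) AE_distr_iff) auto
    then have "(\<integral>z. (norm (fst z - snd z))\<^sup>2 \<partial>\<gamma>) = (\<integral>z. (norm (snd z))\<^sup>2 \<partial>\<gamma>)"
      by (intro integral_cong_AE) auto
    also have "\<dots> = msq \<nu>" using integral_norm_sq_distr[OF \<gamma>(6)] \<gamma>(4) by simp
    finally show "msq \<nu> \<le> (W2 (return borel 0) \<nu>)\<^sup>2 + e" using g(2) by simp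
  qed
qed

lemma measurable_msq: "msq \<in> borel_measurable borel_P2"
proof -
  have "(\<lambda>\<nu>. (W2 (return borel 0) \<nu>)\<^sup>2) \<in> borel_measurable borel_P2"
    using measurable_W2[OF dirac_in_P2] by measurable
  then show ?thesis
    by (rule measurable_cong[THEN iffD1, rotated]) (simp add: W2_dirac_0)
qed

text \<open>The coupling-dependent part of \<open>W2\<close> squared, i.e. \<open>-2\<close> times the maximal correlation.\<close>
definition corr :: "'a::{real_inner, polish_space} measure \<Rightarrow> 'a measure \<Rightarrow> real" where
  "corr \<mu> \<nu> = (W2 \<mu> \<nu>)\<^sup>2 - msq \<mu> - msq \<nu>"

text \<open>For a near-optimal coupling, \<open>corr\<close> is up to \<open>e\<close> equal to -2
  times the integral of the inner product, to which Young's inequality with weight \<open>t\<close>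
  applies.\<close>

lemma abs_corr_le:
  assumes P2: "\<mu> \<in> P2" "\<nu> \<in> P2" and t: "0 < t"
  shows "\<bar>corr \<mu> \<nu>\<bar> \<le> t * msq \<mu> + msq \<nu> / t"
proof (rule field_le_epsilon)
  fix e :: real assume "0 < e"
  then obtain \<gamma> where g: "\<gamma> \<in> couplings \<mu> \<nu>" "(\<integral>z. (norm (fst z - snd z))\<^sup>2 \<partial>\<gamma>) < (W2 \<mu> \<nu>)\<^sup>2 + e"
    using near_optimal_coupling[OF P2] by blast
  note \<gamma> = couplingsD[OF g(1) P2]
  have eq: "(\<integral>z. (norm (fst z - snd z))\<^sup>2 \<partial>\<gamma>) = msq \<mu> + msq \<nu> - 2 * (\<integral>z. fst z \<bullet> snd z \<partial>\<gamma>)"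
    using integral_norm_diff_sq[OF \<gamma>(5,6)] integral_norm_sq_distr[OF \<gamma>(5)] integral_norm_sq_distr[OF \<gamma>(6)] \<gamma>(3,4)
    by simp
  have "2 * \<bar>\<integral>z. fst z \<bullet> snd z \<partial>\<gamma>\<bar> \<le> (\<integral>z. 2 * \<bar>fst z \<bullet> snd z\<bar> \<partial>\<gamma>)"
    using integral_abs_bound[of \<gamma> "\<lambda>z. fst z \<bullet> snd z"] by simp
  also have "\<dots> \<le> (\<integral>z. t * (norm (fst z))\<^sup>2 + (norm (snd z))\<^sup>2 / t \<partial>\<gamma>)"
    using inner_Young[OF t] sq_integrable_inner[OF \<gamma>(5,6)] \<gamma>(5,6)[THEN sq_integrable_integrable]
    by (intro integral_mono) auto
  also have "\<dots> = t * msq \<mu> + msq \<nu> / t"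
    using \<gamma>(5,6)[THEN sq_integrable_integrable] integral_norm_sq_distr[OF \<gamma>(5)] integral_norm_sq_distr[OF \<gamma>(6)] \<gamma>(3,4)
    by simp
  finally have "2 * \<bar>\<integral>z. fst z \<bullet> snd z \<partial>\<gamma>\<bar> \<le> t * msq \<mu> + msq \<nu> / t" .
  moreover have "(W2 \<mu> \<nu>)\<^sup>2 \<le> (\<integral>z. (norm (fst z - snd z))\<^sup>2 \<partial>\<gamma>)"
    using W2_sq_le[OF \<gamma>(1,5,6)] \<gamma>(3,4) by simp
  ultimately show "\<bar>corr \<mu> \<nu>\<bar> \<le> t * msq \<mu> + msq \<nu> / t + e"
    using g(2) eq unfolding corr_def by linarith
qed

section \<open>Weak limits and coding by the Cantor set\<close>

lemma tendsto_of_dist_less: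
  fixes f :: "nat \<Rightarrow> 'a::metric_space"
  assumes "\<And>n. dist (f n) x < 1 / real (Suc n)"
  shows "f \<longlonglongrightarrow> x"
proof -
  have "(\<lambda>n. dist (f n) x) \<longlonglongrightarrow> 0"
  proof (rule tendsto_sandwich[OF _ _ tendsto_const LIMSEQ_Suc[OF lim_1_over_n]])
    show "\<forall>\<^sub>F n in sequentially. dist (f n) x \<le> 1 / real (Suc n)"
      by (rule always_eventually) (use assms in \<open>auto intro: less_imp_le\<close>)
  qed simp
  then show ?thesis by (simp add: tendsto_dist_iff[symmetric])
qed

lemma dense_seq_limit:
  assumes "dense_seq d"
  obtains f where "(\<lambda>n. d (f n)) \<longlonglongrightarrow> x"
proof -
  have "dist (d (cell d (1 / real (Suc n)) x)) x < 1 / real (Suc n)" for n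
    by (rule dist_cell[OF assms]) simp
  then have "(\<lambda>n. d (cell d (1 / real (Suc n)) x)) \<longlonglongrightarrow> x"
    by (rule tendsto_of_dist_less)
  then show thesis by (rule that)
qed

text \<open>Reduces the norm to countably many inner products: by density the test vectors may
  approach \<open>u\<close> itself. Measurability of closed balls and weak semicontinuity of the
  norm both rest on it.\<close>

lemma norm_le_dense_iff:
  fixes u :: "'a::real_inner"
  assumes d: "dense_seq d" and r: "0 \<le> r"
  shows "norm u \<le> r \<longleftrightarrow> (\<forall>k. u \<bullet> d k \<le> r * norm (d k))"
proof
  assume "norm u \<le> r"
  then show "\<forall>k. u \<bullet> d k \<le> r * norm (d k)"
    by (meson mult_right_mono norm_cauchy_schwarz norm_ge_zero order_trans)
next
  assume *: "\<forall>k. u \<bullet> d k \<le> r * norm (d k)"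
  obtain f where f: "(\<lambda>n. d (f n)) \<longlonglongrightarrow> u" by (rule dense_seq_limit[OF d])
  have "u \<bullet> u \<le> r * norm u"
    by (rule LIMSEQ_le[OF tendsto_inner[OF tendsto_const f] tendsto_mult[OF tendsto_const tendsto_norm[OF f]]])
      (use * in auto)
  then show "norm u \<le> r"
    using r by (cases "u = 0") (auto simp: norm_eq_square[symmetric] power2_norm_eq_inner[symmetric] power2_eq_square)
qed

text \<open>An open set is a countable union of closed balls with dense centres and rational radii,
  and each closed ball is a countable intersection of half-spaces.\<close>

lemma borel_measurable_of_inner:
  fixes Z :: "'b \<Rightarrow> 'a::{real_inner, second_countable_topology}"
  assumes d: "dense_seq d" and m [measurable]: "\<And>k. (\<lambda>w. Z w \<bullet> d k) \<in> borel_measurable M"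
  shows "Z \<in> borel_measurable M"
proof (rule borel_measurableI)
  fix S :: "'a set" assume S: "open S"
  have ball: "{w \<in> space M. dist (Z w) (d i) \<le> r} \<in> sets M" if "0 \<le> r" for i r
  proof -
    have "{w \<in> space M. dist (Z w) (d i) \<le> r}
        = {w \<in> space M. \<forall>k. Z w \<bullet> d k - d i \<bullet> d k \<le> r * norm (d k)}"
      using norm_le_dense_iff[OF d that, of "Z _ - d i"] by (auto simp: dist_norm inner_diff_left)
    also have "\<dots> \<in> sets M" by measurable
    finally show ?thesis .
  qed
  let ?I = "{(i, q :: rat). 0 \<le> q \<and> cball (d i) (of_rat q) \<subseteq> S}"
  have "Z -` S \<inter> space M = (\<Union>(i, q)\<in>?I. {w \<in> space M. dist (Z w) (d i) \<le> of_rat q})"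
  proof (intro equalityI subsetI)
    fix w assume w: "w \<in> Z -` S \<inter> space M"
    then obtain e where e: "0 < e" "ball (Z w) e \<subseteq> S" using S open_contains_ball[of S] by auto
    obtain q :: rat where q: "0 < real_of_rat q" "real_of_rat q < e / 2"
      using of_rat_dense[of 0 "e / 2"] e by auto
    obtain i where i: "dist (d i) (Z w) < of_rat q" using d q(1) unfolding dense_seq_def by blast
    have "cball (d i) (of_rat q) \<subseteq> ball (Z w) e"
    proof
      fix y assume "y \<in> cball (d i) (of_rat q)"
      then have "dist (d i) y \<le> of_rat q" by simp
      then show "y \<in> ball (Z w) e"
        using i q dist_triangle3[of "Z w" y "d i"] by simp
    qed
    then have "(i, q) \<in> ?I" using q e by (auto simp: zero_less_of_rat_iff)
    then show "w \<in> (\<Union>(i, q)\<in>?I. {w \<in> space M. dist (Z w) (d i) \<le> of_rat q})"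
      using i w by (intro UN_I[of "(i, q)"]) (auto simp: dist_commute)
  next
    fix w assume "w \<in> (\<Union>(i, q)\<in>?I. {w \<in> space M. dist (Z w) (d i) \<le> of_rat q})"
    then obtain i q where "cball (d i) (of_rat q) \<subseteq> S" "w \<in> space M" "dist (Z w) (d i) \<le> of_rat q" by auto
    then show "w \<in> Z -` S \<inter> space M" by (auto simp: dist_commute)
  qed
  also have "\<dots> \<in> sets M"
    by (intro sets.countable_UN' countableI_type) (auto intro!: ball)
  finally show "Z -` S \<inter> space M \<in> sets M" .
qed

text \<open>Settling eventually on one side of every rational forces a limit in the extended reals;
  being bounded infinitely often excludes the infinite ones.\<close>

lemma convergent_of_rational_cuts:
  fixes a :: "nat \<Rightarrow> real"
  assumes cut: "\<And>q :: rat. (\<forall>\<^sub>F n in sequentially. of_rat q \<le> a n) \<or> (\<forall>\<^sub>F n in sequentially. a n < of_rat q)"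
    and fr: "\<exists>\<^sub>F n in sequentially. \<bar>a n\<bar> \<le> C"
  shows "convergent a"
proof -
  let ?ev = "\<lambda>P. eventually P sequentially"
  define S where "S = {x. ?ev (\<lambda>n. x \<le> a n)}"
  have bound: "s \<le> C" if "s \<in> S" for s
  proof -
    have "\<exists>\<^sub>F n in sequentially. s \<le> C"
      using frequently_eventually_conj[OF fr that[unfolded S_def mem_Collect_eq]]
      by (rule frequently_elim1) auto
    then show ?thesis by (simp add: frequently_const)
  qed
  have lowrat: "?ev (\<lambda>n. of_rat q \<le> a n)" if "of_rat q < - C" for q
  proof (rule ccontr)
    assume "\<not> ?thesis"
    then have "?ev (\<lambda>n. a n < of_rat q)" using cut by blast
    from frequently_eventually_conj[OF fr this] have "\<exists>\<^sub>F n in sequentially. False"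
      by (rule frequently_elim1) (use that in auto)
    then show False by simp
  qed
  obtain q0 :: rat where "- C - 1 < of_rat q0" "of_rat q0 < - C"
    using of_rat_dense[of "- C - 1" "- C"] by auto
  then have "of_rat q0 \<in> S" using lowrat by (simp add: S_def)
  then have ne: "S \<noteq> {}" by auto
  have bdd: "bdd_above S" using bound by (auto simp: bdd_above_def)
  have "a \<longlonglongrightarrow> Sup S"
  proof (rule order_tendstoI)
    fix y assume "y < Sup S"
    then obtain s where "s \<in> S" "y < s" using less_cSup_iff[OF ne bdd] by auto
    then show "?ev (\<lambda>n. y < a n)" unfolding S_def by (auto elim: eventually_mono)
  next
    fix y assume "Sup S < y"
    then obtain q :: rat where q: "Sup S < of_rat q" "of_rat q < y" using of_rat_dense by blast
    then have "of_rat q \<notin> S" using cSup_upper[OF _ bdd] by (meson not_le)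
    then have "?ev (\<lambda>n. a n < of_rat q)" using cut unfolding S_def by blast
    then show "?ev (\<lambda>n. a n < y)" using q(2) by (auto elim: eventually_mono)
  qed
  then show ?thesis by (rule convergentI)
qed

text \<open>The weak limit is the norm limit of near-minimal-norm elements of the convex hulls of the
  tails; by the parallelogram law these form a Cauchy sequence.\<close>
lemma weak_limit_exists_bounded:
  fixes z :: "nat \<Rightarrow> 'a::{real_inner, complete_space}"
  assumes bd: "\<And>n. norm (z n) \<le> R" and lim: "\<And>k. (\<lambda>n. z n \<bullet> d k) \<longlonglongrightarrow> L k"
  obtains v where "\<And>k. v \<bullet> d k = L k"
proof -
  define K where "K m = convex hull (z ` {m..})" for m
  define \<eta> :: "nat \<Rightarrow> real" where "\<eta> m = 1 / real (Suc m)" for m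
  have \<eta>: "0 < \<eta> m" "\<eta> \<longlonglongrightarrow> 0" for m
    unfolding \<eta>_def by (simp, rule LIMSEQ_Suc[OF lim_1_over_n])
  define \<delta> where "\<delta> m = Inf ((\<lambda>x. (norm x)\<^sup>2) ` K m)" for m
  have zK: "z m \<in> K m" for m unfolding K_def by (rule hull_inc) simp
  have Kmono: "K l \<subseteq> K m" if "m \<le> l" for l m
    unfolding K_def by (rule hull_mono) (use that in auto)
  have bb: "bdd_below ((\<lambda>x. (norm x)\<^sup>2) ` K m)" for m by (rule bdd_belowI[of _ 0]) auto
  have \<delta>_le: "\<delta> m \<le> (norm x)\<^sup>2" if "x \<in> K m" for x m
    unfolding \<delta>_def using that by (intro cInf_lower[OF _ bb]) auto
  have "\<exists>x. x \<in> K m \<and> (norm x)\<^sup>2 < \<delta> m + \<eta> m" for m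
    using cInf_lessD[of "(\<lambda>x. (norm x)\<^sup>2) ` K m" "\<delta> m + \<eta> m"] zK[of m]
      \<eta>(1)[of m] unfolding \<delta>_def by auto
  then obtain p where p: "\<And>m. p m \<in> K m" "\<And>m. (norm (p m))\<^sup>2 < \<delta> m + \<eta> m" by metis
  have \<delta>_mono: "\<delta> m \<le> \<delta> l" if "m \<le> l" for m l
  proof -
    have "K l \<noteq> {}" using zK by auto
    then show ?thesis
      unfolding \<delta>_def[of l] using Kmono[OF that] by (intro cInf_greatest) (auto intro: \<delta>_le)
  qed
  have "\<delta> m \<le> R\<^sup>2" for m
    using \<delta>_le[OF zK[of m]] power_mono[OF bd norm_ge_zero, of m 2] by linarith
  then obtain D where D: "\<delta> \<longlonglongrightarrow> D" "\<And>m. \<delta> m \<le> D"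
    using incseq_convergent[of \<delta> "R\<^sup>2"] \<delta>_mono by (metis incseq_def)
  \<comment> \<open>The midpoint of \<open>p m\<close> and \<open>p l\<close> lies in
    \<open>K m\<close>, so its squared norm is at least \<open>\<delta> m\<close>. The parallelogram
    law then bounds the squared distance by \<open>2 * (\<delta> m + \<eta> m) + 2 * (D + \<eta> m)
    - 4 * \<delta> m\<close>, which is this value.\<close>
  define b where "b m = 2 * (D - \<delta> m) + 4 * (\<eta> m)" for m
  have close: "(norm (p m - p l))\<^sup>2 \<le> b m" if "m \<le> l" for m l
  proof -
    define c where "c = (norm ((1 / 2) *\<^sub>R p m + (1 / 2) *\<^sub>R p l))\<^sup>2"
    have "(1 / 2) *\<^sub>R p m + (1 / 2) *\<^sub>R p l \<in> K m"
      using p(1)[of m] p(1)[of l] Kmono[OF that] unfolding K_def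
      by (intro convexD[OF convex_convex_hull]) auto
    then have "\<delta> m \<le> c" unfolding c_def by (rule \<delta>_le)
    moreover have "(norm (p m - p l))\<^sup>2
        = 2 * (norm (p m))\<^sup>2 + 2 * (norm (p l))\<^sup>2 - 4 * c"
      by (simp add: c_def power2_norm_eq_inner inner_add inner_diff inner_commute field_simps)
    moreover have "\<eta> l \<le> \<eta> m" unfolding \<eta>_def using that by (intro divide_left_mono) auto
    moreover have "x \<le> 2 * (D - s) + 4 * h"
      if "s \<le> c" "x = 2 * A + 2 * B - 4 * c" "h' \<le> h" "A < s + h" "B < s' + h'" "s' \<le> D"
      for x s s' h h' A B :: real
      using that by argo
    ultimately show ?thesis using p(2)[of m] p(2)[of l] D(2)[of l] unfolding b_def by blast
  qed
  have "b \<longlonglongrightarrow> 2 * (D - D) + 4 * 0"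
    unfolding b_def by (intro tendsto_intros D \<eta>(2))
  then have b0: "b \<longlonglongrightarrow> 0" by simp
  have "Cauchy p"
  proof (rule metric_CauchyI)
    fix e :: real assume e: "0 < e"
    then have "eventually (\<lambda>m. b m < (e / 2)\<^sup>2) sequentially" by (intro order_tendstoD[OF b0]) auto
    then obtain N where N: "b N < (e / 2)\<^sup>2" by (auto simp: eventually_sequentially)
    have "dist (p N) (p n) < e / 2" if "N \<le> n" for n
    proof -
      have "(norm (p N - p n))\<^sup>2 < (e / 2)\<^sup>2" using close[OF that] N by linarith
      then show ?thesis unfolding dist_norm by (rule power2_less_imp_less) (use e in simp)
    qed
    then show "\<exists>M. \<forall>m\<ge>M. \<forall>n\<ge>M. dist (p m) (p n) < e" by (metis dist_triangle_half_r)
  qed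
  then obtain v where v: "p \<longlonglongrightarrow> v" using Cauchy_convergent convergent_def by blast
  have "v \<bullet> d k = L k" for k
  proof (rule LIMSEQ_unique)
    show "(\<lambda>m. p m \<bullet> d k) \<longlonglongrightarrow> v \<bullet> d k" by (intro tendsto_intros v)
    show "(\<lambda>m. p m \<bullet> d k) \<longlonglongrightarrow> L k"
    proof (rule metric_LIMSEQ_I)
      fix e :: real assume "0 < e"
      then obtain N where N: "\<And>n. N \<le> n \<Longrightarrow> dist (z n \<bullet> d k) (L k) < e / 2"
        using metric_LIMSEQ_D[OF lim, of "e / 2" k] by auto
      \<comment> \<open>A slab is convex, so it contains the convex hull of a tail as soon as it
        contains the tail, and with it the points \<open>p m\<close>.\<close>
      let ?H = "{x. d k \<bullet> x \<le> L k + e / 2} \<inter> {x. d k \<bullet> x \<ge> L k - e / 2}"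
      have H: "convex ?H" by (intro convex_Int convex_halfspace_le convex_halfspace_ge)
      have "z n \<in> ?H" if "N \<le> n" for n
        using N[OF that] unfolding dist_real_def inner_commute[of "z n"] by (auto simp: abs_if split: if_splits)
      then have "K m \<subseteq> ?H" if "N \<le> m" for m
        unfolding K_def using that by (intro hull_minimal H) auto
      then have "p m \<in> ?H" if "N \<le> m" for m using p(1) that by blast
      then have "dist (p m \<bullet> d k) (L k) < e" if "N \<le> m" for m
        using that[THEN \<open>\<And>m. N \<le> m \<Longrightarrow> p m \<in> ?H\<close>] \<open>0 < e\<close>
        by (auto simp: dist_real_def inner_commute abs_less_iff)
      then show "\<exists>no. \<forall>n\<ge>no. dist (p n \<bullet> d k) (L k) < e" by blast
    qed
  qed
  then show thesis by (rule that)
qed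

text \<open>The bound is only required infinitely often, which is all that a finite liminf provides;
  a bounded subsequence has the same limits \<open>L k\<close>.\<close>

lemma weak_limit_exists:
  fixes z :: "nat \<Rightarrow> 'a::{real_inner, complete_space}"
  assumes fr: "\<exists>\<^sub>F n in sequentially. norm (z n) \<le> R" and lim: "\<And>k. (\<lambda>n. z n \<bullet> d k) \<longlonglongrightarrow> L k"
  obtains v where "\<And>k. v \<bullet> d k = L k"
proof -
  have "infinite {n. norm (z n) \<le> R}"
    using fr by (simp add: cofinite_eq_sequentially[symmetric] frequently_cofinite)
  then obtain r :: "nat \<Rightarrow> nat" where r: "strict_mono r" "\<And>n. norm (z (r n)) \<le> R"
    using infinite_enumerate by (metis mem_Collect_eq)
  have "(\<lambda>n. z (r n) \<bullet> d k) \<longlonglongrightarrow> L k" for k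
    using LIMSEQ_subseq_LIMSEQ[OF lim r(1), of k] by (simp add: comp_def)
  then show thesis
    by (rule weak_limit_exists_bounded[of "\<lambda>n. z (r n)" R d L, OF r(2)]) (rule that)
qed

section \<open>Coding points by the Cantor set\<close>

definition cantor :: "(nat \<Rightarrow> bool) \<Rightarrow> real" where
  "cantor b = (\<Sum>n. (if b n then 2 else 0) / 3 ^ Suc n)"

lemma cantor_geometric: "(\<lambda>n. 2 / 3 ^ Suc n) sums (1 :: real)"
  using sums_mult[OF geometric_sums[of "1 / 3 :: real"], of "2 / 3"] by (simp add: power_divide)

lemma summable_cantor: "summable (\<lambda>n. (if b n then 2 else 0) / 3 ^ Suc n :: real)"
  by (rule summable_comparison_test'[OF sums_summable[OF cantor_geometric], of 0]) auto

lemma cantor_bounds: "0 \<le> cantor b" "cantor b \<le> 1"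
proof -
  show "0 \<le> cantor b" unfolding cantor_def by (rule suminf_nonneg[OF summable_cantor]) auto
  have "cantor b \<le> (\<Sum>n. 2 / 3 ^ Suc n)" unfolding cantor_def
    by (rule suminf_le[OF _ summable_cantor sums_summable[OF cantor_geometric]])
      (auto intro: divide_right_mono)
  then show "cantor b \<le> 1" using sums_unique[OF cantor_geometric] by simp
qed

lemma cantor_rec: "cantor b = (if b 0 then 2 else 0) / 3 + cantor (\<lambda>n. b (Suc n)) / 3"
proof -
  have "cantor b = (if b 0 then 2 else 0) / 3 + (\<Sum>n. (if b (Suc n) then 2 else 0) / 3 ^ Suc (Suc n))"
    using suminf_split_head[OF summable_cantor[of b]] unfolding cantor_def by simp
  also have "(\<Sum>n. (if b (Suc n) then 2 else 0) / 3 ^ Suc (Suc n)) = cantor (\<lambda>n. b (Suc n)) / 3"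
    unfolding cantor_def suminf_divide[OF summable_cantor, symmetric] by (simp add: field_simps)
  finally show ?thesis .
qed

text \<open>Digits 0 and 2 in base 3 leave gaps: if the leading digits differ, the tails, worth at
  most 1/3, cannot close the difference of 2/3; otherwise peel off the common digit. Each digit is
  thus locally constant on the codes, which base 2 would not give.\<close>

lemma cantor_gap:
  assumes "b j \<noteq> b' j"
  shows "1 / 3 ^ Suc j \<le> \<bar>cantor b - cantor b'\<bar>"
  using assms
proof (induction j arbitrary: b b')
  case 0
  then show ?case
    using cantor_bounds[of "\<lambda>n. b (Suc n)"] cantor_bounds[of "\<lambda>n. b' (Suc n)"]
    by (cases "b 0") (auto simp: cantor_rec[of b] cantor_rec[of b'])
next
  case (Suc j)
  let ?c = "cantor (\<lambda>n. b (Suc n))" and ?c' = "cantor (\<lambda>n. b' (Suc n))"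
  show ?case
  proof (cases "b 0 = b' 0")
    case True
    then have "\<bar>cantor b - cantor b'\<bar> = \<bar>?c - ?c'\<bar> / 3"
      by (simp add: cantor_rec[of b] cantor_rec[of b'] diff_divide_distrib[symmetric])
    moreover have "1 / 3 ^ Suc j \<le> \<bar>?c - ?c'\<bar>" using Suc by auto
    ultimately show ?thesis by simp
  next
    case False
    then have "1 / 3 \<le> \<bar>cantor b - cantor b'\<bar>"
      using cantor_bounds[of "\<lambda>n. b (Suc n)"] cantor_bounds[of "\<lambda>n. b' (Suc n)"]
      by (cases "b 0") (auto simp: cantor_rec[of b] cantor_rec[of b'])
    moreover have "1 / 3 ^ Suc (Suc j) \<le> (1 / 3 :: real)"
      using power_decreasing[of 1 "Suc (Suc j)" "1 / 3 :: real"] by (simp add: power_divide)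
    ultimately show ?thesis by linarith
  qed
qed

definition set_code :: "(nat \<Rightarrow> 'a set) \<Rightarrow> 'a \<Rightarrow> real" where
  "set_code B x = cantor (\<lambda>j. x \<in> B j)"

lemma measurable_set_code:
  assumes [measurable]: "\<And>j. B j \<in> sets M"
  shows "set_code B \<in> borel_measurable M"
  unfolding set_code_def cantor_def by (intro borel_measurable_suminf) measurable

lemma set_code_decoder:
  fixes d :: "nat \<Rightarrow> 'a::{complete_space, second_countable_topology}"
  assumes d: "dense_seq d" and B: "\<And>i n. B (j i n) = ball (d i) (1 / real (Suc n))"
  obtains g :: "real \<Rightarrow> 'a" where "g \<in> borel_measurable borel" "\<And>x. g (set_code B x) = x"
proof -
  let ?s = "set_code B"
  \<comment> \<open>The gap survives the closure, so \<open>T j\<close> is a Borel set of reals that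
    decides membership in \<open>B j\<close> from the code.\<close>
  define T where "T j = closure (?s ` B j)" for j
  have T [measurable]: "T j \<in> sets borel" for j unfolding T_def by simp
  have sT: "?s x \<in> T j \<longleftrightarrow> x \<in> B j" for x j
  proof
    assume x: "?s x \<in> T j"
    show "x \<in> B j"
    proof (rule ccontr)
      assume "x \<notin> B j"
      then have "?s ` B j \<subseteq> {t. 1 / 3 ^ Suc j \<le> \<bar>t - ?s x\<bar>}"
        unfolding set_code_def by (auto intro!: cantor_gap simp del: power_Suc)
      then have "T j \<subseteq> {t. 1 / 3 ^ Suc j \<le> \<bar>t - ?s x\<bar>}"
        unfolding T_def by (intro closure_minimal closed_Collect_le continuous_intros) auto
      with x have "1 / 3 ^ Suc j \<le> \<bar>?s x - ?s x\<bar>" by blast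
      moreover have "(0::real) < 1 / 3 ^ Suc j" by simp
      ultimately show False by linarith
    qed
  next
    show "?s x \<in> T j" if "x \<in> B j"
      unfolding T_def using that closure_subset[of "?s ` B j"] by blast
  qed
  \<comment> \<open>On the code of \<open>x\<close> this picks the first dense point within 1/(n+1)
    of \<open>x\<close>, hence a sequence converging to \<open>x\<close>.\<close>
  define a where "a n t = d (LEAST i. t \<in> T (j i n))" for n t
  have [measurable]: "a n \<in> borel_measurable borel" for n
  proof -
    have "(\<lambda>t. LEAST i. t \<in> T (j i n)) \<in> measurable borel (count_space UNIV)" by measurable
    then show ?thesis unfolding a_def by (rule measurable_compose) simp
  qed
  \<comment> \<open>Away from codes the sequence need not converge; the value \<open>d 0\<close>
    makes the decoder total and keeps it measurable.\<close>
  define g where "g t = (if Cauchy (\<lambda>n. a n t) then lim (\<lambda>n. a n t) else d 0)" for t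
  have C: "{t \<in> space borel. Cauchy (\<lambda>n. a n t)} \<in> sets borel" by measurable
  have "g \<in> borel_measurable borel"
  proof (rule borel_measurable_LIMSEQ_metric)
    show "(\<lambda>t. if Cauchy (\<lambda>n. a n t) then a n t else d 0) \<in> borel_measurable borel" for n
      using C by (intro measurable_If) (auto simp: pred_def)
    show "(\<lambda>n. if Cauchy (\<lambda>n. a n t) then a n t else d 0) \<longlonglongrightarrow> g t" for t
      using Cauchy_convergent[of "\<lambda>n. a n t"] by (auto simp: g_def convergent_LIMSEQ_iff)
  qed
  moreover have "g (?s x) = x" for x
  proof -
    have "dist (a n (?s x)) x < 1 / real (Suc n)" for n
      using dist_cell[OF d, of "1 / real (Suc n)" x] by (simp add: a_def sT B cell_def)
    then have "(\<lambda>n. a n (?s x)) \<longlonglongrightarrow> x" by (rule tendsto_of_dist_less)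
    then show ?thesis by (simp add: g_def limI LIMSEQ_imp_Cauchy)
  qed
  ultimately show thesis by (rule that)
qed

text \<open>Coding points by the Cantor set transfers Helly's selection theorem and Skorohod's
  representation from the real line.\<close>
lemma coded_representation:
  fixes \<mu> :: "nat \<Rightarrow> 'a::topological_space measure" and g :: "real \<Rightarrow> 'a"
  assumes \<mu>: "\<And>n. prob_space (\<mu> n)" "\<And>n. sets (\<mu> n) = sets borel"
    and B: "\<And>j. B j \<in> sets borel"
    and g: "g \<in> borel_measurable borel" "\<And>x. g (set_code B x) = x"
  obtains r :: "nat \<Rightarrow> nat" and \<Omega> :: "real measure" and Z where
    "strict_mono r" "prob_space \<Omega>" "\<And>n. Z n \<in> borel_measurable \<Omega>"
    "\<And>n. distr \<Omega> borel (Z n) = \<mu> (r n)"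
    "AE w in \<Omega>. \<forall>j. (\<forall>\<^sub>F n in sequentially. Z n w \<in> B j) \<or> (\<forall>\<^sub>F n in sequentially. Z n w \<notin> B j)"
proof -
  let ?s = "set_code B"
  have s [measurable]: "?s \<in> borel_measurable borel" by (rule measurable_set_code[OF B])
  then have s\<mu> [measurable]: "?s \<in> borel_measurable (\<mu> n)" for n using \<mu>(2) by (simp cong: measurable_cong_sets)
  note [measurable] = g(1)
  define \<rho> where "\<rho> n = distr (\<mu> n) borel ?s" for n
  have \<rho>: "real_distribution (\<rho> n)" for n
    unfolding \<rho>_def using \<mu>(1) s\<mu> by (intro prob_space.real_distribution_distr) auto
  have "tight \<rho>"
    unfolding tight_def
  proof (intro conjI allI impI \<rho>)
    fix \<epsilon> :: real assume "0 < \<epsilon>"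
    \<comment> \<open>All codes lie between 0 and 1, which makes tightness automatic. The interval
      starts at -1 since it is open on the left.\<close>
    moreover have "measure (\<rho> n) {-1<..1} = 1" for n
    proof -
      have "?s -` {-1<..1} \<inter> space (\<mu> n) = space (\<mu> n)"
        using less_le_trans[of "-1" 0, OF _ cantor_bounds(1)] by (auto simp: set_code_def cantor_bounds)
      then show ?thesis
        unfolding \<rho>_def using prob_space.prob_space[OF \<mu>(1)] by (subst measure_distr) auto
    qed
    ultimately show "\<exists>a b. a < b \<and> (\<forall>n. 1 - \<epsilon> < measure (\<rho> n) {a<..b})"
      by (intro exI[of _ "-1"] exI[of _ 1]) auto
  qed
  from tight_imp_convergent_subsubsequence[OF this strict_mono_id]
  obtain r M where r: "strict_mono (r :: nat \<Rightarrow> nat)" and M: "real_distribution M"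
    "weak_conv_m (\<lambda>n. \<rho> (r n)) M" by (auto simp: comp_def)
  obtain \<Omega> :: "real measure" and S S' where \<Omega>: "prob_space \<Omega>" and
    S [measurable]: "\<And>n. S n \<in> borel_measurable \<Omega>" and
    lawS: "\<And>n. distr \<Omega> borel (S n) = \<rho> (r n)" and
    limS: "\<And>w. w \<in> space \<Omega> \<Longrightarrow> (\<lambda>n. S n w) \<longlonglongrightarrow> S' w"
    using Skorohod[OF \<rho> M] by blast
  define Z where "Z n w = g (S n w)" for n w
  have Z: "Z n \<in> borel_measurable \<Omega>" for n unfolding Z_def by measurable
  have lawZ: "distr \<Omega> borel (Z n) = \<mu> (r n)" for n
  proof -
    have "distr \<Omega> borel (Z n) = distr (distr \<Omega> borel (S n)) borel g"
      unfolding Z_def by (simp add: distr_distr comp_def)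
    also have "\<dots> = distr (\<mu> (r n)) borel (\<lambda>x. g (?s x))"
      unfolding lawS \<rho>_def by (simp add: distr_distr comp_def)
    also have "\<dots> = \<mu> (r n)" unfolding g(2) by (intro distr_id2) (simp add: \<mu>(2))
    finally show ?thesis .
  qed
  \<comment> \<open>The law of \<open>S n\<close> is carried by codes, on which encoding inverts
    decoding.\<close>
  have "AE w in \<Omega>. ?s (Z n w) = S n w" for n
  proof -
    have "AE t in \<rho> (r n). ?s (g t) = t"
      unfolding \<rho>_def by (subst AE_distr_iff) (auto simp: g(2))
    then show ?thesis
      unfolding lawS[symmetric] Z_def by (subst (asm) AE_distr_iff) auto
  qed
  then have "AE w in \<Omega>. \<forall>n. ?s (Z n w) = S n w" by (subst AE_all_countable) auto
  then have "AE w in \<Omega>. \<forall>j. (\<forall>\<^sub>F n in sequentially. Z n w \<in> B j) \<or> (\<forall>\<^sub>F n in sequentially. Z n w \<notin> B j)"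
    using AE_space
  proof eventually_elim
    case (elim w)
    show ?case
    proof
      fix j
      \<comment> \<open>Half of the gap at digit j, so that any two late codes agree in that digit.
        The limit \<open>S' w\<close> need not be a code itself and is never decoded.\<close>
      have "eventually (\<lambda>n. dist (S n w) (S' w) < 1 / 3 ^ Suc j / 2) sequentially"
        using limS[OF elim(2)] by (intro tendstoD) auto
      then obtain N where N: "\<And>n. N \<le> n \<Longrightarrow> dist (S n w) (S' w) < 1 / 3 ^ Suc j / 2"
        by (auto simp: eventually_sequentially)
      have same: "Z n w \<in> B j \<longleftrightarrow> Z N w \<in> B j" if "N \<le> n" for n
      proof (rule ccontr)
        assume "\<not> ?thesis"
        then have "1 / 3 ^ Suc j \<le> \<bar>?s (Z n w) - ?s (Z N w)\<bar>"
          unfolding set_code_def by (intro cantor_gap) auto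
        moreover have "dist (S n w) (S N w) < 1 / 3 ^ Suc j"
          using N[OF that] N[OF order_refl] by (rule dist_triangle_half_l)
        ultimately show False using elim(1) by (simp add: dist_real_def)
      qed
      show "(\<forall>\<^sub>F n in sequentially. Z n w \<in> B j) \<or> (\<forall>\<^sub>F n in sequentially. Z n w \<notin> B j)"
        unfolding eventually_sequentially by (cases "Z N w \<in> B j") (use same in blast)+
    qed
  qed
  with r \<Omega> Z lawZ show thesis by (rule that)
qed

section \<open>Extraction of a weakly convergent subsequence\<close>

lemma ennreal_norm_sq_le_liminf:
  fixes v :: "'a::real_inner" and z :: "nat \<Rightarrow> 'a"
  assumes d: "dense_seq d" and lim: "\<And>k. (\<lambda>n. z n \<bullet> d k) \<longlonglongrightarrow> v \<bullet> d k"
  shows "ennreal ((norm v)\<^sup>2) \<le> liminf (\<lambda>n. ennreal ((norm (z n))\<^sup>2))"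
proof (rule ccontr)
  assume "\<not> ?thesis"
  then obtain c' where c': "liminf (\<lambda>n. ennreal ((norm (z n))\<^sup>2)) < c'" "c' < ennreal ((norm v)\<^sup>2)"
    using dense not_le by metis
  define c where "c = enn2real c'"
  have c: "0 \<le> c" "c' = ennreal c" using less_le_trans[OF c'(2) top_greatest] by (auto simp: c_def)
  \<comment> \<open>Infinitely many \<open>z n\<close> lie in the ball of radius
    \<open>sqrt c\<close>; that ball is cut out by conditions on the inner products, which pass to
    the weak limit and put \<open>v\<close> into it.\<close>
  have fr: "\<exists>\<^sub>F n in sequentially. (norm (z n))\<^sup>2 < c"
  proof (rule ccontr)
    assume "\<not> ?thesis"
    then have "\<forall>\<^sub>F n in sequentially. c' \<le> ennreal ((norm (z n))\<^sup>2)"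
      unfolding c(2) by (auto simp: frequently_def not_less elim: eventually_mono intro: ennreal_leI)
    then have "c' \<le> liminf (\<lambda>n. ennreal ((norm (z n))\<^sup>2))" by (rule Liminf_bounded)
    then show False using c'(1) by simp
  qed
  have "v \<bullet> d k \<le> sqrt c * norm (d k)" for k
  proof (rule ccontr)
    assume "\<not> ?thesis"
    then have "\<forall>\<^sub>F n in sequentially. sqrt c * norm (d k) < z n \<bullet> d k"
      using order_tendstoD(1)[OF lim] by auto
    from frequently_eventually_conj[OF fr this] have "\<exists>\<^sub>F n in sequentially. False"
    proof (rule frequently_elim1)
      fix n assume *: "sqrt c * norm (d k) < z n \<bullet> d k \<and> (norm (z n))\<^sup>2 < c"
      then have "norm (z n) \<le> sqrt c" by (intro real_le_rsqrt) auto
      then have "z n \<bullet> d k \<le> sqrt c * norm (d k)"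
        by (meson mult_right_mono norm_cauchy_schwarz norm_ge_zero order_trans)
      with * show False by simp
    qed
    then show False by simp
  qed
  then have "norm v \<le> sqrt c" using norm_le_dense_iff[OF d, of "sqrt c" v] c(1) by simp
  then have "(norm v)\<^sup>2 \<le> c" using c(1) power_mono[of "norm v" "sqrt c" 2] by simp
  then have "ennreal ((norm v)\<^sup>2) \<le> c'" unfolding c(2) by (rule ennreal_leI)
  then show False using c'(2) by simp
qed

text \<open>The coded family contains balls, for decoding, and all half-spaces of the
  \<open>d k\<close> with rational thresholds, so that eventually constant memberships become
  rational cuts of the inner products. Fatou's lemma supplies almost surely the boundedness that the
  cuts need.\<close>

lemma weak_subsequence:
  fixes \<mu> :: "nat \<Rightarrow> 'a::{real_inner, polish_space} measure"
  assumes d: "dense_seq d" and \<mu>: "\<And>n. \<mu> n \<in> P2" and R: "\<And>n. msq (\<mu> n) \<le> R"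
  obtains r :: "nat \<Rightarrow> nat" and \<Omega> :: "real measure" and Z and Z' where
    "strict_mono r" "prob_space \<Omega>" "\<And>n. sq_integrable \<Omega> (Z n)"
    "\<And>n. distr \<Omega> borel (Z n) = \<mu> (r n)" "Z' \<in> borel_measurable \<Omega>"
    "AE w in \<Omega>. \<forall>k. (\<lambda>n. Z n w \<bullet> d k) \<longlonglongrightarrow> Z' w \<bullet> d k"
    "(\<integral>\<^sup>+w. ennreal ((norm (Z' w))\<^sup>2) \<partial>\<Omega>) \<le> liminf (\<lambda>n. ennreal (msq (\<mu> (r n))))"
proof -
  define idx :: "nat \<Rightarrow> (nat \<times> rat) + (nat \<times> nat)" where "idx = from_nat"
  define B where "B j = (case idx j of Inl (k, q) \<Rightarrow> {x. of_rat q \<le> x \<bullet> d k}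
      | Inr (i, n) \<Rightarrow> ball (d i) (1 / real (Suc n)))" for j
  have B: "B j \<in> sets borel" for j
    by (auto simp: B_def split: sum.splits)
  have Bball: "B (to_nat (Inr (i, n) :: (nat \<times> rat) + (nat \<times> nat))) = ball (d i) (1 / real (Suc n))" for i n
    by (simp add: B_def idx_def)
  have Bhalf: "B (to_nat (Inl (k, q) :: (nat \<times> rat) + (nat \<times> nat))) = {x. of_rat q \<le> x \<bullet> d k}" for k q
    by (simp add: B_def idx_def)
  obtain g where g: "g \<in> borel_measurable borel" "\<And>x. g (set_code B x) = x"
    by (rule set_code_decoder[OF d Bball]) blast
  obtain r and \<Omega> :: "real measure" and Z where r: "strict_mono (r :: nat \<Rightarrow> nat)" and \<Omega>: "prob_space \<Omega>"
    and Z [measurable]: "\<And>n. Z n \<in> borel_measurable \<Omega>" and law: "\<And>n. distr \<Omega> borel (Z n) = \<mu> (r n)"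
    and ae: "AE w in \<Omega>. \<forall>j. (\<forall>\<^sub>F n in sequentially. Z n w \<in> B j) \<or> (\<forall>\<^sub>F n in sequentially. Z n w \<notin> B j)"
    by (rule coded_representation[of \<mu>, OF P2_D(1)[OF \<mu>] P2_D(2)[OF \<mu>] B g]) blast
  have L2: "sq_integrable \<Omega> (Z n)" for n
    using law \<mu> by (intro sq_integrable_of_law Z) auto
  have int: "(\<integral>\<^sup>+w. ennreal ((norm (Z n w))\<^sup>2) \<partial>\<Omega>) = ennreal (msq (\<mu> (r n)))" for n
    using integral_norm_sq_distr[OF L2, of n] law[of n] sq_integrable_integrable[OF L2, of n]
    by (simp add: nn_integral_eq_integral)
  define l where "l w = liminf (\<lambda>n. ennreal ((norm (Z n w))\<^sup>2))" for w
  have [measurable]: "l \<in> borel_measurable \<Omega>" unfolding l_def by measurable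
  have intl: "(\<integral>\<^sup>+w. l w \<partial>\<Omega>) \<le> liminf (\<lambda>n. ennreal (msq (\<mu> (r n))))"
    unfolding l_def int[symmetric] by (rule nn_integral_liminf) measurable
  have "liminf (\<lambda>n. ennreal (msq (\<mu> (r n)))) \<le> liminf (\<lambda>n. ennreal R)"
    by (intro Liminf_mono always_eventually allI ennreal_leI R)
  also have "\<dots> = ennreal R" by (simp add: Liminf_const)
  finally have "(\<integral>\<^sup>+w. l w \<partial>\<Omega>) \<le> ennreal R" using intl by (rule order_trans[rotated])
  also have "ennreal R < \<infinity>" by simp
  finally have "AE w in \<Omega>. l w \<noteq> \<infinity>" by (intro nn_integral_PInf_AE) auto
  then have fin: "AE w in \<Omega>. l w < \<infinity>" by (simp add: less_top)
  \<comment> \<open>A finite liminf bounds \<open>Z n w\<close> only for infinitely many n; the cut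
    criterion and the existence of weak limits both ask for no more.\<close>
  have bounded: "\<exists>R. \<exists>\<^sub>F n in sequentially. norm (Z n w) \<le> R" if lw: "l w < \<infinity>" for w
  proof -
    obtain c' where c': "l w < c'" "c' < \<infinity>" using dense[OF lw] by blast
    have "\<exists>\<^sub>F n in sequentially. norm (Z n w) \<le> sqrt (enn2real c')"
    proof (rule ccontr)
      assume "\<not> ?thesis"
      then have "\<forall>\<^sub>F n in sequentially. c' \<le> ennreal ((norm (Z n w))\<^sup>2)"
      proof (rule eventually_mono[OF iffD1[OF not_frequently]])
        fix n assume "\<not> norm (Z n w) \<le> sqrt (enn2real c')"
        then have "enn2real c' \<le> (norm (Z n w))\<^sup>2" by (meson less_imp_le not_le real_le_rsqrt)
        then show "c' \<le> ennreal ((norm (Z n w))\<^sup>2)" using c'(2) by (metis ennreal_enn2real ennreal_leI infinity_ennreal_def)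
      qed
      then have "c' \<le> l w" unfolding l_def by (rule Liminf_bounded)
      then show False using c'(1) by simp
    qed
    then show ?thesis by blast
  qed
  define Good where "Good w \<longleftrightarrow> (\<forall>k. Cauchy (\<lambda>n. Z n w \<bullet> d k)) \<and> l w < \<infinity>" for w
  have [measurable]: "{w \<in> space \<Omega>. Cauchy (\<lambda>n. Z n w \<bullet> d k)} \<in> sets \<Omega>" for k by measurable
  have Good_sets [measurable]: "Measurable.pred \<Omega> Good" unfolding Good_def by measurable
  have ae_Good: "AE w in \<Omega>. Good w"
    using ae fin
  proof eventually_elim
    case (elim w)
    obtain C where C: "\<exists>\<^sub>F n in sequentially. norm (Z n w) \<le> C" using bounded[OF elim(2)] by blast
    have "convergent (\<lambda>n. Z n w \<bullet> d k)" for k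
    proof (rule convergent_of_rational_cuts)
      show "\<exists>\<^sub>F n in sequentially. \<bar>Z n w \<bullet> d k\<bar> \<le> C * norm (d k)"
        using C by (rule frequently_elim1)
          (meson Cauchy_Schwarz_ineq2 mult_right_mono norm_ge_zero order_trans)
      show "(\<forall>\<^sub>F n in sequentially. of_rat q \<le> Z n w \<bullet> d k) \<or> (\<forall>\<^sub>F n in sequentially. Z n w \<bullet> d k < of_rat q)" for q
        using elim(1)[rule_format, of "to_nat (Inl (k, q) :: (nat \<times> rat) + (nat \<times> nat))"]
        by (simp add: Bhalf not_le)
    qed
    then show "Good w" using elim(2) by (auto simp: Good_def Cauchy_convergent_iff)
  qed
  \<comment> \<open>The choice operator gives no measurability by itself. It is recovered below from
    the inner products with \<open>d k\<close>, which are limits of measurable functions on the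
    measurable event \<open>Good\<close>.\<close>
  define Z' where "Z' w = (if Good w then SOME v. \<forall>k. v \<bullet> d k = lim (\<lambda>n. Z n w \<bullet> d k) else 0)" for w
  have lim: "(\<lambda>n. Z n w \<bullet> d k) \<longlonglongrightarrow> Z' w \<bullet> d k" if G: "Good w" for w k
  proof -
    have L: "(\<lambda>n. Z n w \<bullet> d k) \<longlonglongrightarrow> lim (\<lambda>n. Z n w \<bullet> d k)" for k
      using that by (simp add: Good_def Cauchy_convergent_iff convergent_LIMSEQ_iff)
    obtain C where C: "\<exists>\<^sub>F n in sequentially. norm (Z n w) \<le> C"
      using bounded G unfolding Good_def by blast
    obtain v where "\<And>k. v \<bullet> d k = lim (\<lambda>n. Z n w \<bullet> d k)"
      by (rule weak_limit_exists[of "\<lambda>n. Z n w" C d "\<lambda>k. lim (\<lambda>n. Z n w \<bullet> d k)", OF C L]) blast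
    then have "\<exists>v. \<forall>k. v \<bullet> d k = lim (\<lambda>n. Z n w \<bullet> d k)" by (intro exI allI)
    from someI_ex[OF this] have "\<forall>k. Z' w \<bullet> d k = lim (\<lambda>n. Z n w \<bullet> d k)"
      unfolding Z'_def if_P[OF G] .
    then show ?thesis using L[of k] by simp
  qed
  have "Z' \<in> borel_measurable \<Omega>"
  proof (rule borel_measurable_of_inner[OF d])
    fix k
    show "(\<lambda>w. Z' w \<bullet> d k) \<in> borel_measurable \<Omega>"
    proof (rule borel_measurable_LIMSEQ_metric)
      show "(\<lambda>w. if Good w then Z n w \<bullet> d k else 0) \<in> borel_measurable \<Omega>" for n by measurable
      show "(\<lambda>n. if Good w then Z n w \<bullet> d k else 0) \<longlonglongrightarrow> Z' w \<bullet> d k" for w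
        using lim[of w k] by (cases "Good w") (auto simp: Z'_def)
    qed
  qed
  moreover have "AE w in \<Omega>. \<forall>k. (\<lambda>n. Z n w \<bullet> d k) \<longlonglongrightarrow> Z' w \<bullet> d k"
    using ae_Good by eventually_elim (simp add: lim)
  moreover have "(\<integral>\<^sup>+w. ennreal ((norm (Z' w))\<^sup>2) \<partial>\<Omega>) \<le> liminf (\<lambda>n. ennreal (msq (\<mu> (r n))))"
  proof (rule order_trans[OF nn_integral_mono intl])
    fix w
    show "ennreal ((norm (Z' w))\<^sup>2) \<le> l w"
    proof (cases "Good w")
      case True
      then show ?thesis unfolding l_def by (intro ennreal_norm_sq_le_liminf[OF d] lim)
    qed (simp add: Z'_def)
  qed
  ultimately show thesis using r \<Omega> L2 law that by blast
qed

section \<open>Continuity of the correlation under weak convergence\<close>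

text \<open>A second-moment bound gives uniform integrability: up to \<open>\<delta>\<close> times
  the square, the absolute value is a bounded function, to which dominated convergence
  applies.\<close>

lemma integral_abs_tendsto_0:
  fixes r :: "nat \<Rightarrow> 'b \<Rightarrow> real"
  assumes M: "prob_space M" and r [measurable]: "\<And>n. r n \<in> borel_measurable M"
    and sq: "\<And>n. integrable M (\<lambda>w. (r n w)\<^sup>2)" and C: "\<And>n. (\<integral>w. (r n w)\<^sup>2 \<partial>M) \<le> C"
    and lim: "AE w in M. (\<lambda>n. r n w) \<longlonglongrightarrow> 0"
  shows "(\<lambda>n. \<integral>w. \<bar>r n w\<bar> \<partial>M) \<longlonglongrightarrow> 0"
proof (rule order_tendstoI)
  interpret prob_space M by fact
  have "0 \<le> (\<integral>w. (r 0 w)\<^sup>2 \<partial>M)" by simp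
  then have C0: "0 \<le> C" using C[of 0] by linarith
  show "\<forall>\<^sub>F n in sequentially. a < (\<integral>w. \<bar>r n w\<bar> \<partial>M)" if "a < 0" for a
    using that by (intro always_eventually allI less_le_trans[OF that]) simp
  show "\<forall>\<^sub>F n in sequentially. (\<integral>w. \<bar>r n w\<bar> \<partial>M) < e" if e: "0 < e" for e
  proof -
    \<comment> \<open>The square term then contributes at most \<open>e / 2\<close>;
      \<open>C + 1\<close> avoids division by zero.\<close>
    define \<delta> where "\<delta> = e / (2 * (C + 1))"
    have \<delta>: "0 < \<delta>" "\<delta> * C \<le> e / 2" using e C0 by (auto simp: \<delta>_def field_simps)
    \<comment> \<open>The maximum of \<open>x - \<delta> * x\<^sup>2\<close> is
      \<open>1 / (4 * \<delta>)\<close>, which makes \<open>h n\<close> bounded.\<close>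
    define h where "h n w = max 0 (\<bar>r n w\<bar> - \<delta> * (r n w)\<^sup>2)" for n w
    have [measurable]: "h n \<in> borel_measurable M" for n unfolding h_def by measurable
    have h_le: "h n w \<le> 1 / (4 * \<delta>)" for n w
    proof -
      have "0 \<le> (2 * \<delta> * \<bar>r n w\<bar> - 1)\<^sup>2" by simp
      then have "4 * \<delta> * (\<bar>r n w\<bar> - \<delta> * (r n w)\<^sup>2) \<le> 1"
        by (simp add: power2_eq_square algebra_simps)
      then have "\<bar>r n w\<bar> - \<delta> * (r n w)\<^sup>2 \<le> 1 / (4 * \<delta>)" using \<delta>(1) by (simp add: field_simps)
      then show ?thesis using \<delta>(1) by (simp add: h_def)
    qed
    have h0: "0 \<le> h n w" for n w by (simp add: h_def)
    have hint: "integrable M (h n)" for n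
      by (rule integrable_const_bound[of _ "1 / (4 * \<delta>)"]) (use h_le h0 in auto)
    have "(\<lambda>n. \<integral>w. h n w \<partial>M) \<longlonglongrightarrow> (\<integral>w. 0 \<partial>M)"
    proof (rule integral_dominated_convergence[where w = "\<lambda>_. 1 / (4 * \<delta>)"])
      show "AE w in M. (\<lambda>n. h n w) \<longlonglongrightarrow> 0"
        using lim
      proof eventually_elim
        case (elim w)
        have "(\<lambda>n. h n w) \<longlonglongrightarrow> max 0 (\<bar>0\<bar> - \<delta> * 0\<^sup>2)"
          unfolding h_def by (intro tendsto_intros elim)
        then show ?case by simp
      qed
    qed (use h_le h0 in auto)
    then have "\<forall>\<^sub>F n in sequentially. (\<integral>w. h n w \<partial>M) < e / 2"
      using e by (intro order_tendstoD) auto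
    then show ?thesis
    proof eventually_elim
      case (elim n)
      have "(\<integral>w. \<bar>r n w\<bar> \<partial>M) \<le> (\<integral>w. h n w + \<delta> * (r n w)\<^sup>2 \<partial>M)"
      proof (rule integral_mono')
        show "integrable M (\<lambda>w. h n w + \<delta> * (r n w)\<^sup>2)" using hint sq by simp
        show "\<bar>r n w\<bar> \<le> h n w + \<delta> * (r n w)\<^sup>2" for w by (simp add: h_def)
        show "0 \<le> h n w + \<delta> * (r n w)\<^sup>2" for w using h0 \<delta>(1) by simp
      qed
      also have "\<dots> = (\<integral>w. h n w \<partial>M) + \<delta> * (\<integral>w. (r n w)\<^sup>2 \<partial>M)" using hint sq by simp
      also have "\<delta> * (\<integral>w. (r n w)\<^sup>2 \<partial>M) \<le> \<delta> * C" using \<delta>(1) C by (intro mult_left_mono) auto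
      finally show ?case using elim \<delta>(2) by linarith
    qed
  qed
qed

text \<open>Round \<open>y\<close> to the dense point of its cell, then replace points of index at
  least \<open>K\<close> by 0; dominated convergence removes the effect of the cut-off as
  \<open>K\<close> grows.\<close>

lemma finite_valued_approximation:
  fixes \<nu> :: "'a::{real_inner, polish_space} measure"
  assumes d: "dense_seq d" and \<nu>: "\<nu> \<in> P2" and e: "0 < e"
  obtains K :: nat and \<psi> where "sq_integrable \<nu> \<psi>" "\<And>y. \<psi> y = 0 \<or> \<psi> y \<in> d ` {..<K}"
    "(\<integral>y. (norm (y - \<psi> y))\<^sup>2 \<partial>\<nu>) < e"
proof -
  interpret \<nu>: prob_space \<nu> using P2_D[OF \<nu>] by simp
  define \<delta> where "\<delta> = sqrt (e / 2)"
  have \<delta>: "0 < \<delta>" "\<delta>\<^sup>2 = e / 2" using e by (auto simp: \<delta>_def)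
  let ?k = "cell d \<delta>"
  define \<psi> where "\<psi> K y = (if ?k y < K then d (?k y) else 0)" for K y
  have [measurable_cong]: "sets \<nu> = sets borel" using P2_D[OF \<nu>] by simp
  have dk [measurable]: "(\<lambda>y. d (?k y)) \<in> borel_measurable borel"
    by (rule measurable_compose[OF measurable_cell]) simp
  have [measurable]: "Measurable.pred borel (\<lambda>y::'a. ?k y < K)" for K
    by (rule measurable_compose[OF measurable_cell, where g = "\<lambda>k. k < K"]) simp
  have [measurable]: "\<psi> K \<in> borel_measurable borel" for K
    unfolding \<psi>_def by measurable
  have ndk: "(norm (y - d (?k y)))\<^sup>2 \<le> \<delta>\<^sup>2" for y
    using dist_cell[OF d \<delta>(1), of y] by (intro power_mono) (auto simp: dist_norm norm_minus_commute)
  \<comment> \<open>The first term covers the rounded points, the second those sent to 0.\<close>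
  have bound: "(norm (y - \<psi> K y))\<^sup>2 \<le> \<delta>\<^sup>2 + (norm y)\<^sup>2" for K y
    using ndk[of y] by (auto simp: \<psi>_def intro: order_trans)
  have id2: "integrable \<nu> (\<lambda>y. (norm y)\<^sup>2)" using sq_integrable_integrable[OF P2_D(4)[OF \<nu>]] .
  have diff: "sq_integrable \<nu> (\<lambda>y. y - \<psi> K y)" for K
    unfolding sq_integrable_def
  proof
    show "integrable \<nu> (\<lambda>y. (norm (y - \<psi> K y))\<^sup>2)"
      by (rule Bochner_Integration.integrable_bound[of _ "\<lambda>y. \<delta>\<^sup>2 + (norm y)\<^sup>2"])
        (use id2 bound in auto)
  qed measurable
  have "(\<lambda>K. \<integral>y. (norm (y - \<psi> K y))\<^sup>2 \<partial>\<nu>) \<longlonglongrightarrow> (\<integral>y. (norm (y - d (?k y)))\<^sup>2 \<partial>\<nu>)"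
  proof (rule integral_dominated_convergence[where w = "\<lambda>y. \<delta>\<^sup>2 + (norm y)\<^sup>2"])
    have "(\<lambda>K. (norm (y - \<psi> K y))\<^sup>2) \<longlonglongrightarrow> (norm (y - d (?k y)))\<^sup>2" for y
      by (rule tendsto_eventually, rule eventually_sequentiallyI[of "Suc (?k y)"]) (simp add: \<psi>_def)
    then show "AE y in \<nu>. (\<lambda>K. (norm (y - \<psi> K y))\<^sup>2) \<longlonglongrightarrow> (norm (y - d (?k y)))\<^sup>2" by simp
  qed (use id2 bound in auto)
  moreover have "(\<integral>y. (norm (y - d (?k y)))\<^sup>2 \<partial>\<nu>) \<le> (\<integral>y. \<delta>\<^sup>2 \<partial>\<nu>)"
    by (rule integral_mono') (use ndk in auto)
  then have "(\<integral>y. (norm (y - d (?k y)))\<^sup>2 \<partial>\<nu>) < e" using \<delta>(2) e by (simp add: \<nu>.prob_space)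
  ultimately have "\<forall>\<^sub>F K in sequentially. (\<integral>y. (norm (y - \<psi> K y))\<^sup>2 \<partial>\<nu>) < e"
    by (intro order_tendstoD)
  then obtain K where K: "(\<integral>y. (norm (y - \<psi> K y))\<^sup>2 \<partial>\<nu>) < e"
    by (auto simp: eventually_sequentially)
  have "sq_integrable \<nu> (\<psi> K)"
    using sq_integrable_diff[OF P2_D(4)[OF \<nu>] diff[of K]] by simp
  then show thesis by (rule that[of "\<psi> K" K]) (use K in \<open>auto simp: \<psi>_def\<close>)
qed

text \<open>Weak convergence tested against \<open>Y\<close> is uniform over all couplings with \<open>Y\<close> of fixed law,
  because one finitely-valued approximation of \<open>Y\<close> serves them all.\<close>
lemma weak_convergence_uniform:
  fixes Z :: "nat \<Rightarrow> 'b \<Rightarrow> 'a::{real_inner, polish_space}" and M :: "'b measure"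
  assumes d: "dense_seq d" and M: "prob_space M" and Z: "\<And>n. sq_integrable M (Z n)"
    and Z': "sq_integrable M Z'" and R: "\<And>n. (\<integral>w. (norm (Z n w))\<^sup>2 \<partial>M) \<le> R"
    and lim: "AE w in M. \<forall>k. (\<lambda>n. Z n w \<bullet> d k) \<longlonglongrightarrow> Z' w \<bullet> d k"
    and \<nu>: "\<nu> \<in> P2" and e: "0 < e"
  shows "\<forall>\<^sub>F n in sequentially. \<forall>(G :: ('b \<times> 'c) measure) Y. prob_space G \<longrightarrow> fst \<in> measurable G M \<longrightarrow>
    distr G M fst = M \<longrightarrow> sq_integrable G Y \<longrightarrow> distr G borel Y = \<nu> \<longrightarrow>
    \<bar>\<integral>w. (Z n (fst w) - Z' (fst w)) \<bullet> Y w \<partial>G\<bar> \<le> e"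
proof -
  interpret M: prob_space M by fact
  define D where "D n w = Z n w - Z' w" for n w
  have D: "sq_integrable M (D n)" for n unfolding D_def by (rule sq_integrable_diff[OF Z Z'])
  note [measurable] = D[THEN sq_integrable_measurable]
  define C where "C = 2 * R + 2 * (\<integral>w. (norm (Z' w))\<^sup>2 \<partial>M)"
  have DC: "(\<integral>w. (norm (D n w))\<^sup>2 \<partial>M) \<le> C" for n
  proof -
    have "(\<integral>w. (norm (D n w))\<^sup>2 \<partial>M) \<le> (\<integral>w. 2 * (norm (Z n w))\<^sup>2 + 2 * (norm (Z' w))\<^sup>2 \<partial>M)"
    proof (rule integral_mono)
      show "(norm (D n w))\<^sup>2 \<le> 2 * (norm (Z n w))\<^sup>2 + 2 * (norm (Z' w))\<^sup>2" for w
        using norm_add_sq_le[of 1 "Z n w" "- Z' w"] by (simp add: D_def)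
    qed (use D Z Z' in \<open>auto simp: sq_integrable_def\<close>)
    also have "\<dots> = 2 * (\<integral>w. (norm (Z n w))\<^sup>2 \<partial>M) + 2 * (\<integral>w. (norm (Z' w))\<^sup>2 \<partial>M)"
      using Z Z' by (simp add: sq_integrable_def)
    finally show ?thesis using R[of n] by (simp add: C_def)
  qed
  have "0 \<le> (\<integral>w. (norm (D 0 w))\<^sup>2 \<partial>M)" by simp
  then have C0: "0 \<le> C" using DC[of 0] by linarith
  have to0: "(\<lambda>n. \<integral>w. \<bar>D n w \<bullet> d k\<bar> \<partial>M) \<longlonglongrightarrow> 0" for k
  proof (rule integral_abs_tendsto_0[OF M])
    have le: "(D n w \<bullet> d k)\<^sup>2 \<le> (norm (d k))\<^sup>2 * (norm (D n w))\<^sup>2" for n w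
      using Cauchy_Schwarz_ineq[of "D n w" "d k"] by (simp add: power2_norm_eq_inner mult.commute)
    show int: "integrable M (\<lambda>w. (D n w \<bullet> d k)\<^sup>2)" for n
      by (rule Bochner_Integration.integrable_bound[of _ "\<lambda>w. (norm (d k))\<^sup>2 * (norm (D n w))\<^sup>2"])
        (use D le in \<open>auto simp: sq_integrable_def\<close>)
    have "(\<integral>w. (D n w \<bullet> d k)\<^sup>2 \<partial>M) \<le> (\<integral>w. (norm (d k))\<^sup>2 * (norm (D n w))\<^sup>2 \<partial>M)" for n
      using D int le by (intro integral_mono) (auto simp: sq_integrable_def)
    also have "(\<integral>w. (norm (d k))\<^sup>2 * (norm (D n w))\<^sup>2 \<partial>M) = (norm (d k))\<^sup>2 * (\<integral>w. (norm (D n w))\<^sup>2 \<partial>M)" for n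
      by simp
    also have "(norm (d k))\<^sup>2 * (\<integral>w. (norm (D n w))\<^sup>2 \<partial>M) \<le> (norm (d k))\<^sup>2 * C" for n
      using DC by (intro mult_left_mono) auto
    finally show "(\<integral>w. (D n w \<bullet> d k)\<^sup>2 \<partial>M) \<le> (norm (d k))\<^sup>2 * C" for n .
    show "AE w in M. (\<lambda>n. D n w \<bullet> d k) \<longlonglongrightarrow> 0"
      using lim
    proof eventually_elim
      case (elim w)
      then have "(\<lambda>n. Z n w \<bullet> d k - Z' w \<bullet> d k) \<longlonglongrightarrow> Z' w \<bullet> d k - Z' w \<bullet> d k"
        by (intro tendsto_diff tendsto_const) auto
      then show ?case by (simp add: D_def inner_diff_left)
    qed
  qed measurable
  \<comment> \<open>The weight \<open>t\<close> makes the \<open>D n\<close> term at most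
    \<open>e / 4\<close>, the accuracy \<open>t * e / 2\<close> of \<open>\<psi>\<close> makes the
    remainder \<open>e / 4\<close>, and the finitely many inner products take \<open>e / 2\<close>.
    Only the last threshold involves n, and it does not see the coupling.\<close>
  define t where "t = e / (2 * (C + 1))"
  have t: "0 < t" "t / 2 * C \<le> e / 4" using e C0 by (auto simp: t_def field_simps)
  have te: "0 < t * e / 2" using t(1) e by simp
  obtain K \<psi> where \<psi>: "sq_integrable \<nu> \<psi>" "\<And>y. \<psi> y = 0 \<or> \<psi> y \<in> d ` {..<K}"
    and \<psi>lt: "(\<integral>y. (norm (y - \<psi> y))\<^sup>2 \<partial>\<nu>) < t * e / 2"
    by (rule finite_valued_approximation[OF d \<nu> te]) blast
  have "(\<lambda>n. \<Sum>k<K. \<integral>w. \<bar>D n w \<bullet> d k\<bar> \<partial>M) \<longlonglongrightarrow> (\<Sum>k<K. 0)"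
    by (intro tendsto_sum to0)
  then have "\<forall>\<^sub>F n in sequentially. (\<Sum>k<K. \<integral>w. \<bar>D n w \<bullet> d k\<bar> \<partial>M) < e / 2"
    using e by (intro order_tendstoD) auto
  then show ?thesis
  proof eventually_elim
    case (elim n)
    show ?case
    proof (intro allI impI)
      fix G :: "('b \<times> 'c) measure" and Y
      assume G: "prob_space G" "fst \<in> measurable G M" "distr G M fst = M"
        and Y: "sq_integrable G Y" "distr G borel Y = \<nu>"
      interpret G: prob_space G by fact
      note [measurable] = G(2) Y(1)[THEN sq_integrable_measurable]
      have sets\<nu>: "sets \<nu> = sets borel" using P2_D[OF \<nu>] by simp
      have [measurable]: "\<psi> \<in> borel_measurable borel"
        using sq_integrable_measurable[OF \<psi>(1)] measurable_cong_sets[OF sets\<nu> refl] by auto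
      have DG: "sq_integrable G (\<lambda>w. D n (fst w))" by (rule sq_integrable_marginal[OF G(2,3) refl D])
      have Yd: "sq_integrable \<nu> (\<lambda>y. y - \<psi> y)" by (rule sq_integrable_diff[OF P2_D(4)[OF \<nu>] \<psi>(1)])
      have Y\<psi>: "sq_integrable G (\<lambda>w. Y w - \<psi> (Y w))"
        by (rule sq_integrable_marginal[of Y G borel \<nu>, OF _ Y(2) sets\<nu>[symmetric] Yd]) simp
      have int1: "(\<integral>w. f (fst w) \<partial>G) = (\<integral>w. f w \<partial>M)" if "f \<in> borel_measurable M" for f :: "'b \<Rightarrow> real"
        using integral_distr[OF G(2) that] G(3) by simp
      have int2: "(\<integral>w. (norm (Y w - \<psi> (Y w)))\<^sup>2 \<partial>G) = (\<integral>y. (norm (y - \<psi> y))\<^sup>2 \<partial>\<nu>)"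
        unfolding Y(2)[symmetric] by (subst integral_distr) auto
      have absI: "integrable M (\<lambda>w. \<bar>D n w \<bullet> d k\<bar>)" for k
        using sq_integrable_inner[OF D[of n], of "\<lambda>_. d k"] by (simp add: sq_integrable_def)
      have absG: "integrable G (\<lambda>w. \<bar>D n (fst w) \<bullet> d k\<bar>)" for k
        using sq_integrable_inner[OF DG, of "\<lambda>_. d k"] by (simp add: sq_integrable_def)
      have pw: "\<bar>D n (fst w) \<bullet> Y w\<bar> \<le> t / 2 * (norm (D n (fst w)))\<^sup>2
          + (norm (Y w - \<psi> (Y w)))\<^sup>2 / (2 * t) + (\<Sum>k<K. \<bar>D n (fst w) \<bullet> d k\<bar>)" for w
      proof -
        have "D n (fst w) \<bullet> Y w = D n (fst w) \<bullet> (Y w - \<psi> (Y w)) + D n (fst w) \<bullet> \<psi> (Y w)"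
          by (simp add: inner_diff_right)
        then have "\<bar>D n (fst w) \<bullet> Y w\<bar> \<le> \<bar>D n (fst w) \<bullet> (Y w - \<psi> (Y w))\<bar> + \<bar>D n (fst w) \<bullet> \<psi> (Y w)\<bar>"
          by linarith
        moreover have "\<bar>D n (fst w) \<bullet> (Y w - \<psi> (Y w))\<bar>
            \<le> t / 2 * (norm (D n (fst w)))\<^sup>2 + (norm (Y w - \<psi> (Y w)))\<^sup>2 / (2 * t)"
          using inner_Young[OF t(1), of "D n (fst w)" "Y w - \<psi> (Y w)"] t(1) by (simp add: field_simps)
        moreover have "\<bar>D n (fst w) \<bullet> \<psi> (Y w)\<bar> \<le> (\<Sum>k<K. \<bar>D n (fst w) \<bullet> d k\<bar>)"
        proof (cases "\<psi> (Y w) = 0")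
          case True
          then show ?thesis by (simp add: sum_nonneg)
        next
          case False
          then obtain k where "k < K" "\<psi> (Y w) = d k" using \<psi>(2)[of "Y w"] by auto
          then show ?thesis
            using member_le_sum[of k "{..<K}" "\<lambda>k. \<bar>D n (fst w) \<bullet> d k\<bar>"] by simp
        qed
        ultimately show ?thesis by linarith
      qed
      have I1: "integrable G (\<lambda>w. (norm (D n (fst w)))\<^sup>2)" by (rule sq_integrable_integrable[OF DG])
      have I2: "integrable G (\<lambda>w. (norm (Y w - \<psi> (Y w)))\<^sup>2)" by (rule sq_integrable_integrable[OF Y\<psi>])
      have "\<bar>\<integral>w. D n (fst w) \<bullet> Y w \<partial>G\<bar> \<le> (\<integral>w. \<bar>D n (fst w) \<bullet> Y w\<bar> \<partial>G)" by (rule integral_abs_bound)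
      also have "\<dots> \<le> (\<integral>w. t / 2 * (norm (D n (fst w)))\<^sup>2
          + (norm (Y w - \<psi> (Y w)))\<^sup>2 / (2 * t) + (\<Sum>k<K. \<bar>D n (fst w) \<bullet> d k\<bar>) \<partial>G)"
        using sq_integrable_inner[OF DG Y(1)] I1 I2 absG pw by (intro integral_mono) auto
      also have "\<dots> = t / 2 * (\<integral>w. (norm (D n (fst w)))\<^sup>2 \<partial>G)
          + (\<integral>w. (norm (Y w - \<psi> (Y w)))\<^sup>2 \<partial>G) / (2 * t) + (\<Sum>k<K. \<integral>w. \<bar>D n (fst w) \<bullet> d k\<bar> \<partial>G)"
        using I1 I2 absG by simp
      also have "\<dots> = t / 2 * (\<integral>w. (norm (D n w))\<^sup>2 \<partial>M)
          + (\<integral>y. (norm (y - \<psi> y))\<^sup>2 \<partial>\<nu>) / (2 * t) + (\<Sum>k<K. \<integral>w. \<bar>D n w \<bullet> d k\<bar> \<partial>M)"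
        by (simp add: int2 int1[of "\<lambda>w. (norm (D n w))\<^sup>2"] int1[of "\<lambda>w. \<bar>D n w \<bullet> d k\<bar>" for k])
      also have "\<dots> \<le> t / 2 * C + (t * e / 2) / (2 * t) + e / 2"
        using DC[of n] \<psi>lt t(1) elim by (intro add_mono mult_left_mono divide_right_mono) auto
      also have "(t * e / 2) / (2 * t) = e / 4" using t(1) by simp
      also have "t / 2 * C + e / 4 + e / 2 \<le> e" using t(2) by linarith
      finally show "\<bar>\<integral>w. (Z n (fst w) - Z' (fst w)) \<bullet> Y w \<partial>G\<bar> \<le> e" unfolding D_def .
    qed
  qed
qed

text \<open>A near-optimal partner of \<open>X\<close> is an admissible partner of
  \<open>X'\<close>. Since \<open>corr\<close> has the moments removed, the two costs differ only by
  twice the difference of the inner products.\<close>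

lemma corr_le_of_inner_bound:
  fixes X X' :: "'b \<Rightarrow> 'a::{real_inner, polish_space}"
  assumes M: "prob_space M" and X: "sq_integrable M X" "sq_integrable M X'" and \<nu>: "\<nu> \<in> P2"
    and bound: "\<And>(G :: ('b \<times> 'a \<times> 'a) measure) Y. prob_space G \<Longrightarrow> fst \<in> measurable G M \<Longrightarrow>
      distr G M fst = M \<Longrightarrow> sq_integrable G Y \<Longrightarrow> distr G borel Y = \<nu> \<Longrightarrow>
      \<bar>\<integral>w. (X (fst w) - X' (fst w)) \<bullet> Y w \<partial>G\<bar> \<le> e"
  shows "corr (distr M borel X') \<nu> \<le> corr (distr M borel X) \<nu> + 2 * e"
proof (rule field_le_epsilon)
  fix s :: real assume s: "0 < s"
  obtain G :: "('b \<times> 'a \<times> 'a) measure" where G: "prob_space G" "fst \<in> measurable G M"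
    "distr G M fst = M" and Y: "sq_integrable G (\<lambda>w. snd (snd w))" "distr G borel (\<lambda>w. snd (snd w)) = \<nu>"
    and opt: "(\<integral>w. (norm (X (fst w) - snd (snd w)))\<^sup>2 \<partial>G) \<le> (W2 (distr M borel X) \<nu>)\<^sup>2 + s"
    by (rule extend_near_optimal[OF M X(1) \<nu> s])
  let ?Y = "\<lambda>w::'b \<times> 'a \<times> 'a. snd (snd w)"
  have XG: "sq_integrable G (\<lambda>w. X (fst w))" "sq_integrable G (\<lambda>w. X' (fst w))"
    by (rule sq_integrable_marginal[OF G(2,3) refl X(1)], rule sq_integrable_marginal[OF G(2,3) refl X(2)])
  have law: "distr G borel (\<lambda>w. X (fst w)) = distr M borel X" "distr G borel (\<lambda>w. X' (fst w)) = distr M borel X'"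
    using distr_distr[OF sq_integrable_measurable[OF X(1)] G(2)]
      distr_distr[OF sq_integrable_measurable[OF X(2)] G(2)] by (simp_all add: G(3) comp_def)
  have eq: "(\<integral>w. (norm (X (fst w) - ?Y w))\<^sup>2 \<partial>G)
      = msq (distr M borel X) + msq \<nu> - 2 * (\<integral>w. X (fst w) \<bullet> ?Y w \<partial>G)"
    "(\<integral>w. (norm (X' (fst w) - ?Y w))\<^sup>2 \<partial>G)
      = msq (distr M borel X') + msq \<nu> - 2 * (\<integral>w. X' (fst w) \<bullet> ?Y w \<partial>G)"
    using integral_norm_diff_sq[OF XG(1) Y(1)] integral_norm_diff_sq[OF XG(2) Y(1)]
      integral_norm_sq_distr[OF XG(1)] integral_norm_sq_distr[OF XG(2)] integral_norm_sq_distr[OF Y(1)] law Y(2)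
    by simp_all
  have "(W2 (distr M borel X') \<nu>)\<^sup>2 \<le> (\<integral>w. (norm (X' (fst w) - ?Y w))\<^sup>2 \<partial>G)"
    using W2_sq_le[OF G(1) XG(2) Y(1)] law Y(2) by simp
  moreover have "(\<integral>w. (X (fst w) - X' (fst w)) \<bullet> ?Y w \<partial>G)
      = (\<integral>w. X (fst w) \<bullet> ?Y w \<partial>G) - (\<integral>w. X' (fst w) \<bullet> ?Y w \<partial>G)"
    using sq_integrable_inner[OF XG(1) Y(1)] sq_integrable_inner[OF XG(2) Y(1)]
    by (simp add: inner_diff_left)
  ultimately show "corr (distr M borel X') \<nu> \<le> corr (distr M borel X) \<nu> + 2 * e + s"
    using bound[OF G Y] opt eq unfolding corr_def by linarith
qed

text \<open>The comparison is used in both directions. In one of them the partner is near-optimal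
  for \<open>Z n\<close> and so changes with n, which is why the preceding estimate has to be
  uniform.\<close>

lemma corr_tendsto:
  fixes Z :: "nat \<Rightarrow> 'b \<Rightarrow> 'a::{real_inner, polish_space}"
  assumes d: "dense_seq d" and M: "prob_space M" and Z: "\<And>n. sq_integrable M (Z n)"
    and Z': "sq_integrable M Z'" and R: "\<And>n. (\<integral>w. (norm (Z n w))\<^sup>2 \<partial>M) \<le> R"
    and lim: "AE w in M. \<forall>k. (\<lambda>n. Z n w \<bullet> d k) \<longlonglongrightarrow> Z' w \<bullet> d k"
    and \<nu>: "\<nu> \<in> P2"
  shows "(\<lambda>n. corr (distr M borel (Z n)) \<nu>) \<longlonglongrightarrow> corr (distr M borel Z') \<nu>"
proof (rule tendstoI)
  fix e :: real assume e: "0 < e"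
  have "\<forall>\<^sub>F n in sequentially. \<forall>(G :: ('b \<times> 'a \<times> 'a) measure) Y. prob_space G \<longrightarrow> fst \<in> measurable G M \<longrightarrow>
    distr G M fst = M \<longrightarrow> sq_integrable G Y \<longrightarrow> distr G borel Y = \<nu> \<longrightarrow>
    \<bar>\<integral>w. (Z n (fst w) - Z' (fst w)) \<bullet> Y w \<partial>G\<bar> \<le> e / 4"
    using e by (intro weak_convergence_uniform[OF d M Z Z' R lim \<nu>]) auto
  then show "\<forall>\<^sub>F n in sequentially. dist (corr (distr M borel (Z n)) \<nu>) (corr (distr M borel Z') \<nu>) < e"
  proof eventually_elim
    case (elim n)
    have "corr (distr M borel Z') \<nu> \<le> corr (distr M borel (Z n)) \<nu> + 2 * (e / 4)"
      using elim by (intro corr_le_of_inner_bound[OF M Z Z' \<nu>]) blast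
    moreover have "corr (distr M borel (Z n)) \<nu> \<le> corr (distr M borel Z') \<nu> + 2 * (e / 4)"
    proof (rule corr_le_of_inner_bound[OF M Z' Z \<nu>])
      fix G :: "('b \<times> 'a \<times> 'a) measure" and Y
      assume G: "prob_space G" "fst \<in> measurable G M" "distr G M fst = M" "sq_integrable G Y" "distr G borel Y = \<nu>"
      have "(Z' (fst w) - Z n (fst w)) \<bullet> Y w = - ((Z n (fst w) - Z' (fst w)) \<bullet> Y w)" for w
        by (simp add: inner_diff_left)
      then show "\<bar>\<integral>w. (Z' (fst w) - Z n (fst w)) \<bullet> Y w \<partial>G\<bar> \<le> e / 4"
        using elim G by simp
    qed
    ultimately show ?case using e by (simp add: dist_real_def abs_le_iff)
  qed
qed

section \<open>The energy and its minimizers\<close>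

lemma parallelogram_midpoint:
  fixes x y z :: "'a::real_inner"
  shows "(norm ((1 / 2) *\<^sub>R (x + y) - z))\<^sup>2
    = (norm (x - z))\<^sup>2 / 2 + (norm (y - z))\<^sup>2 / 2 - (norm (x - y))\<^sup>2 / 4"
  by (simp add: power2_norm_eq_inner inner_add inner_diff inner_commute field_simps)

lemma integral_midpoint:
  assumes "sq_integrable M X" "sq_integrable M Y" "sq_integrable M Z"
  shows "(\<integral>w. (norm ((1 / 2) *\<^sub>R (X w + Y w) - Z w))\<^sup>2 \<partial>M)
    = (\<integral>w. (norm (X w - Z w))\<^sup>2 \<partial>M) / 2 + (\<integral>w. (norm (Y w - Z w))\<^sup>2 \<partial>M) / 2
      - (\<integral>w. (norm (X w - Y w))\<^sup>2 \<partial>M) / 4"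
  unfolding parallelogram_midpoint
  using assms by (simp add: sq_integrable_diff[THEN sq_integrable_integrable])

text \<open>Attach a near-optimal partner to the midpoint; it is also a competitor for both
  endpoints. The lost term depends on the pair \<open>X\<close>, \<open>Y\<close> but not on \<nu>,
  so the inequality can be integrated against the negative part.\<close>

lemma W2_midpoint_ge:
  fixes X Y :: "'b \<Rightarrow> 'a::{real_inner, polish_space}"
  assumes M: "prob_space M" and X: "sq_integrable M X" and Y: "sq_integrable M Y" and \<nu>: "\<nu> \<in> P2"
  shows "(W2 (distr M borel X) \<nu>)\<^sup>2 / 2 + (W2 (distr M borel Y) \<nu>)\<^sup>2 / 2 - (\<integral>w. (norm (X w - Y w))\<^sup>2 \<partial>M) / 4
    \<le> (W2 (distr M borel (\<lambda>w. (1 / 2) *\<^sub>R (X w + Y w))) \<nu>)\<^sup>2"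
proof (rule field_le_epsilon)
  fix e :: real assume e: "0 < e"
  let ?m = "\<lambda>w. (1 / 2) *\<^sub>R (X w + Y w)"
  have m: "sq_integrable M ?m" by (intro sq_integrable_scaleR sq_integrable_add X Y)
  obtain G :: "('b \<times> 'a \<times> 'a) measure" where G: "prob_space G" "fst \<in> measurable G M"
    "distr G M fst = M" and N: "sq_integrable G (\<lambda>w. snd (snd w))" "distr G borel (\<lambda>w. snd (snd w)) = \<nu>"
    and opt: "(\<integral>w. (norm (?m (fst w) - snd (snd w)))\<^sup>2 \<partial>G) \<le> (W2 (distr M borel ?m) \<nu>)\<^sup>2 + e"
    by (rule extend_near_optimal[OF M m \<nu> e])
  have XG: "sq_integrable G (\<lambda>w. X (fst w))" and YG: "sq_integrable G (\<lambda>w. Y (fst w))"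
    by (rule sq_integrable_marginal[OF G(2,3) refl X], rule sq_integrable_marginal[OF G(2,3) refl Y])
  have law: "distr G borel (\<lambda>w. X (fst w)) = distr M borel X" "distr G borel (\<lambda>w. Y (fst w)) = distr M borel Y"
    using distr_distr[OF sq_integrable_measurable[OF X] G(2)]
      distr_distr[OF sq_integrable_measurable[OF Y] G(2)] by (simp_all add: G(3) comp_def)
  have "(\<integral>w. (norm (X (fst w) - Y (fst w)))\<^sup>2 \<partial>G) = (\<integral>w. (norm (X w - Y w))\<^sup>2 \<partial>distr G M fst)"
    using sq_integrable_measurable[OF sq_integrable_diff[OF X Y]] G(2) by (subst integral_distr) auto
  then have "(\<integral>w. (norm (X (fst w) - Y (fst w)))\<^sup>2 \<partial>G) = (\<integral>w. (norm (X w - Y w))\<^sup>2 \<partial>M)"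
    by (simp add: G(3))
  then show "(W2 (distr M borel X) \<nu>)\<^sup>2 / 2 + (W2 (distr M borel Y) \<nu>)\<^sup>2 / 2
      - (\<integral>w. (norm (X w - Y w))\<^sup>2 \<partial>M) / 4 \<le> (W2 (distr M borel ?m) \<nu>)\<^sup>2 + e"
    using opt W2_sq_le[OF G(1) XG N(1)] W2_sq_le[OF G(1) YG N(1)] integral_midpoint[OF XG YG N(1)]
    unfolding law N(2) by linarith
qed

text \<open>The opposite bound to \<open>W2_midpoint_ge\<close>, up to \<open>e\<close>, for one
  fixed \<nu>: both endpoints are coupled near-optimally with the same \<nu>-distributed variable,
  so the midpoint identity uses their almost optimal costs.\<close>

lemma W2_midpoint_glued:
  fixes \<mu>\<^sub>0 \<mu>\<^sub>1 \<nu> :: "'a::{real_inner, polish_space} measure"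
  assumes P2: "\<mu>\<^sub>0 \<in> P2" "\<mu>\<^sub>1 \<in> P2" "\<nu> \<in> P2" and e: "0 < e"
  obtains M :: "(('a \<times> 'a) \<times> 'a \<times> 'a) measure" and X Y where "prob_space M"
    "sq_integrable M X" "sq_integrable M Y" "distr M borel X = \<mu>\<^sub>0" "distr M borel Y = \<mu>\<^sub>1"
    "(W2 (distr M borel (\<lambda>w. (1 / 2) *\<^sub>R (X w + Y w))) \<nu>)\<^sup>2
      \<le> (W2 \<mu>\<^sub>0 \<nu>)\<^sup>2 / 2 + (W2 \<mu>\<^sub>1 \<nu>)\<^sup>2 / 2 - (\<integral>w. (norm (X w - Y w))\<^sup>2 \<partial>M) / 4 + e"
proof -
  obtain \<gamma> where g: "\<gamma> \<in> couplings \<mu>\<^sub>0 \<nu>" "(\<integral>z. (norm (fst z - snd z))\<^sup>2 \<partial>\<gamma>) < (W2 \<mu>\<^sub>0 \<nu>)\<^sup>2 + e"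
    using near_optimal_coupling[OF P2(1,3) e] by blast
  note \<gamma> = couplingsD[OF g(1) P2(1,3)]
  obtain G :: "(('a \<times> 'a) \<times> 'a \<times> 'a) measure" where G: "prob_space G" "fst \<in> measurable G \<gamma>"
    "distr G \<gamma> fst = \<gamma>" and Y: "sq_integrable G (\<lambda>w. snd (snd w))" "distr G borel (\<lambda>w. snd (snd w)) = \<mu>\<^sub>1"
    and opt: "(\<integral>w. (norm (snd (fst w) - snd (snd w)))\<^sup>2 \<partial>G) \<le> (W2 \<nu> \<mu>\<^sub>1)\<^sup>2 + e"
    by (rule extend_near_optimal[OF \<gamma>(1,6) P2(2) e, unfolded \<gamma>(4)])
  have X: "sq_integrable G (\<lambda>w. fst (fst w))" and N: "sq_integrable G (\<lambda>w. snd (fst w))"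
    by (rule sq_integrable_marginal[OF G(2,3) refl \<gamma>(5)], rule sq_integrable_marginal[OF G(2,3) refl \<gamma>(6)])
  have law: "distr G borel (\<lambda>w. fst (fst w)) = \<mu>\<^sub>0" "distr G borel (\<lambda>w. snd (fst w)) = \<nu>"
    using distr_distr[OF sq_integrable_measurable[OF \<gamma>(5)] G(2)]
      distr_distr[OF sq_integrable_measurable[OF \<gamma>(6)] G(2)] \<gamma>(3,4) by (simp_all add: G(3) comp_def)
  have "(\<integral>w. (norm (fst (fst w) - snd (fst w)))\<^sup>2 \<partial>G) = (\<integral>z. (norm (fst z - snd z))\<^sup>2 \<partial>distr G \<gamma> fst)"
    using sq_integrable_measurable[OF sq_integrable_diff[OF \<gamma>(5,6)]] G(2) by (subst integral_distr) auto
  then have "(\<integral>w. (norm (fst (fst w) - snd (fst w)))\<^sup>2 \<partial>G) \<le> (W2 \<mu>\<^sub>0 \<nu>)\<^sup>2 + e"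
    using g(2) by (simp add: G(3))
  moreover have "(\<integral>w. (norm (snd (snd w) - snd (fst w)))\<^sup>2 \<partial>G) \<le> (W2 \<mu>\<^sub>1 \<nu>)\<^sup>2 + e"
    using opt by (simp add: W2_commute[of \<mu>\<^sub>1 \<nu>] norm_minus_commute[of "snd (snd _)"])
  moreover have "sq_integrable G (\<lambda>w. (1 / 2) *\<^sub>R (fst (fst w) + snd (snd w)))"
    by (intro sq_integrable_scaleR sq_integrable_add X Y(1))
  from W2_sq_le[OF G(1) this N]
  have "(W2 (distr G borel (\<lambda>w. (1 / 2) *\<^sub>R (fst (fst w) + snd (snd w)))) \<nu>)\<^sup>2
      \<le> (\<integral>w. (norm ((1 / 2) *\<^sub>R (fst (fst w) + snd (snd w)) - snd (fst w)))\<^sup>2 \<partial>G)"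
    unfolding law(2) .
  ultimately have "(W2 (distr G borel (\<lambda>w. (1 / 2) *\<^sub>R (fst (fst w) + snd (snd w)))) \<nu>)\<^sup>2
      \<le> (W2 \<mu>\<^sub>0 \<nu>)\<^sup>2 / 2 + (W2 \<mu>\<^sub>1 \<nu>)\<^sup>2 / 2 - (\<integral>w. (norm (fst (fst w) - snd (snd w)))\<^sup>2 \<partial>G) / 4 + e"
    using integral_midpoint[OF X Y(1) N] by linarith
  then show thesis by (rule that[OF G(1) X Y(1) law(1) Y(2)])
qed

section \<open>The energy: coercivity, existence and uniqueness of minimizers\<close>

locale signed_P2 =
  fixes \<sigma> :: "'a::{real_inner, polish_space} measure set \<Rightarrow> real"
  assumes signed: "signed_measure borel_P2 \<sigma>"
    and total: "\<sigma> P2 = 1"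
    and moment: "(\<integral>\<^sup>+\<nu>. m2sq \<nu> \<partial>total_variation borel_P2 \<sigma>) < \<infinity>"
begin

abbreviation pos :: "'a measure measure" where "pos \<equiv> pos_part borel_P2 \<sigma>"
abbreviation neg :: "'a measure measure" where "neg \<equiv> neg_part borel_P2 \<sigma>"

sublocale pos: finite_measure pos by (rule finite_measure_pos_part[OF signed])
sublocale neg: finite_measure neg by (rule finite_measure_neg_part[OF signed])

lemma mass_diff: "measure pos P2 - measure neg P2 = 1"
  using measure_pos_part_minus_neg_part[OF signed] total by simp

lemma space_parts [simp]: "space pos = P2" "space neg = P2"
  by simp_all

lemma measurable_parts [measurable]:
  "msq \<in> borel_measurable pos" "msq \<in> borel_measurable neg"
  "\<mu> \<in> P2 \<Longrightarrow> W2 \<mu> \<in> borel_measurable pos" "\<mu> \<in> P2 \<Longrightarrow> W2 \<mu> \<in> borel_measurable neg"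
  using measurable_msq measurable_W2 by (simp_all cong: measurable_cong_sets)

lemma integrable_msq: "integrable pos msq" "integrable neg msq"
proof -
  have *: "(\<integral>\<^sup>+\<nu>. ennreal (msq \<nu>) \<partial>N) = (\<integral>\<^sup>+\<nu>. m2sq \<nu> \<partial>N)" if "space N = P2" for N :: "'a measure measure"
    using that by (intro nn_integral_cong) (simp add: m2sq_eq_msq)
  show "integrable pos msq" "integrable neg msq"
    using le_less_trans[OF nn_integral_pos_part_le moment] le_less_trans[OF nn_integral_neg_part_le moment]
    by (auto simp: integrable_iff_bounded *)
qed

lemma measurable_corr [measurable]:
  assumes "\<mu> \<in> P2"
  shows "corr \<mu> \<in> borel_measurable pos" "corr \<mu> \<in> borel_measurable neg"
  using assms unfolding corr_def by measurable

lemma integrable_corr: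
  assumes \<mu>: "\<mu> \<in> P2"
  shows "integrable pos (corr \<mu>)" "integrable neg (corr \<mu>)"
proof -
  have le: "\<bar>corr \<mu> \<nu>\<bar> \<le> msq \<mu> + msq \<nu>" if "\<nu> \<in> P2" for \<nu>
    using abs_corr_le[OF \<mu> that, of 1] by simp
  show "integrable pos (corr \<mu>)"
    by (rule Bochner_Integration.integrable_bound[of _ "\<lambda>\<nu>. msq \<mu> + msq \<nu>"])
      (use \<mu> integrable_msq in \<open>auto intro!: AE_I2 le\<close>)
  show "integrable neg (corr \<mu>)"
    by (rule Bochner_Integration.integrable_bound[of _ "\<lambda>\<nu>. msq \<mu> + msq \<nu>"])
      (use \<mu> integrable_msq in \<open>auto intro!: AE_I2 le\<close>)
qed

lemma integrable_W2_sq: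
  assumes \<mu>: "\<mu> \<in> P2"
  shows "integrable pos (\<lambda>\<nu>. (W2 \<mu> \<nu>)\<^sup>2)" "integrable neg (\<lambda>\<nu>. (W2 \<mu> \<nu>)\<^sup>2)"
proof -
  have "(\<lambda>\<nu>. (W2 \<mu> \<nu>)\<^sup>2) = (\<lambda>\<nu>. corr \<mu> \<nu> + (msq \<mu> + msq \<nu>))"
    by (simp add: corr_def)
  then show "integrable pos (\<lambda>\<nu>. (W2 \<mu> \<nu>)\<^sup>2)" "integrable neg (\<lambda>\<nu>. (W2 \<mu> \<nu>)\<^sup>2)"
    using integrable_corr[OF \<mu>] integrable_msq by simp_all
qed

definition moment_offset :: real where
  "moment_offset = (\<integral>\<nu>. msq \<nu> \<partial>pos) - (\<integral>\<nu>. msq \<nu> \<partial>neg)"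

definition corr_energy :: "'a measure \<Rightarrow> real" where
  "corr_energy \<mu> = (\<integral>\<nu>. corr \<mu> \<nu> \<partial>pos) - (\<integral>\<nu>. corr \<mu> \<nu> \<partial>neg)"

lemma wass_energy_eq:
  assumes \<mu>: "\<mu> \<in> P2"
  shows "wass_energy \<sigma> \<mu> = msq \<mu> + moment_offset + corr_energy \<mu>"
proof -
  have eq: "(W2 \<mu> \<nu>)\<^sup>2 = msq \<mu> + msq \<nu> + corr \<mu> \<nu>" for \<nu> by (simp add: corr_def)
  have "(\<integral>\<nu>. (W2 \<mu> \<nu>)\<^sup>2 \<partial>pos) = msq \<mu> * measure pos P2 + (\<integral>\<nu>. msq \<nu> \<partial>pos) + (\<integral>\<nu>. corr \<mu> \<nu> \<partial>pos)"
    "(\<integral>\<nu>. (W2 \<mu> \<nu>)\<^sup>2 \<partial>neg) = msq \<mu> * measure neg P2 + (\<integral>\<nu>. msq \<nu> \<partial>neg) + (\<integral>\<nu>. corr \<mu> \<nu> \<partial>neg)"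
    unfolding eq using integrable_corr[OF \<mu>] integrable_msq by simp_all
  moreover have "msq \<mu> * measure pos P2 - msq \<mu> * measure neg P2 = msq \<mu>"
    using mass_diff by (simp add: right_diff_distrib[symmetric])
  ultimately show ?thesis
    by (simp add: wass_energy_def signed_integral_def moment_offset_def corr_energy_def)
qed

lemma energy_coercive: "\<exists>c. \<forall>\<mu>\<in>P2. msq \<mu> / 2 - c \<le> wass_energy \<sigma> \<mu>"
proof -
  define P where "P = measure pos P2 + measure neg P2"
  define S where "S = (\<integral>\<nu>. msq \<nu> \<partial>pos) + (\<integral>\<nu>. msq \<nu> \<partial>neg)"
  have P: "0 < P" using mass_diff measure_nonneg[of neg P2] unfolding P_def by linarith
  \<comment> \<open>With this weight the correlations against both parts together consume at most
    half of \<open>msq \<mu>\<close>, leaving the other half for coercivity.\<close>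
  define t where "t = 1 / (2 * P)"
  have t: "0 < t" "t * P = 1 / 2" using P by (auto simp: t_def)
  have "- (msq \<mu> / 2 + S / t) \<le> corr_energy \<mu>" if \<mu>: "\<mu> \<in> P2" for \<mu>
  proof -
    have bound: "\<bar>\<integral>\<nu>. corr \<mu> \<nu> \<partial>N\<bar> \<le> t * msq \<mu> * measure N P2 + (\<integral>\<nu>. msq \<nu> \<partial>N) / t"
      if N: "finite_measure N" "space N = P2" "integrable N (corr \<mu>)" "integrable N msq" for N
    proof -
      interpret finite_measure N by fact
      have "\<bar>\<integral>\<nu>. corr \<mu> \<nu> \<partial>N\<bar> \<le> (\<integral>\<nu>. \<bar>corr \<mu> \<nu>\<bar> \<partial>N)" by (rule integral_abs_bound)
      also have "\<dots> \<le> (\<integral>\<nu>. t * msq \<mu> + msq \<nu> / t \<partial>N)"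
        using N abs_corr_le[OF \<mu> _ t(1)] by (intro integral_mono) auto
      also have "\<dots> = t * msq \<mu> * measure N P2 + (\<integral>\<nu>. msq \<nu> \<partial>N) / t"
        using N by simp
      finally show ?thesis .
    qed
    have "t * msq \<mu> * measure pos P2 + t * msq \<mu> * measure neg P2 = (t * P) * msq \<mu>"
      by (simp add: P_def algebra_simps)
    also have "\<dots> = msq \<mu> / 2" by (simp add: t(2))
    finally have "t * msq \<mu> * measure pos P2 + t * msq \<mu> * measure neg P2 = msq \<mu> / 2" .
    moreover have "(\<integral>\<nu>. msq \<nu> \<partial>pos) / t + (\<integral>\<nu>. msq \<nu> \<partial>neg) / t = S / t"
      by (simp add: S_def add_divide_distrib)
    ultimately show ?thesis
      using bound[OF pos.finite_measure_axioms space_parts(1) integrable_corr(1)[OF \<mu>] integrable_msq(1)]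
        bound[OF neg.finite_measure_axioms space_parts(2) integrable_corr(2)[OF \<mu>] integrable_msq(2)]
      unfolding corr_energy_def by linarith
  qed
  then have "msq \<mu> / 2 - (S / t - moment_offset) \<le> wass_energy \<sigma> \<mu>" if "\<mu> \<in> P2" for \<mu>
    using that wass_energy_eq[OF that] by fastforce
  then show ?thesis by blast
qed

text \<open>Dominated convergence on each part separately, with majorant
  \<open>R + msq \<nu>\<close>. As this is a limit and not a semicontinuity statement, subtracting
  the negative part is harmless.\<close>

lemma corr_energy_tendsto:
  assumes \<mu>n: "\<And>n. \<mu>n n \<in> P2" and R: "\<And>n. msq (\<mu>n n) \<le> R" and \<mu>: "\<mu> \<in> P2"
    and lim: "\<And>\<nu>. \<nu> \<in> P2 \<Longrightarrow> (\<lambda>n. corr (\<mu>n n) \<nu>) \<longlonglongrightarrow> corr \<mu> \<nu>"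
  shows "(\<lambda>n. corr_energy (\<mu>n n)) \<longlonglongrightarrow> corr_energy \<mu>"
proof -
  have le: "\<bar>corr (\<mu>n n) \<nu>\<bar> \<le> R + msq \<nu>" if "\<nu> \<in> P2" for n \<nu>
    using abs_corr_le[OF \<mu>n[of n] that, of 1] R[of n] by simp
  have "(\<lambda>n. \<integral>\<nu>. corr (\<mu>n n) \<nu> \<partial>pos) \<longlonglongrightarrow> (\<integral>\<nu>. corr \<mu> \<nu> \<partial>pos)"
    by (rule integral_dominated_convergence[where w = "\<lambda>\<nu>. R + msq \<nu>"])
      (use \<mu>n \<mu> integrable_msq in \<open>auto intro!: AE_I2 lim le\<close>)
  moreover have "(\<lambda>n. \<integral>\<nu>. corr (\<mu>n n) \<nu> \<partial>neg) \<longlonglongrightarrow> (\<integral>\<nu>. corr \<mu> \<nu> \<partial>neg)"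
    by (rule integral_dominated_convergence[where w = "\<lambda>\<nu>. R + msq \<nu>"])
      (use \<mu>n \<mu> integrable_msq in \<open>auto intro!: AE_I2 lim le\<close>)
  ultimately show ?thesis unfolding corr_energy_def by (rule tendsto_diff)
qed

lemma ex_minimizer: "\<exists>\<mu>. is_arg_min (wass_energy \<sigma>) (\<lambda>\<mu>. \<mu> \<in> P2) \<mu>"
proof -
  let ?E = "wass_energy \<sigma>"
  obtain c where c: "\<And>\<mu>. \<mu> \<in> P2 \<Longrightarrow> msq \<mu> / 2 - c \<le> ?E \<mu>" using energy_coercive by blast
  define I where "I = Inf (?E ` P2)"
  have bdd: "bdd_below (?E ` P2)"
  proof (rule bdd_belowI2)
    show "- c \<le> ?E \<mu>" if "\<mu> \<in> P2" for \<mu> using c[OF that] msq_nonneg[of \<mu>] by linarith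
  qed
  have I_le: "I \<le> ?E \<mu>" if "\<mu> \<in> P2" for \<mu>
    unfolding I_def by (rule cINF_lower[OF bdd that])
  have ne: "?E ` P2 \<noteq> {}" using dirac_in_P2 by auto
  have "\<exists>\<mu>\<in>P2. ?E \<mu> < I + 1 / real (Suc n)" for n
    using cInf_lessD[OF ne, of "I + 1 / real (Suc n)"] by (auto simp: I_def)
  then obtain \<mu> where \<mu>: "\<And>n. \<mu> n \<in> P2" "\<And>n. ?E (\<mu> n) < I + 1 / real (Suc n)" by metis
  \<comment> \<open>Coercivity bounds the moments of all measures of energy below
    \<open>I + 1\<close>.\<close>
  define R where "R = 2 * (I + 1 + c)"
  have R: "msq (\<mu> n) \<le> R" for n
  proof -
    have "I + 1 / real (Suc n) \<le> I + 1" by simp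
    with \<mu>(2)[of n] have "?E (\<mu> n) < I + 1" by (rule less_le_trans)
    then show ?thesis using c[OF \<mu>(1)[of n]] unfolding R_def by argo
  qed
  obtain d :: "nat \<Rightarrow> 'a" where d: "dense_seq d" using ex_dense_seq by blast
  obtain r and \<Omega> :: "real measure" and Z Z' where
    r: "strict_mono (r :: nat \<Rightarrow> nat)" and \<Omega>: "prob_space \<Omega>" and Z: "\<And>n. sq_integrable \<Omega> (Z n)"
    and law: "\<And>n. distr \<Omega> borel (Z n) = \<mu> (r n)" and Z'm: "Z' \<in> borel_measurable \<Omega>"
    and weak: "AE w in \<Omega>. \<forall>k. (\<lambda>n. Z n w \<bullet> d k) \<longlonglongrightarrow> Z' w \<bullet> d k"
    and Fatou: "(\<integral>\<^sup>+w. ennreal ((norm (Z' w))\<^sup>2) \<partial>\<Omega>) \<le> liminf (\<lambda>n. ennreal (msq (\<mu> (r n))))"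
    by (rule weak_subsequence[of d \<mu> R, OF d \<mu>(1) R]) blast
  have "liminf (\<lambda>n. ennreal (msq (\<mu> (r n)))) \<le> liminf (\<lambda>n. ennreal R)"
    by (intro Liminf_mono always_eventually allI ennreal_leI R)
  also have "\<dots> < \<infinity>" by (simp add: Liminf_const)
  finally have "(\<integral>\<^sup>+w. ennreal ((norm (Z' w))\<^sup>2) \<partial>\<Omega>) < \<infinity>" using Fatou by (rule le_less_trans[rotated])
  then have Z': "sq_integrable \<Omega> Z'"
    using Z'm by (auto simp: sq_integrable_def integrable_iff_bounded)
  define \<mu>' where "\<mu>' = distr \<Omega> borel Z'"
  have \<mu>': "\<mu>' \<in> P2" unfolding \<mu>'_def by (rule distr_in_P2[OF \<Omega> Z'])
  have bd: "(\<integral>w. (norm (Z n w))\<^sup>2 \<partial>\<Omega>) \<le> R" for n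
    using integral_norm_sq_distr[OF Z] law R by simp
  have "(\<lambda>n. corr (\<mu> (r n)) \<nu>) \<longlonglongrightarrow> corr \<mu>' \<nu>" if "\<nu> \<in> P2" for \<nu>
    using corr_tendsto[OF d \<Omega> Z Z' bd weak that] unfolding law \<mu>'_def .
  then have J: "(\<lambda>n. corr_energy (\<mu> (r n))) \<longlonglongrightarrow> corr_energy \<mu>'"
    using \<mu>(1) R \<mu>' by (intro corr_energy_tendsto) auto
  have "(\<lambda>n. ?E (\<mu> n)) \<longlonglongrightarrow> I"
  proof (rule tendsto_sandwich[OF _ _ tendsto_const])
    show "(\<lambda>n. I + 1 / real (Suc n)) \<longlonglongrightarrow> I"
      using tendsto_add[OF tendsto_const LIMSEQ_Suc[OF lim_1_over_n], of I] by simp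
    show "\<forall>\<^sub>F n in sequentially. I \<le> ?E (\<mu> n)" using I_le \<mu>(1) by simp
    show "\<forall>\<^sub>F n in sequentially. ?E (\<mu> n) \<le> I + 1 / real (Suc n)"
      by (intro always_eventually allI less_imp_le \<mu>(2))
  qed
  then have "(\<lambda>n. ?E (\<mu> (r n))) \<longlonglongrightarrow> I"
    using LIMSEQ_subseq_LIMSEQ[OF _ r, of "\<lambda>n. ?E (\<mu> n)"] by (simp add: comp_def)
  \<comment> \<open>Energies and correlation terms converge, hence so do the moments; the liminf in
    \<open>Fatou\<close> becomes a limit that can be computed.\<close>
  then have "(\<lambda>n. ?E (\<mu> (r n)) - moment_offset - corr_energy (\<mu> (r n))) \<longlonglongrightarrow> I - moment_offset - corr_energy \<mu>'"
    by (intro tendsto_diff tendsto_const J)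
  then have m: "(\<lambda>n. msq (\<mu> (r n))) \<longlonglongrightarrow> I - moment_offset - corr_energy \<mu>'"
    by (simp add: wass_energy_eq[OF \<mu>(1)])
  \<comment> \<open>Since \<open>ennreal\<close> truncates negative numbers to 0, nonnegativity is
    needed to return to a real inequality below.\<close>
  then have m0: "0 \<le> I - moment_offset - corr_energy \<mu>'"
    by (rule LIMSEQ_le_const) simp
  have "ennreal (msq \<mu>') = (\<integral>\<^sup>+w. ennreal ((norm (Z' w))\<^sup>2) \<partial>\<Omega>)"
    using integral_norm_sq_distr[OF Z'] sq_integrable_integrable[OF Z']
    by (simp add: nn_integral_eq_integral \<mu>'_def)
  also have "\<dots> \<le> ennreal (I - moment_offset - corr_energy \<mu>')"
    using Fatou lim_imp_Liminf[OF _ tendsto_ennrealI[OF m]] by simp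
  finally have "msq \<mu>' \<le> I - moment_offset - corr_energy \<mu>'" using m0 by simp
  then have "?E \<mu>' \<le> I" using wass_energy_eq[OF \<mu>'] by simp
  then have "is_arg_min ?E (\<lambda>\<mu>. \<mu> \<in> P2) \<mu>'"
    using \<mu>' I_le by (fastforce simp: is_arg_min_def)
  then show ?thesis ..
qed

lemma minimizer_unique:
  assumes \<nu>\<^sub>0: "\<nu>\<^sub>0 \<in> P2" and atom: "emeasure pos (P2 - {\<nu>\<^sub>0}) = 0"
    and min: "is_arg_min (wass_energy \<sigma>) (\<lambda>\<mu>. \<mu> \<in> P2) \<mu>\<^sub>0" "is_arg_min (wass_energy \<sigma>) (\<lambda>\<mu>. \<mu> \<in> P2) \<mu>\<^sub>1"
  shows "\<mu>\<^sub>0 = \<mu>\<^sub>1"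
proof -
  let ?E = "wass_energy \<sigma>"
  have \<mu>: "\<mu>\<^sub>0 \<in> P2" "\<mu>\<^sub>1 \<in> P2" and E: "?E \<mu>\<^sub>1 = ?E \<mu>\<^sub>0" "\<And>\<mu>. \<mu> \<in> P2 \<Longrightarrow> ?E \<mu>\<^sub>0 \<le> ?E \<mu>"
    using min unfolding is_arg_min_def by (auto simp: not_less intro: antisym)
  define a where "a = measure pos P2"
  define b where "b = measure neg P2"
  have ab: "a = 1 + b" "0 \<le> b" using mass_diff by (auto simp: a_def b_def)
  have "AE \<nu> in pos. \<nu> \<notin> P2 - {\<nu>\<^sub>0}"
    using atom Diff_singleton_in_sets_borel_P2[of \<nu>\<^sub>0] by (intro AE_not_in) (simp add: null_sets_def)
  then have AE: "AE \<nu> in pos. \<nu> = \<nu>\<^sub>0" using AE_space by eventually_elim auto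
  have int_pos: "(\<integral>\<nu>. (W2 \<mu> \<nu>)\<^sup>2 \<partial>pos) = a * (W2 \<mu> \<nu>\<^sub>0)\<^sup>2" if "\<mu> \<in> P2" for \<mu>
  proof -
    have "(\<integral>\<nu>. (W2 \<mu> \<nu>)\<^sup>2 \<partial>pos) = (\<integral>\<nu>. (W2 \<mu> \<nu>\<^sub>0)\<^sup>2 \<partial>pos)"
      using that by (intro integral_cong_AE eventually_mono[OF AE]) auto
    then show ?thesis by (simp add: a_def)
  qed
  have E_eq: "?E \<mu> = a * (W2 \<mu> \<nu>\<^sub>0)\<^sup>2 - (\<integral>\<nu>. (W2 \<mu> \<nu>)\<^sup>2 \<partial>neg)" if "\<mu> \<in> P2" for \<mu>
    using int_pos[OF that] by (simp add: wass_energy_def signed_integral_def)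
  have "(W2 \<mu>\<^sub>0 \<mu>\<^sub>1)\<^sup>2 \<le> s" if s: "0 < s" for s
  proof -
    \<comment> \<open>The gluing error is multiplied by the mass \<open>a\<close> of the atom and by
      4 when the inequality is solved for \<open>D\<close>; this choice turns it into
      \<open>s\<close>.\<close>
    define e where "e = s / (4 * a)"
    have "0 < a" using ab by simp
    then have e: "0 < e" "4 * (a * e) = s" using s by (auto simp: e_def)
    obtain M :: "(('a \<times> 'a) \<times> 'a \<times> 'a) measure" and X Y where M: "prob_space M"
      and X: "sq_integrable M X" and Y: "sq_integrable M Y"
      and law: "distr M borel X = \<mu>\<^sub>0" "distr M borel Y = \<mu>\<^sub>1"
      and glued: "(W2 (distr M borel (\<lambda>w. (1 / 2) *\<^sub>R (X w + Y w))) \<nu>\<^sub>0)\<^sup>2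
        \<le> (W2 \<mu>\<^sub>0 \<nu>\<^sub>0)\<^sup>2 / 2 + (W2 \<mu>\<^sub>1 \<nu>\<^sub>0)\<^sup>2 / 2 - (\<integral>w. (norm (X w - Y w))\<^sup>2 \<partial>M) / 4 + e"
      by (rule W2_midpoint_glued[OF \<mu> \<nu>\<^sub>0 e(1)]) blast
    define D where "D = (\<integral>w. (norm (X w - Y w))\<^sup>2 \<partial>M)"
    define m where "m = distr M borel (\<lambda>w. (1 / 2) *\<^sub>R (X w + Y w))"
    have m: "m \<in> P2" unfolding m_def by (intro distr_in_P2[OF M] sq_integrable_scaleR sq_integrable_add X Y)
    \<comment> \<open>The variables \<open>X\<close>, \<open>Y\<close> were coupled through the
      atom, yet the lower bound for their midpoint holds against every \<nu> with the same
      \<open>D\<close>.\<close>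
    have "(\<integral>\<nu>. (W2 \<mu>\<^sub>0 \<nu>)\<^sup>2 / 2 + (W2 \<mu>\<^sub>1 \<nu>)\<^sup>2 / 2 - D / 4 \<partial>neg) \<le> (\<integral>\<nu>. (W2 m \<nu>)\<^sup>2 \<partial>neg)"
    proof (rule integral_mono)
      show "(W2 \<mu>\<^sub>0 \<nu>)\<^sup>2 / 2 + (W2 \<mu>\<^sub>1 \<nu>)\<^sup>2 / 2 - D / 4 \<le> (W2 m \<nu>)\<^sup>2" if "\<nu> \<in> space neg" for \<nu>
        using W2_midpoint_ge[OF M X Y, of \<nu>] that unfolding law m_def D_def by simp
    qed (use integrable_W2_sq[OF \<mu>(1)] integrable_W2_sq[OF \<mu>(2)] integrable_W2_sq[OF m] in auto)
    also have "(\<integral>\<nu>. (W2 \<mu>\<^sub>0 \<nu>)\<^sup>2 / 2 + (W2 \<mu>\<^sub>1 \<nu>)\<^sup>2 / 2 - D / 4 \<partial>neg)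
        = (\<integral>\<nu>. (W2 \<mu>\<^sub>0 \<nu>)\<^sup>2 \<partial>neg) / 2 + (\<integral>\<nu>. (W2 \<mu>\<^sub>1 \<nu>)\<^sup>2 \<partial>neg) / 2 - b * (D / 4)"
      using integrable_W2_sq[OF \<mu>(1)] integrable_W2_sq[OF \<mu>(2)] by (simp add: b_def)
    finally have neg_le: "(\<integral>\<nu>. (W2 \<mu>\<^sub>0 \<nu>)\<^sup>2 \<partial>neg) / 2 + (\<integral>\<nu>. (W2 \<mu>\<^sub>1 \<nu>)\<^sup>2 \<partial>neg) / 2 - b * (D / 4)
        \<le> (\<integral>\<nu>. (W2 m \<nu>)\<^sup>2 \<partial>neg)" .
    have "a * (W2 m \<nu>\<^sub>0)\<^sup>2 \<le> a * ((W2 \<mu>\<^sub>0 \<nu>\<^sub>0)\<^sup>2 / 2 + (W2 \<mu>\<^sub>1 \<nu>\<^sub>0)\<^sup>2 / 2 - D / 4 + e)"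
      using glued ab by (intro mult_left_mono) (auto simp: m_def D_def)
    also have "\<dots> = a * (W2 \<mu>\<^sub>0 \<nu>\<^sub>0)\<^sup>2 / 2 + a * (W2 \<mu>\<^sub>1 \<nu>\<^sub>0)\<^sup>2 / 2 - a * (D / 4) + a * e"
      by (simp add: algebra_simps)
    finally have "?E m \<le> ?E \<mu>\<^sub>0 / 2 + ?E \<mu>\<^sub>1 / 2 - (a * (D / 4) - b * (D / 4)) + a * e"
      using neg_le unfolding E_eq[OF m] E_eq[OF \<mu>(1)] E_eq[OF \<mu>(2)] by argo
    moreover have "a * (D / 4) - b * (D / 4) = D / 4" using ab by (simp add: algebra_simps)
    \<comment> \<open>Both endpoints have the minimal energy and \<open>m\<close> has at least that,
      so the energies cancel and only \<open>D / 4\<close> against \<open>a * e\<close> is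
      left.\<close>
    ultimately have "D \<le> 4 * (a * e)" using E(1) E(2)[OF m] by argo
    moreover have "(W2 \<mu>\<^sub>0 \<mu>\<^sub>1)\<^sup>2 \<le> D" using W2_sq_le[OF M X Y] unfolding law D_def .
    ultimately show ?thesis using e(2) by simp
  qed
  then have "(W2 \<mu>\<^sub>0 \<mu>\<^sub>1)\<^sup>2 \<le> 0" by (rule field_le_epsilon[of _ 0, simplified])
  then show ?thesis using W2_eq_0_iff[OF \<mu>] by simp
qed

end

theorem theorem1p1:
  fixes \<sigma> :: "'a::{real_inner, polish_space} measure set \<Rightarrow> real"
  assumes "signed_measure borel_P2 \<sigma>"
    and "\<sigma> P2 = 1"
    and "(\<integral>\<^sup>+\<nu>. m2sq \<nu> \<partial>total_variation borel_P2 \<sigma>) < \<infinity>"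
  shows "(\<exists>\<mu>. is_arg_min (wass_energy \<sigma>) (\<lambda>\<mu>. \<mu> \<in> P2) \<mu>) \<and>
         ((\<exists>\<nu>\<^sub>0\<in>P2. emeasure (pos_part borel_P2 \<sigma>) (P2 - {\<nu>\<^sub>0}) = 0) \<longrightarrow>
           (\<exists>!\<mu>. is_arg_min (wass_energy \<sigma>) (\<lambda>\<mu>. \<mu> \<in> P2) \<mu>))"
proof -
  interpret signed_P2 \<sigma> by unfold_locales (fact assms)+
  show ?thesis
  proof (intro conjI impI ex_minimizer)
    assume "\<exists>\<nu>\<^sub>0\<in>P2. emeasure pos (P2 - {\<nu>\<^sub>0}) = 0"
    then obtain \<nu>\<^sub>0 where \<nu>\<^sub>0: "\<nu>\<^sub>0 \<in> P2" "emeasure pos (P2 - {\<nu>\<^sub>0}) = 0" by (rule bexE)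
    show "\<exists>!\<mu>. is_arg_min (wass_energy \<sigma>) (\<lambda>\<mu>. \<mu> \<in> P2) \<mu>"
    proof (rule ex_ex1I[OF ex_minimizer])
      fix \<mu>\<^sub>0 \<mu>\<^sub>1
      assume "is_arg_min (wass_energy \<sigma>) (\<lambda>\<mu>. \<mu> \<in> P2) \<mu>\<^sub>0" "is_arg_min (wass_energy \<sigma>) (\<lambda>\<mu>. \<mu> \<in> P2) \<mu>\<^sub>1"
      then show "\<mu>\<^sub>0 = \<mu>\<^sub>1" by (rule minimizer_unique[OF \<nu>\<^sub>0])
    qed
  qed
qed

end
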